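(* Let $\eta>0$, let $Y$ be a block subdiagonal matrix and $N$ an invertible block diagonal matrix (with $N_0=I_{d_0}$) as in the context. The map $\Gamma_N^{(\eta,Y)}$ is a $\tilde G$-equivariant isomorphism of $\mathbf A^{(\eta)}$ onto the Hilbert space $\mathcal H_N^{(\eta,Y)}$, on which the $\tilde G$-action is unitary via the multiplier $J_g^{(\eta,Y)}(z)$, that is, given by $(U_{g^{-1}}f)(z)=J_g^{(\eta,Y)}(z)f(g\cdot z)$. The space $\mathcal H_N^{(\eta,Y)}$ has a reproducing kernel $K_N^{(\eta,Y)}(z,w)$ such that for $0\le\ell\le m$ the $(\ell,\ell)$ block of $K_N^{(\eta,Y)}(0,0)$ is $$\big(K_N^{(\eta,Y)}(0,0)\big)_{\ell\ell}=\sum_{j=0}^{\ell}\frac{1}{(\ell-j)!}\frac{1}{(2\eta+2j)_{\ell-j}}\,Y_\ell\cdots Y_{j+1}N_jN_j^*Y_{j+1}^*\cdots Y_\ell^*.$$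
   Context: $G=\mathrm{SU}(1,1)$ acts on the unit disc $\mathbb D$ by $g\cdot z=(az+b)(cz+d)^{-1}$ for $g=\begin{pmatrix}a&b\\ c&d\end{pmatrix}\in G$ (so $c=\bar b$, $d=\bar a$). $\tilde G$ is the universal covering group of $G$, acting on $\mathbb D$ through $G$. For $g\in\tilde G$, $c_g$ is the lower left entry of the image of $g$ in $G$, $g'(z)$ is the complex derivative of $z\mapsto g\cdot z$, and for real $\lambda$, $g'(z)^\lambda$ is the real analytic function on $\tilde G\times\mathbb D$, holomorphic in $z$, which is given by the principal branch for $g$ near the identity. Pochhammer symbol: $(x)_n=x(x+1)\cdots(x+n-1)$, $(x)_0=1$. Empty products of matrices are identities. Data: $m\ge 0$, $d_0,\dots,d_m\ge1$, $d=d_0+\cdots+d_m$, $\mathbb C^d=\bigoplus_{j=0}^m\mathbb C^{d_j}$; "block" refers to this decomposition. $Y$ is the block matrix whose only nonzero blocks are $Y_j:\mathbb C^{d_{j-1}}\to\mathbb C^{d_j}$ in position $(j,j-1)$, $1\le j\le m$ (arbitrary matrices). $N$ is an invertible block diagonal matrix with diagonal blocks $N_j$ of size $d_j\times d_j$, normalized by $N_0=I_{d_0}$. The multiplier $J_g^{(\eta,Y)}(z)$ is the block matrix with $(p,\ell)$ block $$\frac{1}{(p-\ell)!}(-c_g)^{p-\ell}\,g'(z)^{\eta+\frac{p+\ell}{2}}\,Y_p\cdots Y_{\ell+1}\quad(p\ge\ell),\qquad 0\quad(p<\ell).$$ For $\lambda>0$, $\mathbb A^{(\lambda)}$ is the Hilbert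 space of holomorphic functions on $\mathbb D$ with reproducing kernel $(1-z\bar w)^{-2\lambda}$; $\tilde G$ acts on it unitarily by $(D^{(\lambda)}_{g^{-1}}f)(z)=g'(z)^\lambda f(g\cdot z)$. $\mathbf A^{(\eta)}=\bigoplus_{j=0}^m\mathbb A^{(\eta+j)}\otimes\mathbb C^{d_j}$, with the action $\bigoplus_jD^{(\eta+j)}\otimes I_{d_j}$, viewed as a space of functions $f:\mathbb D\to\mathbb C^d$ with components $f_j:\mathbb D\to\mathbb C^{d_j}$. The linear map $\Gamma^{(\eta,Y)}$ on holomorphic functions is defined by $$(\Gamma^{(\eta,Y)}f)_\ell=\sum_{j=0}^{\ell}\frac{1}{(\ell-j)!}\frac{1}{(2\eta+2j)_{\ell-j}}\,Y_\ell\cdots Y_{j+1}\,f_j^{(\ell-j)},\qquad 0\le\ell\le m,$$ and $\Gamma_N^{(\eta,Y)}=\Gamma^{(\eta,Y)}\circ N$. $\mathcal H_N^{(\eta,Y)}$ is the image of $\mathbf A^{(\eta)}$ under $\Gamma_N^{(\eta,Y)}$ in the space of holomorphic functions $\mathbb D\to\mathbb C^d$, with the norm stipulated by requiring $\Gamma_N^{(\eta,Y)}$ to be a Hilbert space isometry. A reproducing kernel is a $d\times d$ matrix valued function $K(z,w)$ with $K(\cdot,w)\xi$ in the space and $\langle f(w),\xi\rangle_{\mathbb C^d}=\langle f,K(\cdot,w)\xi\rangle$ for all $\xi\in\mathbb C^d$, $w\in\mathbb D$ and all $f$ in the space. *)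

theory Defs
  imports
    "HOL-Complex_Analysis.Complex_Analysis"
    "HOL-Algebra.Group"
    "HOL-Library.Function_Algebras"
begin

abbreviation disc :: "complex set" where
  "disc \<equiv> ball 0 1"

text \<open>
  A function on the disc is represented by its extension by zero, so that equality of functions
  is HOL equality and the pointwise operations (\<^theory>\<open>HOL-Library.Function_Algebras\<close>) apply.
\<close>

definition on_disc :: "(complex \<Rightarrow> 'b::zero) \<Rightarrow> complex \<Rightarrow> 'b" where
  "on_disc f z = (if z \<in> disc then f z else 0)"

definition hilbert_space ::
  "(complex \<Rightarrow> 'v::ab_group_add \<Rightarrow> 'v) \<Rightarrow> 'v set \<Rightarrow> ('v \<Rightarrow> 'v \<Rightarrow> complex) \<Rightarrow> bool"
where
  "hilbert_space sc V ip \<longleftrightarrow>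
     vector_space sc \<and> module.subspace sc V \<and>
     (\<forall>f\<in>V. \<forall>g\<in>V. \<forall>h\<in>V. ip (f + g) h = ip f h + ip g h) \<and>
     (\<forall>c. \<forall>f\<in>V. \<forall>g\<in>V. ip (sc c f) g = c * ip f g) \<and>
     (\<forall>f\<in>V. \<forall>g\<in>V. ip g f = cnj (ip f g)) \<and>
     (\<forall>f\<in>V. f \<noteq> 0 \<longrightarrow> Re (ip f f) > 0) \<and>
     (\<forall>X :: nat \<Rightarrow> 'v. range X \<subseteq> V \<longrightarrow>
        (\<forall>e>0. \<exists>M. \<forall>i\<ge>M. \<forall>j\<ge>M. sqrt (Re (ip (X i - X j) (X i - X j))) < e) \<longrightarrow>
        (\<exists>f\<in>V. (\<lambda>i. sqrt (Re (ip (X i - f) (X i - f)))) \<longlonglongrightarrow> 0))"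

definition scale_fun :: "complex \<Rightarrow> (complex \<Rightarrow> complex) \<Rightarrow> complex \<Rightarrow> complex" where
  "scale_fun c f = (\<lambda>z. c * f z)"

definition scale_vfun ::
  "complex \<Rightarrow> (complex \<Rightarrow> complex ^ 'n) \<Rightarrow> complex \<Rightarrow> complex ^ 'n" where
  "scale_vfun c f = (\<lambda>z. c *s f z)"

definition hol_disc :: "(complex \<Rightarrow> complex) set" where
  "hol_disc = {f. f holomorphic_on disc \<and> (\<forall>z. z \<notin> disc \<longrightarrow> f z = 0)}"

definition hol_disc_vec :: "(complex \<Rightarrow> complex ^ 'n) set" where
  "hol_disc_vec = {f. \<forall>i. (\<lambda>z. f z $ i) \<in> hol_disc}"

definition is_bergman_space ::
  "real \<Rightarrow> (complex \<Rightarrow> complex) set \<Rightarrow>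
    ((complex \<Rightarrow> complex) \<Rightarrow> (complex \<Rightarrow> complex) \<Rightarrow> complex) \<Rightarrow> bool"
where
  "is_bergman_space lam V ip \<longleftrightarrow>
     hilbert_space scale_fun V ip \<and> V \<subseteq> hol_disc \<and>
     (\<forall>w\<in>disc.
        on_disc (\<lambda>z. (1 - z * cnj w) powr of_real (- 2 * lam)) \<in> V \<and>
        (\<forall>f\<in>V. f w = ip f (on_disc (\<lambda>z. (1 - z * cnj w) powr of_real (- 2 * lam)))))"

text \<open>
  For \<open>lam > 0\<close> the space is unique and its inner product is unique on the space (a Hilbert space of
  functions is determined by its reproducing kernel).  The description operator is \<open>SOME\<close>
  rather than \<open>THE\<close> only because the inner product is arbitrary off the space.
\<close>

definition bergman ::
  "real \<Rightarrow> (complex \<Rightarrow> complex) set \<times>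
    ((complex \<Rightarrow> complex) \<Rightarrow> (complex \<Rightarrow> complex) \<Rightarrow> complex)"
where
  "bergman lam = (SOME (V, ip). is_bergman_space lam V ip)"

abbreviation bergman_carrier :: "real \<Rightarrow> (complex \<Rightarrow> complex) set" where
  "bergman_carrier lam \<equiv> fst (bergman lam)"

abbreviation bergman_inner ::
  "real \<Rightarrow> (complex \<Rightarrow> complex) \<Rightarrow> (complex \<Rightarrow> complex) \<Rightarrow> complex" where
  "bergman_inner lam \<equiv> snd (bergman lam)"

definition cinner_vec :: "complex ^ 'n \<Rightarrow> complex ^ 'n \<Rightarrow> complex" where
  "cinner_vec x y = (\<Sum>i\<in>UNIV. x $ i * cnj (y $ i))"

definition has_reproducing_kernel ::
  "(complex \<Rightarrow> complex ^ 'n) set \<Rightarrow>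
    ((complex \<Rightarrow> complex ^ 'n) \<Rightarrow> (complex \<Rightarrow> complex ^ 'n) \<Rightarrow> complex) \<Rightarrow>
    (complex \<Rightarrow> complex \<Rightarrow> complex ^ 'n ^ 'n) \<Rightarrow> bool"
where
  "has_reproducing_kernel V ip K \<longleftrightarrow>
     (\<forall>w\<in>disc. \<forall>\<xi>.
        on_disc (\<lambda>z. K z w *v \<xi>) \<in> V \<and>
        (\<forall>f\<in>V. cinner_vec (f w) \<xi> = ip f (on_disc (\<lambda>z. K z w *v \<xi>))))"

definition adj :: "complex ^ 'n ^ 'm \<Rightarrow> complex ^ 'm ^ 'n" where
  "adj A = (\<chi> i j. cnj (A $ j $ i))"

definition form11 :: "complex ^ 2 ^ 2" where
  "form11 = vector [vector [1, 0], vector [0, -1]]"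

definition SU11 :: "(complex ^ 2 ^ 2) set" where
  "SU11 = {g. adj g ** form11 ** g = form11 \<and> det g = 1}"

definition moebius :: "complex ^ 2 ^ 2 \<Rightarrow> complex \<Rightarrow> complex" where
  "moebius g z = (g $ 1 $ 1 * z + g $ 1 $ 2) / (g $ 2 $ 1 * z + g $ 2 $ 2)"

text \<open>
  The universal covering group is realised in the standard way: its elements are the
  homotopy classes (with fixed end points) of paths in \<open>SU11\<close> that start at the identity,
  multiplied pointwise; the covering map sends a class to the common end point of its paths.
\<close>

definition path_class :: "(real \<Rightarrow> complex ^ 2 ^ 2) \<Rightarrow> (real \<Rightarrow> complex ^ 2 ^ 2) set" where
  "path_class a = {b. homotopic_paths SU11 a b}"

definition SU11_cover :: "(real \<Rightarrow> complex ^ 2 ^ 2) set monoid" where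
  "SU11_cover =
     \<lparr>carrier = {path_class a |a. path a \<and> path_image a \<subseteq> SU11 \<and> pathstart a = mat 1},
      mult = (\<lambda>g h. \<Union>a\<in>g. \<Union>b\<in>h. path_class (\<lambda>t. a t ** b t)),
      one = path_class (\<lambda>t. mat 1)\<rparr>"

definition cover_proj :: "(real \<Rightarrow> complex ^ 2 ^ 2) set \<Rightarrow> complex ^ 2 ^ 2" where
  "cover_proj g = the_elem (pathfinish ` g)"

abbreviation cover_act :: "(real \<Rightarrow> complex ^ 2 ^ 2) set \<Rightarrow> complex \<Rightarrow> complex" where
  "cover_act g \<equiv> moebius (cover_proj g)"

text \<open>
  \<open>log_deriv g z\<close> is the branch of \<open>log g'(z)\<close> obtained by continuation, along any path
  representing \<open>g\<close>, of the principal branch near the identity; hence \<open>deriv_power lam g z\<close> is the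
  branch of \<open>g'(z)^lam\<close> on the covering group that is principal near the identity.
\<close>

definition log_deriv :: "(real \<Rightarrow> complex ^ 2 ^ 2) set \<Rightarrow> complex \<Rightarrow> complex" where
  "log_deriv g z = (THE u. \<exists>a\<in>g. \<exists>l. continuous_on {0..1} l \<and> l 0 = 0 \<and>
      (\<forall>t\<in>{0..1}. exp (l t) = deriv (moebius (a t)) z) \<and> l 1 = u)"

definition deriv_power :: "real \<Rightarrow> (real \<Rightarrow> complex ^ 2 ^ 2) set \<Rightarrow> complex \<Rightarrow> complex" where
  "deriv_power lam g z = exp (of_real lam * log_deriv g z)"

definition D_act ::
  "real \<Rightarrow> (real \<Rightarrow> complex ^ 2 ^ 2) set \<Rightarrow> (complex \<Rightarrow> complex) \<Rightarrow> complex \<Rightarrow> complex"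
where
  "D_act lam g f =
     (let h = inv\<^bsub>SU11_cover\<^esub> g in on_disc (\<lambda>z. deriv_power lam h z * f (cover_act h z)))"

definition unitary_action ::
  "('g, 'b) monoid_scheme \<Rightarrow> (complex \<Rightarrow> 'v::ab_group_add \<Rightarrow> 'v) \<Rightarrow> 'v set \<Rightarrow>
    ('v \<Rightarrow> 'v \<Rightarrow> complex) \<Rightarrow> ('g \<Rightarrow> 'v \<Rightarrow> 'v) \<Rightarrow> bool"
where
  "unitary_action G sc V ip U \<longleftrightarrow>
     (\<forall>g\<in>carrier G.
        U g ` V = V \<and>
        (\<forall>f\<in>V. \<forall>h\<in>V. U g (f + h) = U g f + U g h) \<and>
        (\<forall>c. \<forall>f\<in>V. U g (sc c f) = sc c (U g f)) \<and>
        (\<forall>f\<in>V. \<forall>h\<in>V. ip (U g f) (U g h) = ip f h)) \<and>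
     (\<forall>f\<in>V. U \<one>\<^bsub>G\<^esub> f = f) \<and>
     (\<forall>g\<in>carrier G. \<forall>h\<in>carrier G. \<forall>f\<in>V. U (g \<otimes>\<^bsub>G\<^esub> h) f = U g (U h f))"

text \<open>
  The decomposition of \<open>\<complex>\<^sup>d\<close> into blocks is given by a labelling \<open>blk\<close> of the \<open>d\<close> coordinates:
  the \<open>j\<close>-th summand is spanned by the coordinates with label \<open>j\<close>.  The \<open>(p, l)\<close> block of a
  matrix is kept in place inside the full matrix, with zeros elsewhere, so that matrix
  products of blocks are products of full matrices.
\<close>

definition block :: "('n \<Rightarrow> nat) \<Rightarrow> nat \<Rightarrow> nat \<Rightarrow> complex ^ 'n ^ 'n \<Rightarrow> complex ^ 'n ^ 'n" where
  "block blk p l A = (\<chi> i k. if blk i = p \<and> blk k = l then A $ i $ k else 0)"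

definition block_subdiagonal :: "('n \<Rightarrow> nat) \<Rightarrow> complex ^ 'n ^ 'n \<Rightarrow> bool" where
  "block_subdiagonal blk A \<longleftrightarrow> (\<forall>i k. A $ i $ k \<noteq> 0 \<longrightarrow> blk i = Suc (blk k))"

definition block_diagonal :: "('n \<Rightarrow> nat) \<Rightarrow> complex ^ 'n ^ 'n \<Rightarrow> bool" where
  "block_diagonal blk A \<longleftrightarrow> (\<forall>i k. A $ i $ k \<noteq> 0 \<longrightarrow> blk i = blk k)"

text \<open>\<open>Yprod_steps blk Y l k\<close> is the product \<open>Y\<^sub>l\<^sub>+\<^sub>k \<cdots> Y\<^sub>l\<^sub>+\<^sub>1\<close>, and \<open>Yprod blk Y p l\<close> is \<open>Y\<^sub>p \<cdots> Y\<^sub>l\<^sub>+\<^sub>1\<close> (for \<open>l \<le> p\<close>).\<close>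

primrec Yprod_steps ::
  "('n \<Rightarrow> nat) \<Rightarrow> complex ^ 'n::finite ^ 'n \<Rightarrow> nat \<Rightarrow> nat \<Rightarrow> complex ^ 'n ^ 'n"
where
  "Yprod_steps blk Y l 0 = block blk l l (mat 1)"
| "Yprod_steps blk Y l (Suc k) = block blk (l + Suc k) (l + k) Y ** Yprod_steps blk Y l k"

definition Yprod ::
  "('n \<Rightarrow> nat) \<Rightarrow> complex ^ 'n::finite ^ 'n \<Rightarrow> nat \<Rightarrow> nat \<Rightarrow> complex ^ 'n ^ 'n"
where
  "Yprod blk Y p l = Yprod_steps blk Y l (p - l)"

definition multiplier ::
  "('n \<Rightarrow> nat) \<Rightarrow> real \<Rightarrow> complex ^ 'n::finite ^ 'n \<Rightarrow> (real \<Rightarrow> complex ^ 2 ^ 2) set \<Rightarrow> complex \<Rightarrow>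
    complex ^ 'n ^ 'n"
where
  "multiplier blk \<eta> Y g z = (\<chi> i k. let p = blk i; l = blk k in
     if l \<le> p then
       1 / fact (p - l) * (- (cover_proj g $ 2 $ 1)) ^ (p - l)
       * deriv_power (\<eta> + real (p + l) / 2) g z * Yprod blk Y p l $ i $ k
     else 0)"

definition U_act ::
  "('n \<Rightarrow> nat) \<Rightarrow> real \<Rightarrow> complex ^ 'n::finite ^ 'n \<Rightarrow> (real \<Rightarrow> complex ^ 2 ^ 2) set \<Rightarrow>
    (complex \<Rightarrow> complex ^ 'n) \<Rightarrow> complex \<Rightarrow> complex ^ 'n"
where
  "U_act blk \<eta> Y g f =
     (let h = inv\<^bsub>SU11_cover\<^esub> g in on_disc (\<lambda>z. multiplier blk \<eta> Y h z *v f (cover_act h z)))"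

definition A_carrier :: "('n \<Rightarrow> nat) \<Rightarrow> real \<Rightarrow> (complex \<Rightarrow> complex ^ 'n) set" where
  "A_carrier blk \<eta> = {f. \<forall>i. (\<lambda>z. f z $ i) \<in> bergman_carrier (\<eta> + real (blk i))}"

definition A_inner ::
  "('n \<Rightarrow> nat) \<Rightarrow> real \<Rightarrow> (complex \<Rightarrow> complex ^ 'n) \<Rightarrow> (complex \<Rightarrow> complex ^ 'n) \<Rightarrow> complex"
where
  "A_inner blk \<eta> f g =
     (\<Sum>i\<in>UNIV. bergman_inner (\<eta> + real (blk i)) (\<lambda>z. f z $ i) (\<lambda>z. g z $ i))"

definition A_act ::
  "('n \<Rightarrow> nat) \<Rightarrow> real \<Rightarrow> (real \<Rightarrow> complex ^ 2 ^ 2) set \<Rightarrow>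
    (complex \<Rightarrow> complex ^ 'n) \<Rightarrow> complex \<Rightarrow> complex ^ 'n"
where
  "A_act blk \<eta> g f = (\<lambda>z. \<chi> i. D_act (\<eta> + real (blk i)) g (\<lambda>w. f w $ i) z)"

definition Gam ::
  "('n \<Rightarrow> nat) \<Rightarrow> real \<Rightarrow> complex ^ 'n::finite ^ 'n \<Rightarrow>
    (complex \<Rightarrow> complex ^ 'n) \<Rightarrow> complex \<Rightarrow> complex ^ 'n"
where
  "Gam blk \<eta> Y f = on_disc (\<lambda>z. \<chi> i. let l = blk i in
     \<Sum>j=0..l. 1 / fact (l - j) * (1 / of_real (pochhammer (2 * \<eta> + 2 * real j) (l - j)))
       * (Yprod blk Y l j *v (\<chi> k. (deriv ^^ (l - j)) (\<lambda>w. f w $ k) z)) $ i)"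

definition Gam_N ::
  "('n \<Rightarrow> nat) \<Rightarrow> real \<Rightarrow> complex ^ 'n::finite ^ 'n \<Rightarrow> complex ^ 'n ^ 'n \<Rightarrow>
    (complex \<Rightarrow> complex ^ 'n) \<Rightarrow> complex \<Rightarrow> complex ^ 'n"
where
  "Gam_N blk \<eta> Y N f = Gam blk \<eta> Y (\<lambda>z. N *v f z)"

definition H_carrier ::
  "('n \<Rightarrow> nat) \<Rightarrow> real \<Rightarrow> complex ^ 'n::finite ^ 'n \<Rightarrow> complex ^ 'n ^ 'n \<Rightarrow>
    (complex \<Rightarrow> complex ^ 'n) set"
where
  "H_carrier blk \<eta> Y N = Gam_N blk \<eta> Y N ` A_carrier blk \<eta>"

text \<open>\<open>Gam_N\<close> is injective on \<open>A_carrier\<close>, so this inner product is the one that makes it an isometry.\<close>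

definition H_inner ::
  "('n \<Rightarrow> nat) \<Rightarrow> real \<Rightarrow> complex ^ 'n::finite ^ 'n \<Rightarrow> complex ^ 'n ^ 'n \<Rightarrow>
    (complex \<Rightarrow> complex ^ 'n) \<Rightarrow> (complex \<Rightarrow> complex ^ 'n) \<Rightarrow> complex"
where
  "H_inner blk \<eta> Y N F G =
     A_inner blk \<eta> (inv_into (A_carrier blk \<eta>) (Gam_N blk \<eta> Y N) F)
                   (inv_into (A_carrier blk \<eta>) (Gam_N blk \<eta> Y N) G)"

definition hilbert_isomorphism ::
  "(complex \<Rightarrow> 'v::ab_group_add \<Rightarrow> 'v) \<Rightarrow> 'v set \<Rightarrow> ('v \<Rightarrow> 'v \<Rightarrow> complex) \<Rightarrow>
    'v set \<Rightarrow> ('v \<Rightarrow> 'v \<Rightarrow> complex) \<Rightarrow> ('v \<Rightarrow> 'v) \<Rightarrow> bool"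
where
  "hilbert_isomorphism sc V ip W ip' T \<longleftrightarrow>
     hilbert_space sc V ip \<and> hilbert_space sc W ip' \<and> bij_betw T V W \<and>
     (\<forall>f\<in>V. \<forall>g\<in>V. T (f + g) = T f + T g) \<and>
     (\<forall>c. \<forall>f\<in>V. T (sc c f) = sc c (T f)) \<and>
     (\<forall>f\<in>V. \<forall>g\<in>V. ip' (T f) (T g) = ip f g)"

end

theory Submission
  imports Defs
begin

text \<open>
  The space \<open>A\<close> is a finite direct sum of weighted Bergman spaces, so the theorem follows from scalar
  facts about these spaces and one identity between higher derivatives.

  Bergman spaces.  A Hilbert space of functions is determined by its reproducing kernel, because the
  kernel functions span a dense subspace (\<open>rkhs_unique\<close>).  This is used twice.  First, it identifies
  the Bergman space with the space of power series \<open>\<Sum> a\<^sub>n z\<^sup>n\<close> with \<open>\<Sum> \<bar>a\<^sub>n\<bar>\<^sup>2 / c\<^sub>n < \<infinity>\<close>, where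
  \<open>c\<^sub>n = (2 lam)\<^sub>n / n!\<close> are the coefficients of the kernel; in particular the monomials are orthogonal and
  represent the Taylor coefficients at \<open>0\<close>.  Secondly, it gives unitarity of \<open>f \<mapsto> g'^lam (f \<circ> g)\<close>
  (\<open>weighted_pullback_unitary\<close>): transporting the Hilbert space along this map yields a Hilbert space
  with kernel \<open>g'(z)^lam K(gz, gw) cnj (g'(w)^lam)\<close>, and this is \<open>K(z, w)\<close> again.

  The covering group.  Along a path in \<open>SU(1,1)\<close> from the identity the logarithm of
  \<open>g'(z) = (c z + d)^(-2)\<close> is \<open>- 2 (\<delta> + Ln (1 + c z / d))\<close> with \<open>\<delta>\<close> a continuous logarithm of \<open>d\<close>.
  Relations between such logarithms (the cocycle law, the transformation of the kernel) hold because
  both sides are continuous logarithms of one function along the path that agree at its start.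

  Equivariance.  By induction on \<open>k\<close>,
  \<open>(g'^lam (f \<circ> g))^(k)\<close> is the sum over \<open>i\<close> of
  \<open>(k choose i) pochhammer (2 lam + i) (k - i) (- c)^(k - i) g'^(lam + (k + i) / 2) (f^(i) \<circ> g)\<close>.
  After division by \<open>k! (2 lam)\<^sub>k\<close> the coefficient splits as \<open>1 / (k - i)!\<close> times \<open>1 / (i! (2 lam)\<^sub>i)\<close>.
  The first factor belongs to a block of the multiplier and the second to a block of \<open>\<Gamma>\<close>, while
  the products of the \<open>Y\<^sub>j\<close> compose; summing over blocks gives \<open>Gam_vec_pullback\<close>.

  The map \<open>\<Gamma>\<close> is block triangular with identities on the diagonal, hence injective, and the
  remaining claims about \<open>H\<close> are transported from \<open>A\<close>.  The evaluation \<open>f \<mapsto> (\<Gamma> N f)(0)\<close> is represented by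
  explicit vectors of monomials, and their inner products give the blocks of \<open>K(0, 0)\<close>.  Since the
  group acts transitively and unitarily, evaluation at any other point is represented as well.
\<close>

text \<open>Throughout, \<open>$\<close> denotes the component of a vector, not the coefficient of a power series.\<close>

no_notation fps_nth (infixl "$" 75)

section \<open>Hilbert spaces and reproducing kernels\<close>

locale complex_hilbert_space =
  fixes sc :: "complex \<Rightarrow> 'v::ab_group_add \<Rightarrow> 'v" and V :: "'v set"
    and ip :: "'v \<Rightarrow> 'v \<Rightarrow> complex"
  assumes hilbert: "hilbert_space sc V ip"
begin

sublocale vector_space sc
  using hilbert by (simp add: hilbert_space_def)

lemma subspace_V: "subspace V"
  using hilbert by (simp add: hilbert_space_def)

lemma zero_V: "0 \<in> V" and add_V: "f \<in> V \<Longrightarrow> g \<in> V \<Longrightarrow> f + g \<in> V"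
  and scale_V: "f \<in> V \<Longrightarrow> sc c f \<in> V" and diff_V: "f \<in> V \<Longrightarrow> g \<in> V \<Longrightarrow> f - g \<in> V"
  using subspace_V by (auto simp: subspace_0 subspace_add subspace_scale subspace_diff)

lemmas V_closed = zero_V add_V scale_V diff_V

lemma ip_add_left: "f \<in> V \<Longrightarrow> g \<in> V \<Longrightarrow> h \<in> V \<Longrightarrow> ip (f + g) h = ip f h + ip g h"
  and ip_scale_left: "f \<in> V \<Longrightarrow> g \<in> V \<Longrightarrow> ip (sc c f) g = c * ip f g"
  and ip_sym: "f \<in> V \<Longrightarrow> g \<in> V \<Longrightarrow> ip g f = cnj (ip f g)"
  and ip_pos: "f \<in> V \<Longrightarrow> f \<noteq> 0 \<Longrightarrow> Re (ip f f) > 0"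
  using hilbert unfolding hilbert_space_def by blast+

lemma ip_add_right: "f \<in> V \<Longrightarrow> g \<in> V \<Longrightarrow> h \<in> V \<Longrightarrow> ip h (f + g) = ip h f + ip h g"
  by (metis ip_add_left ip_sym add_V complex_cnj_add)

lemma ip_scale_right: "f \<in> V \<Longrightarrow> g \<in> V \<Longrightarrow> ip g (sc c f) = cnj c * ip g f"
  by (metis ip_scale_left ip_sym scale_V complex_cnj_mult)

lemma ip_diff_left: "f \<in> V \<Longrightarrow> g \<in> V \<Longrightarrow> h \<in> V \<Longrightarrow> ip (f - g) h = ip f h - ip g h"
  using ip_add_left[of "f - g" g h] by (simp add: V_closed)

lemma ip_diff_right: "f \<in> V \<Longrightarrow> g \<in> V \<Longrightarrow> h \<in> V \<Longrightarrow> ip h (f - g) = ip h f - ip h g"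
  using ip_add_right[of "f - g" g h] by (simp add: V_closed)

lemma ip_zero: "f \<in> V \<Longrightarrow> ip 0 f = 0" "f \<in> V \<Longrightarrow> ip f 0 = 0"
  using ip_diff_left[of f f f] ip_diff_right[of f f f] by auto

definition nrm2 :: "'v \<Rightarrow> real" where "nrm2 f = Re (ip f f)"

lemma nrm2_nonneg: "f \<in> V \<Longrightarrow> nrm2 f \<ge> 0"
  using ip_pos[of f] ip_zero(1)[of f] by (cases "f = 0") (auto simp: nrm2_def zero_V intro: less_imp_le)

lemma nrm2_diff_scale:
  assumes "f \<in> V" "g \<in> V"
  shows "nrm2 (f - sc t g) = nrm2 f - 2 * Re (cnj t * ip f g) + (cmod t)\<^sup>2 * nrm2 g"
proof -
  have "ip (f - sc t g) (f - sc t g)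
      = ip f f - cnj t * ip f g - (t * cnj (ip f g) - t * cnj t * ip g g)"
    using assms ip_sym[of f g]
    by (simp add: ip_diff_left ip_diff_right V_closed ip_scale_left ip_scale_right algebra_simps)
  also have "\<dots> = ip f f - (cnj t * ip f g + cnj (cnj t * ip f g)) + of_real ((cmod t)\<^sup>2) * ip g g"
    by (simp add: algebra_simps flip: complex_norm_square)
  finally show ?thesis
    by (simp add: nrm2_def)
qed

lemma Cauchy_Schwarz:
  assumes "f \<in> V" "g \<in> V"
  shows "(cmod (ip f g))\<^sup>2 \<le> nrm2 f * nrm2 g"
proof (cases "g = 0")
  case True
  then show ?thesis using assms by (simp add: ip_zero nrm2_nonneg nrm2_def)
next
  case False
  then have q: "nrm2 g > 0" using assms ip_pos nrm2_def by simp
  \<comment> \<open>the scalar that minimises the norm of \<open>f - t g\<close>\<close>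
  define t where "t = ip f g / of_real (nrm2 g)"
  have "0 \<le> nrm2 (f - sc t g)" using assms by (simp add: nrm2_nonneg V_closed)
  also have "\<dots> = nrm2 f - 2 * Re (cnj t * ip f g) + (cmod t)\<^sup>2 * nrm2 g"
    by (rule nrm2_diff_scale[OF assms])
  also have "cnj t * ip f g = of_real ((cmod (ip f g))\<^sup>2 / nrm2 g)"
    by (simp only: t_def of_real_divide complex_norm_square complex_cnj_divide complex_cnj_complex_of_real) 
       (simp add: mult.commute)
  also have "(cmod t)\<^sup>2 * nrm2 g = (cmod (ip f g))\<^sup>2 / nrm2 g"
    using q by (simp add: t_def norm_divide power_divide power2_eq_square)
  finally show ?thesis using q by (simp add: field_simps)
qed

lemma nrm2_add_le:
  assumes "f \<in> V" "g \<in> V"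
  shows "nrm2 (f + g) \<le> 2 * nrm2 f + 2 * nrm2 g"
proof -
  have "0 \<le> nrm2 (f - g)" using assms by (simp add: nrm2_nonneg V_closed)
  then show ?thesis
    using assms by (simp add: nrm2_def ip_add_left ip_add_right ip_diff_left ip_diff_right V_closed)
qed

lemma complete:
  assumes "range X \<subseteq> V" and "\<And>e. e > 0 \<Longrightarrow> \<exists>M. \<forall>i\<ge>M. \<forall>j\<ge>M. nrm2 (X i - X j) < e"
  obtains f where "f \<in> V" "(\<lambda>i. nrm2 (X i - f)) \<longlonglongrightarrow> 0"
proof -
  have "\<exists>M. \<forall>i\<ge>M. \<forall>j\<ge>M. sqrt (Re (ip (X i - X j) (X i - X j))) < e" if "e > 0" for e
  proof -
    from assms(2)[of "e\<^sup>2"] that obtain M where "\<forall>i\<ge>M. \<forall>j\<ge>M. nrm2 (X i - X j) < e\<^sup>2" by auto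
    then show ?thesis unfolding nrm2_def using that real_less_lsqrt by (metis less_imp_le)
  qed
  with hilbert assms(1) obtain f where f: "f \<in> V"
    and lim: "(\<lambda>i. sqrt (Re (ip (X i - f) (X i - f)))) \<longlonglongrightarrow> 0"
    unfolding hilbert_space_def by blast
  have "Re (ip (X i - f) (X i - f)) \<ge> 0" for i
    using nrm2_nonneg[OF diff_V[OF _ f], of "X i"] assms(1) by (auto simp: nrm2_def)
  then have "(\<lambda>i. nrm2 (X i - f)) \<longlonglongrightarrow> 0"
    using tendsto_power[OF lim, of 2] by (simp add: nrm2_def)
  with f that show ?thesis by blast
qed

lemma ip_tendsto_left:
  assumes "range X \<subseteq> V" "f \<in> V" "g \<in> V" "(\<lambda>i. nrm2 (X i - f)) \<longlonglongrightarrow> 0"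
  shows "(\<lambda>i. ip (X i) g) \<longlonglongrightarrow> ip f g"
proof -
  have X: "X i \<in> V" for i using assms(1) by auto
  have "(\<lambda>i. (cmod (ip (X i) g - ip f g))\<^sup>2) \<longlonglongrightarrow> 0"
  proof (rule tendsto_sandwich[OF _ _ tendsto_const])
    show "(\<lambda>i. nrm2 (X i - f) * nrm2 g) \<longlonglongrightarrow> 0"
      using tendsto_mult_right[OF assms(4), of "nrm2 g"] by simp
    show "\<forall>\<^sub>F i in sequentially. (cmod (ip (X i) g - ip f g))\<^sup>2 \<le> nrm2 (X i - f) * nrm2 g"
      using Cauchy_Schwarz[OF diff_V[OF X assms(2)] assms(3)] X assms by (simp add: ip_diff_left)
  qed auto
  from tendsto_real_sqrt[OF this] have "(\<lambda>i. ip (X i) g - ip f g) \<longlonglongrightarrow> 0"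
    using tendsto_norm_zero_iff by auto
  then show ?thesis by (simp add: LIM_zero_iff)
qed

lemma ip_tendsto_right:
  assumes "range X \<subseteq> V" "f \<in> V" "g \<in> V" "(\<lambda>i. nrm2 (X i - f)) \<longlonglongrightarrow> 0"
  shows "(\<lambda>i. ip g (X i)) \<longlonglongrightarrow> ip g f"
proof -
  have "(\<lambda>i. cnj (ip (X i) g)) \<longlonglongrightarrow> cnj (ip f g)"
    by (intro tendsto_cnj ip_tendsto_left assms)
  moreover have "cnj (ip (X i) g) = ip g (X i)" for i
    using assms(1,3) by (metis ip_sym rangeI subsetD)
  ultimately show ?thesis using ip_sym[OF assms(2,3)] by simp
qed

lemma tendsto_imp_Cauchy:
  assumes "range X \<subseteq> V" "f \<in> V" "(\<lambda>i. nrm2 (X i - f)) \<longlonglongrightarrow> 0" "e > 0"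
  shows "\<exists>M. \<forall>i\<ge>M. \<forall>j\<ge>M. nrm2 (X i - X j) < e"
proof -
  have "eventually (\<lambda>i. nrm2 (X i - f) < e / 4) sequentially"
    by (rule order_tendstoD(2)[OF assms(3)]) (use assms(4) in simp)
  then obtain M where M: "\<And>i. i \<ge> M \<Longrightarrow> nrm2 (X i - f) < e / 4"
    by (auto simp: eventually_sequentially)
  have "nrm2 (X i - X j) < e" if "i \<ge> M" "j \<ge> M" for i j
  proof -
    have XV: "X i \<in> V" "X j \<in> V" using assms(1) by auto
    have "nrm2 (f - X j) = nrm2 (X j - f)"
      using assms(2) XV by (simp add: nrm2_def ip_diff_left ip_diff_right V_closed)
    moreover have "nrm2 (X i - f + (f - X j)) \<le> 2 * nrm2 (X i - f) + 2 * nrm2 (f - X j)"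
      by (intro nrm2_add_le diff_V XV assms)
    ultimately show ?thesis using M[OF that(1)] M[OF that(2)] by simp
  qed
  then show ?thesis by blast
qed

text \<open>
  This is the part of the projection theorem that density arguments need.  The sequence minimises the
  distance from \<open>f\<close> to \<open>S\<close>; the parallelogram law makes it Cauchy, and comparison with
  \<open>s\<^sub>n + t g\<close> for the best scalar \<open>t\<close> shows that \<open>f - s\<^sub>n\<close> becomes orthogonal to every \<open>g \<in> S\<close>.
\<close>

lemma minimizing_sequence:
  assumes S: "subspace S" "S \<subseteq> V" and f: "f \<in> V"
  obtains s :: "nat \<Rightarrow> 'v" and p where "range s \<subseteq> S" "p \<in> V"
    "(\<lambda>n. nrm2 (s n - p)) \<longlonglongrightarrow> 0" "\<And>g. g \<in> S \<Longrightarrow> (\<lambda>n. ip (f - s n) g) \<longlonglongrightarrow> 0"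
proof -
  define d where "d = (INF s\<in>S. nrm2 (f - s))"
  have bdd: "bdd_below ((\<lambda>s. nrm2 (f - s)) ` S)"
    by (rule bdd_belowI[of _ 0]) (use S f in \<open>auto intro!: nrm2_nonneg diff_V\<close>)
  have ne: "S \<noteq> {}" using S(1) subspace_0 by blast
  have d_le: "d \<le> nrm2 (f - s)" if "s \<in> S" for s
    unfolding d_def by (rule cINF_lower[OF bdd that])
  have "\<exists>s\<in>S. nrm2 (f - s) < d + 1 / Suc n" for n
    using cINF_less_iff[OF ne bdd, of "d + 1 / Suc n"] by (simp flip: d_def)
  then obtain s where sS: "\<And>n. s n \<in> S" and s: "\<And>n. nrm2 (f - s n) < d + 1 / Suc n"
    by metis
  have sV: "s n \<in> V" for n using sS S by auto
  have small: "nrm2 (s i - s j) < 2 / Suc i + 2 / Suc j" for i j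
  proof -
    let ?a = "f - s i" and ?b = "f - s j" and ?c = "f - sc (1/2) (s i + s j)"
    have V: "s i \<in> V" "s j \<in> V" "f \<in> V" using sV f by auto
    have "4 * nrm2 ?c + nrm2 (s i - s j) = 2 * nrm2 ?a + 2 * nrm2 ?b"
      using V by (simp add: nrm2_def ip_diff_left ip_diff_right ip_add_left ip_add_right
          ip_scale_left ip_scale_right V_closed field_simps)
    moreover have "d \<le> nrm2 ?c"
      by (intro d_le subspace_scale subspace_add S sS)
    ultimately show ?thesis using s[of i] s[of j] by simp
  qed
  obtain p where p: "p \<in> V" "(\<lambda>n. nrm2 (s n - p)) \<longlonglongrightarrow> 0"
  proof (rule complete)
    show "range s \<subseteq> V" using sV by auto
    fix e :: real assume "e > 0"
    then obtain M where M: "1 / real (Suc M) < e / 4"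
      using nat_approx_posE[of "e / 4"] by auto
    have "nrm2 (s i - s j) < e" if "i \<ge> M" "j \<ge> M" for i j
    proof -
      have "1 / real (Suc i) \<le> 1 / real (Suc M)" "1 / real (Suc j) \<le> 1 / real (Suc M)"
        using that by (simp_all add: frac_le)
      then show ?thesis using small[of i j] M by simp
    qed
    then show "\<exists>M. \<forall>i\<ge>M. \<forall>j\<ge>M. nrm2 (s i - s j) < e" by blast
  qed auto
  have orth: "(\<lambda>n. ip (f - s n) g) \<longlonglongrightarrow> 0" if g: "g \<in> S" for g
  proof (cases "g = 0")
    case True
    then show ?thesis using f sV by (simp add: ip_zero V_closed)
  next
    case False
    have gV: "g \<in> V" using g S by auto
    then have q: "nrm2 g > 0" using False ip_pos nrm2_def by simp
    have bound: "(cmod (ip (f - s n) g))\<^sup>2 \<le> nrm2 g * (1 / real (Suc n))" for n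
    proof -
      define t where "t = ip (f - s n) g / of_real (nrm2 g)"
      have "d \<le> nrm2 (f - (s n + sc t g))"
        by (intro d_le subspace_scale subspace_add S sS g)
      also have "f - (s n + sc t g) = (f - s n) - sc t g" by simp
      also have "nrm2 \<dots> = nrm2 (f - s n) - 2 * Re (cnj t * ip (f - s n) g) + (cmod t)\<^sup>2 * nrm2 g"
        by (intro nrm2_diff_scale gV diff_V f sV)
      also have "cnj t * ip (f - s n) g = of_real ((cmod (ip (f - s n) g))\<^sup>2 / nrm2 g)"
        by (simp only: t_def of_real_divide complex_norm_square complex_cnj_divide complex_cnj_complex_of_real)
           (simp add: mult.commute)
      also have "(cmod t)\<^sup>2 * nrm2 g = (cmod (ip (f - s n) g))\<^sup>2 / nrm2 g"
        using q by (simp add: t_def norm_divide power_divide power2_eq_square)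
      finally have "(cmod (ip (f - s n) g))\<^sup>2 / nrm2 g \<le> 1 / real (Suc n)"
        using s[of n] by simp
      then show ?thesis using q by (simp add: field_simps)
    qed
    have "(\<lambda>n. (cmod (ip (f - s n) g))\<^sup>2) \<longlonglongrightarrow> 0"
    proof (rule tendsto_sandwich[OF _ _ tendsto_const])
      show "(\<lambda>n. nrm2 g * (1 / real (Suc n))) \<longlonglongrightarrow> 0"
        using tendsto_mult_right_zero[OF LIMSEQ_inverse_real_of_nat] by (simp add: divide_inverse)
      show "\<forall>\<^sub>F n in sequentially. (cmod (ip (f - s n) g))\<^sup>2 \<le> nrm2 g * (1 / real (Suc n))"
        using bound by (intro always_eventually) blast
    qed auto
    from tendsto_real_sqrt[OF this] show ?thesis using tendsto_norm_zero_iff by auto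
  qed
  show thesis by (rule that[of s p]) (use sS p orth in auto)
qed

end

text \<open>
  Completeness only needs to be checked for the squared norm, which avoids square roots in every
  concrete verification.
\<close>

lemma hilbert_spaceI:
  assumes "vector_space sc" "module.subspace sc V"
    and "\<And>f g h. f \<in> V \<Longrightarrow> g \<in> V \<Longrightarrow> h \<in> V \<Longrightarrow> ip (f + g) h = ip f h + ip g h"
    and "\<And>c f g. f \<in> V \<Longrightarrow> g \<in> V \<Longrightarrow> ip (sc c f) g = c * ip f g"
    and "\<And>f g. f \<in> V \<Longrightarrow> g \<in> V \<Longrightarrow> ip g f = cnj (ip f g)"
    and pos: "\<And>f. f \<in> V \<Longrightarrow> f \<noteq> 0 \<Longrightarrow> Re (ip f f) > 0"
    and complete: "\<And>X. range X \<subseteq> V \<Longrightarrow>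
          (\<And>e. e > 0 \<Longrightarrow> \<exists>M. \<forall>i\<ge>M. \<forall>j\<ge>M. Re (ip (X i - X j) (X i - X j)) < e) \<Longrightarrow>
          \<exists>f\<in>V. (\<lambda>i. Re (ip (X i - f) (X i - f))) \<longlonglongrightarrow> 0"
  shows "hilbert_space sc V ip"
proof -
  have "\<exists>f\<in>V. (\<lambda>i. sqrt (Re (ip (X i - f) (X i - f)))) \<longlonglongrightarrow> 0"
    if XV: "range X \<subseteq> V"
      and C: "\<forall>e>0. \<exists>M. \<forall>i\<ge>M. \<forall>j\<ge>M. sqrt (Re (ip (X i - X j) (X i - X j))) < e" for X
  proof -
    have "\<exists>M. \<forall>i\<ge>M. \<forall>j\<ge>M. Re (ip (X i - X j) (X i - X j)) < e" if "e > 0" for e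
    proof -
      from C that obtain M where "\<forall>i\<ge>M. \<forall>j\<ge>M. sqrt (Re (ip (X i - X j) (X i - X j))) < sqrt e"
        by (metis real_sqrt_gt_0_iff)
      then show ?thesis by auto
    qed
    from complete[OF XV this] show ?thesis
      using tendsto_real_sqrt by fastforce
  qed
  with assms show ?thesis unfolding hilbert_space_def by blast
qed

lemma hilbert_space_transport:
  assumes hs: "hilbert_space sc V ip" and "vector_space sc'"
    and add: "\<And>f g. f \<in> V \<Longrightarrow> g \<in> V \<Longrightarrow> T (f + g) = T f + T g"
    and scale: "\<And>c f. f \<in> V \<Longrightarrow> T (sc c f) = sc' c (T f)"
    and ip': "\<And>f g. f \<in> V \<Longrightarrow> g \<in> V \<Longrightarrow> ip' (T f) (T g) = ip f g"
  shows "hilbert_space sc' (T ` V) ip'"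
proof -
  interpret complex_hilbert_space sc V ip by unfold_locales fact
  interpret W: vector_space sc' by fact
  have T0: "T 0 = 0" using scale[OF zero_V, of 0] by simp
  have diff: "T (f - g) = T f - T g" if "f \<in> V" "g \<in> V" for f g
    using add[of "f - g" g] that by (simp add: V_closed algebra_simps)
  show ?thesis
  proof (rule hilbert_spaceI)
    show "W.subspace (T ` V)"
      unfolding W.subspace_def using T0 add scale V_closed by (auto simp: image_iff) metis+
    show "\<exists>f\<in>T ` V. (\<lambda>i. Re (ip' (X i - f) (X i - f))) \<longlonglongrightarrow> 0"
      if XV: "range X \<subseteq> T ` V"
        and C: "\<And>e. e > 0 \<Longrightarrow> \<exists>M. \<forall>i\<ge>M. \<forall>j\<ge>M. Re (ip' (X i - X j) (X i - X j)) < e" for X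
    proof -
      from XV have "\<forall>i. \<exists>x\<in>V. X i = T x" by auto
      then obtain x where x: "\<And>i. x i \<in> V" "\<And>i. X i = T (x i)" by metis
      have eq: "Re (ip' (X i - T f) (X i - T f)) = nrm2 (x i - f)" if "f \<in> V" for i f
        using that x by (simp add: nrm2_def ip' V_closed flip: diff)
      obtain f where "f \<in> V" "(\<lambda>i. nrm2 (x i - f)) \<longlonglongrightarrow> 0"
      proof (rule complete)
        show "\<exists>M. \<forall>i\<ge>M. \<forall>j\<ge>M. nrm2 (x i - x j) < e" if "e > 0" for e
          using C[OF that] x(2) eq[OF x(1)] by simp
      qed (use x in auto)
      then show "\<exists>f\<in>T ` V. (\<lambda>i. Re (ip' (X i - f) (X i - f))) \<longlonglongrightarrow> 0"
        using eq by auto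
    qed
    show "ip' g f = cnj (ip' f g)" if "f \<in> T ` V" "g \<in> T ` V" for f g
      using that ip' ip_sym by (metis imageE)
    show "Re (ip' f f) > 0" if "f \<in> T ` V" "f \<noteq> 0" for f
      using that ip' ip_pos T0 by (metis imageE)
  qed (auto simp flip: add scale simp: ip' V_closed ip_add_left ip_scale_left \<open>vector_space sc'\<close>)
qed

lemma vector_space_scale_fun: "vector_space scale_fun"
  by unfold_locales (auto simp: scale_fun_def algebra_simps)

lemma vector_space_scale_vfun: "vector_space scale_vfun"
  by unfold_locales (auto simp: scale_vfun_def vec_eq_iff algebra_simps)

text \<open>
  Members vanish off the disc, so they are equal as soon as the kernel functions cannot tell them apart.
\<close>

definition rkhs ::
  "(complex \<Rightarrow> complex \<Rightarrow> complex) \<Rightarrow> (complex \<Rightarrow> complex) set \<Rightarrow>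
    ((complex \<Rightarrow> complex) \<Rightarrow> (complex \<Rightarrow> complex) \<Rightarrow> complex) \<Rightarrow> bool" where
  "rkhs k V ip \<longleftrightarrow> hilbert_space scale_fun V ip \<and> (\<forall>f\<in>V. \<forall>z. z \<notin> disc \<longrightarrow> f z = 0) \<and>
     (\<forall>w\<in>disc. k w \<in> V \<and> (\<forall>f\<in>V. f w = ip f (k w)))"

text \<open>
  The limit \<open>p\<close> of a minimising sequence in the span agrees with \<open>f\<close> at each point \<open>w\<close>, because
  \<open>f - s\<^sub>n\<close> becomes orthogonal to the kernel function at \<open>w\<close>.
\<close>

lemma rkhs_kernels_dense:
  assumes "rkhs k V ip" "f \<in> V"
  obtains s :: "nat \<Rightarrow> complex \<Rightarrow> complex"
  where "range s \<subseteq> module.span scale_fun (k ` disc)" "(\<lambda>n. Re (ip (s n - f) (s n - f))) \<longlonglongrightarrow> 0"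
proof -
  interpret complex_hilbert_space scale_fun V ip
    using assms(1) by unfold_locales (simp add: rkhs_def)
  have kV: "k w \<in> V" and ev: "g \<in> V \<Longrightarrow> g w = ip g (k w)" if "w \<in> disc" for w g
    using assms(1) that by (auto simp: rkhs_def)
  have "span (k ` disc) \<subseteq> V" by (rule span_minimal) (use kV subspace_V in auto)
  then obtain s p where s: "range s \<subseteq> span (k ` disc)" and p: "p \<in> V" "(\<lambda>n. nrm2 (s n - p)) \<longlonglongrightarrow> 0"
    and orth: "\<And>g. g \<in> span (k ` disc) \<Longrightarrow> (\<lambda>n. ip (f - s n) g) \<longlonglongrightarrow> 0"
    using minimizing_sequence[OF subspace_span _ assms(2)] by metis
  have sV: "s n \<in> V" for n using s \<open>span (k ` disc) \<subseteq> V\<close> by auto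
  have "p w = f w" for w
  proof (cases "w \<in> disc")
    case True
    have "(\<lambda>n. ip (f - s n) (k w)) \<longlonglongrightarrow> ip f (k w) - ip p (k w)"
      using tendsto_diff[OF tendsto_const ip_tendsto_left[OF _ p(1) kV[OF True] p(2)], of "ip f (k w)"]
        sV assms(2) kV[OF True] by (simp add: ip_diff_left image_subset_iff)
    moreover have "(\<lambda>n. ip (f - s n) (k w)) \<longlonglongrightarrow> 0"
      by (intro orth span_base) (use True in auto)
    ultimately have "ip f (k w) - ip p (k w) = 0" by (rule LIMSEQ_unique)
    then show ?thesis using ev[OF True] p(1) assms(2) by simp
  next
    case False
    then show ?thesis using assms p(1) by (metis rkhs_def)
  qed
  then have "p = f" by auto
  with that s p(2) show ?thesis by (simp add: nrm2_def)
qed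

text \<open>
  On the span of the kernel functions both inner products are given by the kernel.  A sequence
  in the span that converges to \<open>f\<close> in the first space is therefore Cauchy in the second one, and its
  limits in the two spaces coincide since both convergences imply pointwise convergence.
\<close>

theorem rkhs_unique:
  assumes V: "rkhs k V ip" and W: "rkhs k W ip'"
  shows "V = W" and "f \<in> V \<Longrightarrow> g \<in> V \<Longrightarrow> ip f g = ip' f g"
proof -
  have main: "f \<in> W \<and> (\<exists>s. range s \<subseteq> V \<inter> W \<and> (\<forall>n. \<forall>h\<in>V \<inter> W. ip h (s n) = ip' h (s n)) \<and>
      (\<lambda>n. Re (ip (s n - f) (s n - f))) \<longlonglongrightarrow> 0 \<and> (\<lambda>n. Re (ip' (s n - f) (s n - f))) \<longlonglongrightarrow> 0)"
    if V: "rkhs k V ip" and W: "rkhs k W ip'" and fV: "f \<in> V" for V ip W ip' f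
  proof -
    interpret V: complex_hilbert_space scale_fun V ip
      using V by unfold_locales (simp add: rkhs_def)
    interpret W: complex_hilbert_space scale_fun W ip'
      using W by unfold_locales (simp add: rkhs_def)
    have kV: "k w \<in> V" and evV: "g \<in> V \<Longrightarrow> g w = ip g (k w)" if "w \<in> disc" for w g
      using V that by (auto simp: rkhs_def)
    have kW: "k w \<in> W" and evW: "g \<in> W \<Longrightarrow> g w = ip' g (k w)" if "w \<in> disc" for w g
      using W that by (auto simp: rkhs_def)
    \<comment> \<open>a subspace on which the two inner products agree and which contains the kernel functions\<close>
    let ?E = "{s \<in> V \<inter> W. \<forall>h\<in>V \<inter> W. ip h s = ip' h s}"
    have "V.subspace ?E"
      unfolding V.subspace_def using V.V_closed W.V_closed
      by (auto simp: V.ip_zero W.ip_zero V.ip_add_right W.ip_add_right V.ip_scale_right W.ip_scale_right)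
    moreover have "k ` disc \<subseteq> ?E"
      using kV kW evV evW by (auto simp del: mem_ball)
    ultimately have E: "V.span (k ` disc) \<subseteq> ?E" by (rule V.span_minimal[rotated])
    obtain s where s: "range s \<subseteq> V.span (k ` disc)" and lim: "(\<lambda>n. V.nrm2 (s n - f)) \<longlonglongrightarrow> 0"
      using rkhs_kernels_dense[OF V fV] unfolding V.nrm2_def by blast
    have sE: "s n \<in> ?E" for n using s E by blast
    have eq: "W.nrm2 (s i - s j) = V.nrm2 (s i - s j)" for i j
    proof -
      have "s i - s j \<in> ?E"
        using s by (intro subsetD[OF E] V.span_diff) auto
      then show ?thesis by (simp add: V.nrm2_def W.nrm2_def)
    qed
    obtain h where h: "h \<in> W" "(\<lambda>n. W.nrm2 (s n - h)) \<longlonglongrightarrow> 0"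
    proof (rule W.complete)
      show "range s \<subseteq> W" using sE by auto
      show "\<exists>M. \<forall>i\<ge>M. \<forall>j\<ge>M. W.nrm2 (s i - s j) < e" if "e > 0" for e
        unfolding eq by (rule V.tendsto_imp_Cauchy[OF _ fV lim that]) (use sE in auto)
    qed auto
    have "h w = f w" for w
    proof (cases "w \<in> disc")
      case True
      have "(\<lambda>n. ip (s n) (k w)) \<longlonglongrightarrow> ip f (k w)"
        using sE by (intro V.ip_tendsto_left fV kV[OF True] lim) auto
      moreover have "(\<lambda>n. ip' (s n) (k w)) \<longlonglongrightarrow> ip' h (k w)"
        using sE by (intro W.ip_tendsto_left h kW[OF True]) auto
      moreover have "ip (s n) (k w) = ip' (s n) (k w)" for n
        using evV[OF True, of "s n"] evW[OF True, of "s n"] sE[of n] by simp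
      ultimately have "ip f (k w) = ip' h (k w)" using LIMSEQ_unique by auto
      then show ?thesis using evV[OF True fV] evW[OF True h(1)] by simp
    next
      case False
      then show ?thesis using V W fV h(1) by (metis rkhs_def)
    qed
    then have "h = f" by auto
    with h lim sE show ?thesis unfolding V.nrm2_def W.nrm2_def by (intro conjI exI[of _ s]) auto
  qed
  show VW: "V = W" using main[OF V W] main[OF W V] by blast
  assume f: "f \<in> V" and g: "g \<in> V"
  interpret V: complex_hilbert_space scale_fun V ip
    using V by unfold_locales (simp add: rkhs_def)
  interpret W: complex_hilbert_space scale_fun V ip'
    using W VW by unfold_locales (simp add: rkhs_def)
  from main[OF V W g] VW obtain s where s: "range s \<subseteq> V" "\<And>n. \<forall>h\<in>V. ip h (s n) = ip' h (s n)"
    "(\<lambda>n. V.nrm2 (s n - g)) \<longlonglongrightarrow> 0" "(\<lambda>n. W.nrm2 (s n - g)) \<longlonglongrightarrow> 0"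
    unfolding V.nrm2_def W.nrm2_def by auto
  have "(\<lambda>n. ip f (s n)) \<longlonglongrightarrow> ip f g" "(\<lambda>n. ip' f (s n)) \<longlonglongrightarrow> ip' f g"
    by (intro V.ip_tendsto_right W.ip_tendsto_right f g s)+
  with s(2) f show "ip f g = ip' f g" using LIMSEQ_unique by auto
qed

section \<open>Weighted Bergman spaces as weighted sequence spaces\<close>

definition taylor_coeff :: "(complex \<Rightarrow> complex) \<Rightarrow> nat \<Rightarrow> complex" where
  "taylor_coeff f n = (deriv ^^ n) f 0 / fact n"

lemma taylor_coeff_sums:
  assumes "f \<in> hol_disc" "z \<in> disc"
  shows "(\<lambda>n. taylor_coeff f n * z ^ n) sums f z"
  using holomorphic_power_series[of f 0 1 z] assms by (simp add: hol_disc_def taylor_coeff_def)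

lemma taylor_coeff_eqI:
  assumes "\<And>z. z \<in> disc \<Longrightarrow> (\<lambda>n. a n * z ^ n) sums f z"
  shows "taylor_coeff f n = a n"
proof -
  have "\<forall>\<^sub>F z in nhds 0. z \<in> disc" by (intro eventually_nhds_in_open) auto
  then have "f has_fps_expansion Abs_fps a"
    by (intro has_fps_expansionI) (auto elim!: eventually_mono intro!: assms)
  from fps_nth_fps_expansion[OF this, of n] show ?thesis by (simp add: taylor_coeff_def)
qed

lemma taylor_coeff_add: "f \<in> hol_disc \<Longrightarrow> g \<in> hol_disc \<Longrightarrow> taylor_coeff (f + g) n = taylor_coeff f n + taylor_coeff g n"
  by (intro taylor_coeff_eqI) (auto simp: ring_distribs intro!: sums_add taylor_coeff_sums)

lemma taylor_coeff_scale: "f \<in> hol_disc \<Longrightarrow> taylor_coeff (scale_fun c f) n = c * taylor_coeff f n"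
  by (intro taylor_coeff_eqI) (auto simp: scale_fun_def mult.assoc intro!: sums_mult taylor_coeff_sums)

lemma taylor_coeff_diff: "f \<in> hol_disc \<Longrightarrow> g \<in> hol_disc \<Longrightarrow> taylor_coeff (f - g) n = taylor_coeff f n - taylor_coeff g n"
  by (intro taylor_coeff_eqI) (auto simp: ring_distribs intro!: sums_diff taylor_coeff_sums)

lemma hol_disc_eqI:
  assumes "f \<in> hol_disc" "g \<in> hol_disc" "\<And>n. taylor_coeff f n = taylor_coeff g n"
  shows "f = g"
proof
  fix z
  show "f z = g z"
    using taylor_coeff_sums[OF assms(1), of z] taylor_coeff_sums[OF assms(2), of z] assms
    by (cases "z \<in> disc") (auto dest: sums_unique2 simp: hol_disc_def)
qed

lemma hol_disc_closed:
  "0 \<in> hol_disc" "f \<in> hol_disc \<Longrightarrow> g \<in> hol_disc \<Longrightarrow> f + g \<in> hol_disc"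
  "f \<in> hol_disc \<Longrightarrow> scale_fun c f \<in> hol_disc"
  "f \<in> hol_disc \<Longrightarrow> g \<in> hol_disc \<Longrightarrow> f - g \<in> hol_disc"
  by (auto simp: hol_disc_def scale_fun_def plus_fun_def fun_diff_def zero_fun_def
      intro!: holomorphic_intros)

lemma on_disc_hol: "f holomorphic_on disc \<Longrightarrow> on_disc f \<in> hol_disc"
  using holomorphic_cong[of disc disc "on_disc f" f] by (simp add: hol_disc_def on_disc_def)

lemma on_disc_power_series:
  assumes "\<And>z. z \<in> disc \<Longrightarrow> summable (\<lambda>n. a n * z ^ n)"
  defines "f \<equiv> on_disc (\<lambda>z. \<Sum>n. a n * z ^ n)"
  shows "f \<in> hol_disc" "taylor_coeff f n = a n"
proof -
  have s: "(\<lambda>n. a n * z ^ n) sums f z" if "z \<in> disc" for z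
    using assms(1)[OF that] that by (auto simp: f_def on_disc_def)
  then have "f holomorphic_on disc"
    by (intro power_series_holomorphic[of 0 1 a]) auto
  then show "f \<in> hol_disc" by (auto simp: hol_disc_def f_def on_disc_def)
  show "taylor_coeff f n = a n" using s by (rule taylor_coeff_eqI)
qed

text \<open>
  The coefficients of the binomial series \<open>(1 - x)^(- 2 lam) = \<Sum> c\<^sub>n x\<^sup>n\<close>.
\<close>

definition binom_weight :: "real \<Rightarrow> nat \<Rightarrow> real" where
  "binom_weight lam n = pochhammer (2 * lam) n / fact n"

lemma binom_weight_pos: "lam > 0 \<Longrightarrow> binom_weight lam n > 0"
  by (simp add: binom_weight_def pochhammer_pos)

lemma binomial_series:
  assumes "cmod x < 1"
  shows "(\<lambda>n. of_real (binom_weight lam n) * x ^ n) sums (1 - x) powr of_real (- 2 * lam)"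
proof -
  have "(\<lambda>n. (of_real (- 2 * lam) gchoose n) * (- x) ^ n) sums (1 + - x) powr of_real (- 2 * lam)"
    using assms by (intro gen_binomial_complex) auto
  moreover have "(of_real (- 2 * lam) gchoose n) * (- x) ^ n = of_real (binom_weight lam n) * x ^ n" for n
  proof -
    have "(of_real (- 2 * lam) gchoose n) * (- x) ^ n
        = (- 1) ^ n * (- x) ^ n * (pochhammer (of_real (2 * lam)) n / fact n)"
      by (simp add: gbinomial_pochhammer)
    also have "(- 1) ^ n * (- x) ^ n = x ^ n" by (simp flip: power_mult_distrib)
    also have "pochhammer (of_real (2 * lam)) n / fact n = complex_of_real (binom_weight lam n)"
      by (simp only: binom_weight_def pochhammer_of_real of_real_divide of_real_fact)
    finally show ?thesis by simp
  qed
  ultimately show ?thesis by simp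
qed

lemma binom_weight_summable:
  assumes "0 \<le> r" "r < 1"
  shows "summable (\<lambda>n. binom_weight lam n * r ^ n)"
proof -
  have "summable (\<lambda>n. complex_of_real (binom_weight lam n * r ^ n))"
    using sums_summable[OF binomial_series[of "of_real r" lam]] assms by simp
  then show ?thesis by (simp only: summable_of_real_iff)
qed

definition weighted_l2 :: "(nat \<Rightarrow> real) \<Rightarrow> (nat \<Rightarrow> complex) \<Rightarrow> bool" where
  "weighted_l2 w a \<longleftrightarrow> summable (\<lambda>n. (cmod (a n))\<^sup>2 / w n)"

lemma norm_add_square_le: "(cmod (a + b))\<^sup>2 \<le> 2 * (cmod a)\<^sup>2 + 2 * (cmod b)\<^sup>2"
proof -
  have "(cmod (a + b))\<^sup>2 \<le> (cmod a + cmod b)\<^sup>2" by (simp add: norm_triangle_ineq power_mono)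
  also have "\<dots> \<le> 2 * (cmod a)\<^sup>2 + 2 * (cmod b)\<^sup>2"
    using sum_squares_bound[of "cmod a" "cmod b"] by (simp add: power2_sum)
  finally show ?thesis .
qed

lemma weighted_l2_add:
  assumes "\<And>n. w n > 0" "weighted_l2 w a" "weighted_l2 w b"
  shows "weighted_l2 w (\<lambda>n. a n + b n)"
  unfolding weighted_l2_def
proof (rule summable_comparison_test')
  show "summable (\<lambda>n. 2 * ((cmod (a n))\<^sup>2 / w n) + 2 * ((cmod (b n))\<^sup>2 / w n))"
    using assms(2,3) unfolding weighted_l2_def by (intro summable_add summable_mult)
  show "norm ((cmod (a n + b n))\<^sup>2 / w n) \<le> 2 * ((cmod (a n))\<^sup>2 / w n) + 2 * ((cmod (b n))\<^sup>2 / w n)" for n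
    using norm_add_square_le[of "a n" "b n"] assms(1)[of n] by (simp add: field_simps)
qed

lemma weighted_l2_scale: "weighted_l2 w a \<Longrightarrow> weighted_l2 w (\<lambda>n. c * a n)"
  using summable_mult[of "\<lambda>n. (cmod (a n))\<^sup>2 / w n" "(cmod c)\<^sup>2"]
  by (simp add: weighted_l2_def norm_mult power_mult_distrib)

lemma weighted_l2_diff:
  assumes "\<And>n. w n > 0" "weighted_l2 w a" "weighted_l2 w b"
  shows "weighted_l2 w (\<lambda>n. a n - b n)"
  using weighted_l2_add[OF assms(1,2) weighted_l2_scale[OF assms(3), of "-1"]] by simp

lemma weighted_l2_mult_summable:
  assumes "\<And>n. w n > 0" "weighted_l2 w a" "weighted_l2 w b"
  shows "summable (\<lambda>n. a n * cnj (b n) / of_real (w n))"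
proof (rule summable_comparison_test')
  show "summable (\<lambda>n. (cmod (a n))\<^sup>2 / w n + (cmod (b n))\<^sup>2 / w n)"
    using assms(2,3) unfolding weighted_l2_def by (rule summable_add)
  fix n
  have "cmod (a n) * cmod (b n) \<le> (cmod (a n))\<^sup>2 + (cmod (b n))\<^sup>2"
    using sum_squares_bound[of "cmod (a n)" "cmod (b n)"]
      mult_nonneg_nonneg[OF norm_ge_zero norm_ge_zero, of "a n" "b n"] by linarith
  then show "norm (a n * cnj (b n) / of_real (w n)) \<le> (cmod (a n))\<^sup>2 / w n + (cmod (b n))\<^sup>2 / w n"
    using assms(1)[of n] by (simp add: norm_mult norm_divide field_simps)
qed

text \<open>
  The usual completeness proof for sequence spaces: a Cauchy sequence converges in each coordinate, and
  the bounds on finite partial sums survive the limit.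
\<close>

lemma weighted_l2_complete:
  assumes w: "\<And>n. w n > 0" and X: "\<And>i. weighted_l2 w (X i)"
    and C: "\<And>e. e > 0 \<Longrightarrow> \<exists>M. \<forall>i\<ge>M. \<forall>j\<ge>M. (\<Sum>n. (cmod (X i n - X j n))\<^sup>2 / w n) < e"
  obtains a where "weighted_l2 w a" "(\<lambda>i. \<Sum>n. (cmod (X i n - a n))\<^sup>2 / w n) \<longlonglongrightarrow> 0"
proof -
  have XX: "summable (\<lambda>n. (cmod (X i n - X j n))\<^sup>2 / w n)" for i j
    using weighted_l2_diff[OF w X X] by (simp add: weighted_l2_def)
  have "Cauchy (\<lambda>i. X i n)" for n
  proof (rule metric_CauchyI)
    fix e :: real assume e: "e > 0"
    then have "e\<^sup>2 / w n > 0" using w by simp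
    from C[OF this] obtain M where M: "\<And>i j. i \<ge> M \<Longrightarrow> j \<ge> M \<Longrightarrow> (\<Sum>n. (cmod (X i n - X j n))\<^sup>2 / w n) < e\<^sup>2 / w n"
      by blast
    have "dist (X i n) (X j n) < e" if "i \<ge> M" "j \<ge> M" for i j
    proof -
      have "(cmod (X i n - X j n))\<^sup>2 / w n \<le> (\<Sum>n. (cmod (X i n - X j n))\<^sup>2 / w n)"
        using sum_le_suminf[OF XX, of "{n}" i j] w by (simp add: less_imp_le)
      also have "\<dots> < e\<^sup>2 / w n" by (rule M[OF that])
      finally have "(cmod (X i n - X j n))\<^sup>2 < e\<^sup>2" using w[of n] by (simp add: divide_less_cancel)
      then show ?thesis using e by (simp add: dist_norm power_less_imp_less_base)
    qed
    then show "\<exists>M. \<forall>i\<ge>M. \<forall>j\<ge>M. dist (X i n) (X j n) < e" by blast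
  qed
  then have "\<forall>n. \<exists>l. (\<lambda>i. X i n) \<longlonglongrightarrow> l"
    by (simp add: Cauchy_convergent_iff convergent_def)
  then obtain a where a: "\<And>n. (\<lambda>i. X i n) \<longlonglongrightarrow> a n" by metis
  \<comment> \<open>the Cauchy estimate for finite sums, passed to the limit in the second index\<close>
  have key: "\<exists>M. \<forall>i\<ge>M. summable (\<lambda>n. (cmod (X i n - a n))\<^sup>2 / w n) \<and> (\<Sum>n. (cmod (X i n - a n))\<^sup>2 / w n) \<le> e"
    if e: "e > 0" for e
  proof -
    from C[OF e] obtain M where M: "\<And>i j. i \<ge> M \<Longrightarrow> j \<ge> M \<Longrightarrow> (\<Sum>n. (cmod (X i n - X j n))\<^sup>2 / w n) < e"
      by blast
    have "summable (\<lambda>n. (cmod (X i n - a n))\<^sup>2 / w n) \<and> (\<Sum>n. (cmod (X i n - a n))\<^sup>2 / w n) \<le> e"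
      if i: "i \<ge> M" for i
    proof -
      have part: "(\<Sum>n<K. (cmod (X i n - a n))\<^sup>2 / w n) \<le> e" for K
      proof (rule tendsto_upperbound)
        show "(\<lambda>j. \<Sum>n<K. (cmod (X i n - X j n))\<^sup>2 / w n) \<longlonglongrightarrow> (\<Sum>n<K. (cmod (X i n - a n))\<^sup>2 / w n)"
          by (intro tendsto_intros a) (use w in \<open>auto simp: less_imp_neq[symmetric]\<close>)
        have "(\<Sum>n<K. (cmod (X i n - X j n))\<^sup>2 / w n) \<le> e" if "j \<ge> M" for j
          using sum_le_suminf[OF XX, of "{..<K}" i j] M[OF i that] w by (simp add: less_imp_le)
        then show "\<forall>\<^sub>F j in sequentially. (\<Sum>n<K. (cmod (X i n - X j n))\<^sup>2 / w n) \<le> e"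
          by (auto simp: eventually_sequentially)
      qed auto
      have sm: "summable (\<lambda>n. (cmod (X i n - a n))\<^sup>2 / w n)"
        by (rule summableI_nonneg_bounded[OF _ part]) (use w in \<open>simp add: less_imp_le\<close>)
      moreover have "(\<Sum>n. (cmod (X i n - a n))\<^sup>2 / w n) \<le> e"
        by (rule suminf_le_const[OF sm part])
      ultimately show ?thesis by blast
    qed
    then show ?thesis by blast
  qed
  obtain M where "summable (\<lambda>n. (cmod (X M n - a n))\<^sup>2 / w n)" using key[of 1] by auto
  then have "weighted_l2 w (\<lambda>n. X M n - a n)" by (simp add: weighted_l2_def)
  from weighted_l2_diff[OF w X[of M] this] have "weighted_l2 w a" by (simp add: weighted_l2_def)
  moreover have "(\<lambda>i. \<Sum>n. (cmod (X i n - a n))\<^sup>2 / w n) \<longlonglongrightarrow> 0"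
  proof (rule LIMSEQ_I)
    fix r :: real assume "r > 0"
    then obtain M where M: "\<forall>i\<ge>M. summable (\<lambda>n. (cmod (X i n - a n))\<^sup>2 / w n) \<and> (\<Sum>n. (cmod (X i n - a n))\<^sup>2 / w n) \<le> r / 2"
      using key[of "r / 2"] by auto
    have "norm ((\<Sum>n. (cmod (X i n - a n))\<^sup>2 / w n) - 0) < r" if "i \<ge> M" for i
      using M that \<open>r > 0\<close> suminf_nonneg[of "\<lambda>n. (cmod (X i n - a n))\<^sup>2 / w n"] w
      by (fastforce simp: less_imp_le)
    then show "\<exists>no. \<forall>n\<ge>no. norm ((\<Sum>na. (cmod (X n na - a na))\<^sup>2 / w na) - 0) < r" by blast
  qed
  ultimately show ?thesis by (rule that)
qed

definition bergman_model :: "real \<Rightarrow> (complex \<Rightarrow> complex) set" where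
  "bergman_model lam = {f \<in> hol_disc. weighted_l2 (binom_weight lam) (taylor_coeff f)}"

definition bergman_form :: "real \<Rightarrow> (complex \<Rightarrow> complex) \<Rightarrow> (complex \<Rightarrow> complex) \<Rightarrow> complex" where
  "bergman_form lam f g = (\<Sum>n. taylor_coeff f n * cnj (taylor_coeff g n) / of_real (binom_weight lam n))"

lemma bergman_form_self:
  assumes "lam > 0" "f \<in> bergman_model lam"
  shows "Re (bergman_form lam f f) = (\<Sum>n. (cmod (taylor_coeff f n))\<^sup>2 / binom_weight lam n)"
proof -
  have "taylor_coeff f n * cnj (taylor_coeff f n) / of_real (binom_weight lam n)
      = of_real ((cmod (taylor_coeff f n))\<^sup>2 / binom_weight lam n)" for n
    by (simp only: of_real_divide complex_norm_square)
  then have "bergman_form lam f f = of_real (\<Sum>n. (cmod (taylor_coeff f n))\<^sup>2 / binom_weight lam n)"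
    using assms(2) by (simp add: bergman_form_def bergman_model_def weighted_l2_def suminf_of_real del: of_real_divide of_real_power)
  then show ?thesis by simp
qed

text \<open>
  This makes the power series of every square summable sequence converge on the disc, by
  \<open>weighted_l2_mult_summable\<close>, and places the kernel functions in the space.
\<close>

lemma weighted_l2_kernel:
  assumes lam: "lam > 0" and z: "z \<in> disc"
  shows "weighted_l2 (binom_weight lam) (\<lambda>n. of_real (binom_weight lam n) * cnj z ^ n)"
proof -
  have "(cmod z)\<^sup>2 < 1" using z by (simp add: abs_square_less_1)
  from binom_weight_summable[OF _ this, of lam]
  have "summable (\<lambda>n. binom_weight lam n * ((cmod z)\<^sup>2) ^ n)" by simp
  moreover have "binom_weight lam n * ((cmod z)\<^sup>2) ^ n
      = (cmod (of_real (binom_weight lam n) * cnj z ^ n))\<^sup>2 / binom_weight lam n" for n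
    using binom_weight_pos[OF lam, of n]
    by (simp add: norm_mult norm_power power_mult_distrib power2_eq_square)
  ultimately show ?thesis by (simp add: weighted_l2_def)
qed

lemma weighted_l2_in_bergman_model:
  assumes lam: "lam > 0" and a: "weighted_l2 (binom_weight lam) a"
  obtains f where "f \<in> bergman_model lam" "taylor_coeff f = a"
proof -
  have "summable (\<lambda>n. a n * z ^ n)" if "z \<in> disc" for z
  proof -
    from weighted_l2_mult_summable[OF binom_weight_pos[OF lam] a weighted_l2_kernel[OF lam that]] show ?thesis
      using binom_weight_pos[OF lam] by (simp add: less_imp_neq[symmetric])
  qed
  note F = on_disc_power_series[of a, OF this]
  show ?thesis
    by (rule that[of "on_disc (\<lambda>z. \<Sum>n. a n * z ^ n)"]) (use F a in \<open>auto simp: bergman_model_def weighted_l2_def\<close>)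
qed

lemma hilbert_space_bergman_model:
  assumes lam: "lam > 0"
  shows "hilbert_space scale_fun (bergman_model lam) (bergman_form lam)"
proof (rule hilbert_spaceI)
  interpret vector_space scale_fun by (rule vector_space_scale_fun)
  note pos = binom_weight_pos[OF lam]
  let ?M = "bergman_model lam"
  have hol: "f \<in> hol_disc" and l2: "weighted_l2 (binom_weight lam) (taylor_coeff f)" if "f \<in> ?M" for f
    using that by (auto simp: bergman_model_def)
  note sm = weighted_l2_mult_summable[OF pos l2 l2]
  show "vector_space scale_fun" by (rule vector_space_scale_fun)
  have tc0: "taylor_coeff 0 n = 0" for n by (rule taylor_coeff_eqI) auto
  show sub: "subspace ?M"
    unfolding subspace_def
  proof (intro conjI ballI allI)
    show "0 \<in> ?M" by (simp add: bergman_model_def hol_disc_closed weighted_l2_def tc0)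
    show "f + g \<in> ?M" if "f \<in> ?M" "g \<in> ?M" for f g
      using weighted_l2_add[OF pos l2 l2, OF that] hol[OF that(1)] hol[OF that(2)]
      by (simp add: bergman_model_def hol_disc_closed taylor_coeff_add weighted_l2_def)
    show "scale_fun c f \<in> ?M" if "f \<in> ?M" for c f
      using weighted_l2_scale[OF l2, OF that, of c] hol[OF that]
      by (simp add: bergman_model_def hol_disc_closed taylor_coeff_scale weighted_l2_def)
  qed
  show "bergman_form lam (f + g) h = bergman_form lam f h + bergman_form lam g h"
    if "f \<in> ?M" "g \<in> ?M" "h \<in> ?M" for f g h
    using suminf_add[OF sm sm, OF that(1,3) that(2,3)] that
    by (simp add: bergman_form_def taylor_coeff_add hol ring_distribs add_divide_distrib)
  show "bergman_form lam (scale_fun c f) g = c * bergman_form lam f g"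
    if "f \<in> ?M" "g \<in> ?M" for c f g
    using suminf_mult[OF sm, OF that, of c] that
    by (simp add: bergman_form_def taylor_coeff_scale hol mult.assoc)
  show "bergman_form lam g f = cnj (bergman_form lam f g)" if "f \<in> ?M" "g \<in> ?M" for f g
    using sums_unique[OF sums_cnj[THEN iffD2, OF summable_sums[OF sm[OF that]]]]
    by (simp add: bergman_form_def mult.commute)
  show "Re (bergman_form lam f f) > 0" if f: "f \<in> ?M" "f \<noteq> 0" for f
  proof -
    obtain n where n: "taylor_coeff f n \<noteq> 0"
      using hol_disc_eqI[OF hol[OF f(1)] hol_disc_closed(1)] f(2) tc0 by auto
    show ?thesis
      unfolding bergman_form_self[OF lam f(1)]
    proof (rule suminf_pos2[where i = n])
      show "summable (\<lambda>n. (cmod (taylor_coeff f n))\<^sup>2 / binom_weight lam n)"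
        using l2[OF f(1)] by (simp add: weighted_l2_def)
    qed (use n pos in \<open>simp_all add: less_imp_le\<close>)
  qed
  fix X :: "nat \<Rightarrow> complex \<Rightarrow> complex"
  assume X: "range X \<subseteq> ?M"
    and C: "\<And>e. e > 0 \<Longrightarrow> \<exists>N. \<forall>i\<ge>N. \<forall>j\<ge>N. Re (bergman_form lam (X i - X j) (X i - X j)) < e"
  have XM: "X i \<in> ?M" for i using X by auto
  have eq: "Re (bergman_form lam (X i - f) (X i - f)) = (\<Sum>n. (cmod (taylor_coeff (X i) n - taylor_coeff f n))\<^sup>2 / binom_weight lam n)"
    if "f \<in> ?M" for i f
    using that XM by (simp add: bergman_form_self lam subspace_diff[OF sub] taylor_coeff_diff hol)
  obtain a where a: "weighted_l2 (binom_weight lam) a"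
    "(\<lambda>i. \<Sum>n. (cmod (taylor_coeff (X i) n - a n))\<^sup>2 / binom_weight lam n) \<longlonglongrightarrow> 0"
  proof (rule weighted_l2_complete[OF pos l2[OF XM]])
    show "\<exists>N. \<forall>i\<ge>N. \<forall>j\<ge>N. (\<Sum>n. (cmod (taylor_coeff (X i) n - taylor_coeff (X j) n))\<^sup>2 / binom_weight lam n) < e"
      if "e > 0" for e
      using C[OF that] by (simp add: eq XM)
  qed auto
  obtain f where f: "f \<in> ?M" "taylor_coeff f = a" by (rule weighted_l2_in_bergman_model[OF lam a(1)])
  show "\<exists>f\<in>?M. (\<lambda>i. Re (bergman_form lam (X i - f) (X i - f))) \<longlonglongrightarrow> 0"
    using a(2) f by (intro bexI[OF _ f(1)]) (simp add: eq f)
qed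

definition bergman_kernel :: "real \<Rightarrow> complex \<Rightarrow> complex \<Rightarrow> complex" where
  "bergman_kernel lam w = on_disc (\<lambda>z. (1 - z * cnj w) powr of_real (- 2 * lam))"

lemma bergman_kernel_hol: "w \<in> disc \<Longrightarrow> bergman_kernel lam w \<in> hol_disc"
  and taylor_coeff_bergman_kernel: 
    "w \<in> disc \<Longrightarrow> taylor_coeff (bergman_kernel lam w) n = of_real (binom_weight lam n) * cnj w ^ n"
proof -
  assume w: "w \<in> disc"
  have s: "(\<lambda>n. of_real (binom_weight lam n) * cnj w ^ n * z ^ n) sums bergman_kernel lam w z"
    if "z \<in> disc" for z
  proof -
    have "cmod (z * cnj w) < 1" using that w 
      using mult_strict_mono[of "cmod z" 1 "cmod w" 1] by (simp add: norm_mult)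
    from binomial_series[OF this, of lam] that show ?thesis
      by (simp add: bergman_kernel_def on_disc_def power_mult_distrib mult_ac)
  qed
  then have "bergman_kernel lam w holomorphic_on disc"
    by (intro power_series_holomorphic[of 0 1 "\<lambda>n. of_real (binom_weight lam n) * cnj w ^ n"]) auto
  then show "bergman_kernel lam w \<in> hol_disc"
    by (auto simp: hol_disc_def bergman_kernel_def on_disc_def)
  show "taylor_coeff (bergman_kernel lam w) n = of_real (binom_weight lam n) * cnj w ^ n"
    by (rule taylor_coeff_eqI[OF s])
qed

text \<open>
  The inner product of \<open>f\<close> with the kernel function at \<open>w\<close> is the Taylor series of \<open>f\<close> at \<open>w\<close>, since the
  weights cancel.
\<close>

theorem bergman_model_is_bergman_space:
  assumes lam: "lam > 0"
  shows "is_bergman_space lam (bergman_model lam) (bergman_form lam)"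
  unfolding is_bergman_space_def bergman_kernel_def[symmetric]
proof (intro conjI ballI)
  show "hilbert_space scale_fun (bergman_model lam) (bergman_form lam)"
    by (rule hilbert_space_bergman_model[OF lam])
  show "bergman_model lam \<subseteq> hol_disc" by (auto simp: bergman_model_def)
  note pos = binom_weight_pos[OF lam]
  fix w assume w: "w \<in> disc"
  show "bergman_kernel lam w \<in> bergman_model lam"
    using weighted_l2_kernel[OF lam w]
    by (simp add: bergman_model_def weighted_l2_def bergman_kernel_hol[OF w] taylor_coeff_bergman_kernel[OF w])
  show "f w = bergman_form lam f (bergman_kernel lam w)" if "f \<in> bergman_model lam" for f
    using sums_unique[OF taylor_coeff_sums[of f w]] w that pos
    by (simp add: bergman_form_def taylor_coeff_bergman_kernel bergman_model_def less_imp_neq[symmetric])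
qed

lemma is_bergman_space_imp_rkhs:
  "is_bergman_space lam V ip \<Longrightarrow> rkhs (bergman_kernel lam) V ip"
  by (auto simp: is_bergman_space_def rkhs_def bergman_kernel_def hol_disc_def)

theorem is_bergman_space_bergman:
  assumes "lam > 0"
  shows "is_bergman_space lam (bergman_carrier lam) (bergman_inner lam)"
proof -
  have "case bergman lam of (V, ip) \<Rightarrow> is_bergman_space lam V ip"
    unfolding bergman_def
    by (rule someI[of _ "(bergman_model lam, bergman_form lam)"])
       (simp add: bergman_model_is_bergman_space assms)
  then show ?thesis by (simp add: case_prod_beta)
qed

text \<open>
  By uniqueness, any Hilbert space with the defining properties may be used in place of the chosen one.
\<close>

theorem bergman_eqI:
  assumes "lam > 0" "is_bergman_space lam V ip"
  shows "bergman_carrier lam = V"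
    and "f \<in> V \<Longrightarrow> g \<in> V \<Longrightarrow> bergman_inner lam f g = ip f g"
  using rkhs_unique[OF is_bergman_space_imp_rkhs is_bergman_space_imp_rkhs,
      OF is_bergman_space_bergman assms(2)] assms(1) by auto

lemmas bergman_carrier_eq_model = bergman_eqI(1)[OF _ bergman_model_is_bergman_space]

definition disc_monomial :: "nat \<Rightarrow> complex \<Rightarrow> complex" where
  "disc_monomial n = on_disc (\<lambda>z. z ^ n)"

lemma disc_monomial_hol: "disc_monomial n \<in> hol_disc"
  unfolding disc_monomial_def by (intro on_disc_hol holomorphic_intros)

lemma taylor_coeff_disc_monomial: "taylor_coeff (disc_monomial n) k = (if k = n then 1 else 0)"
proof (rule taylor_coeff_eqI)
  fix z :: complex assume z: "z \<in> disc"
  have "(\<lambda>k. if k = n then z ^ k else 0) sums z ^ n" by (rule sums_single)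
  then show "(\<lambda>k. (if k = n then 1 else 0) * z ^ k) sums disc_monomial n z"
    using z by (simp add: disc_monomial_def on_disc_def if_distrib[of "\<lambda>x. x * _"] cong: if_cong)
qed

text \<open>
  Monomials represent Taylor coefficients at \<open>0\<close>; all explicit inner products below are read off from
  this.
\<close>

lemma bergman_monomial:
  assumes lam: "lam > 0"
  shows "disc_monomial n \<in> bergman_carrier lam"
    and "f \<in> bergman_carrier lam \<Longrightarrow> bergman_inner lam f (disc_monomial n) = taylor_coeff f n / of_real (binom_weight lam n)"
proof -
  have "weighted_l2 (binom_weight lam) (taylor_coeff (disc_monomial n))"
    unfolding weighted_l2_def by (rule summable_finite[of "{n}"]) (auto simp: taylor_coeff_disc_monomial)
  then have m: "disc_monomial n \<in> bergman_model lam"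
    by (simp add: bergman_model_def disc_monomial_hol)
  then show "disc_monomial n \<in> bergman_carrier lam" by (simp add: bergman_carrier_eq_model lam)
  assume "f \<in> bergman_carrier lam"
  then have f: "f \<in> bergman_model lam" by (simp add: bergman_carrier_eq_model lam)
  have "bergman_form lam f (disc_monomial n)
      = (\<Sum>k. if k = n then taylor_coeff f k / of_real (binom_weight lam k) else 0)"
    unfolding bergman_form_def by (intro arg_cong[of _ _ suminf]) (auto simp: taylor_coeff_disc_monomial)
  also have "\<dots> = taylor_coeff f n / of_real (binom_weight lam n)"
    by (rule sums_unique[symmetric]) (rule sums_single)
  finally show "bergman_inner lam f (disc_monomial n) = taylor_coeff f n / of_real (binom_weight lam n)"
    by (simp add: bergman_eqI(2)[OF lam bergman_model_is_bergman_space[OF lam] f m])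
qed

section \<open>The group SU(1,1) and its action on the disc\<close>

lemma vec2_eq_iff: "x = y \<longleftrightarrow> x $ 1 = y $ 1 \<and> x $ 2 = (y $ 2 :: 'a)" for x y :: "'a ^ 2"
  by (simp add: vec_eq_iff forall_2)

lemma mat2_entries:
  fixes A B :: "complex ^ 2 ^ 2"
  shows "(A ** B) $ i $ j = A $ i $ 1 * B $ 1 $ j + A $ i $ 2 * B $ 2 $ j"
    and "adj A $ i $ j = cnj (A $ j $ i)"
    and "form11 $ 1 $ 1 = 1" "form11 $ 1 $ 2 = 0" "form11 $ 2 $ 1 = 0" "form11 $ 2 $ 2 = - 1"
    and "mat x $ 1 $ 1 = x" "mat x $ 1 $ (2::2) = 0" "mat x $ (2::2) $ 1 = 0" "mat x $ (2::2) $ (2::2) = x"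
  by (simp_all add: matrix_matrix_mult_def sum_2 adj_def form11_def mat_def)

lemmas mat2_simps = vec2_eq_iff mat2_entries

lemma SU11_iff:
  "g \<in> SU11 \<longleftrightarrow> g $ 2 $ 2 = cnj (g $ 1 $ 1) \<and> g $ 2 $ 1 = cnj (g $ 1 $ 2)
     \<and> g $ 1 $ 1 * cnj (g $ 1 $ 1) - g $ 1 $ 2 * cnj (g $ 1 $ 2) = 1"
proof -
  obtain a b c d where abcd: "g $ 1 $ 1 = a" "g $ 1 $ 2 = b" "g $ 2 $ 1 = c" "g $ 2 $ 2 = d" by blast
  have 1: "g \<in> SU11 \<longleftrightarrow> ((cnj a * a - cnj c * c = 1 \<and> cnj a * b - cnj c * d = 0) \<and>
      cnj b * a - cnj d * c = 0 \<and> cnj b * b - cnj d * d = - 1) \<and> a * d - b * c = 1"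
    by (simp add: SU11_def mat2_simps det_2 abcd)
  show ?thesis
    unfolding 1 abcd
  proof (intro iffI; elim conjE)
    assume h: "cnj a * a - cnj c * c = 1" "cnj a * b - cnj c * d = 0" "a * d - b * c = 1"
    have "d = d * (cnj a * a - cnj c * c)" using h(1) by simp
    also have "\<dots> = cnj a * (a * d - b * c) + c * (cnj a * b - cnj c * d)" by (simp add: algebra_simps)
    finally have d: "d = cnj a" unfolding h by simp
    have "b = b * (cnj a * a - cnj c * c)" using h(1) by simp
    also have "\<dots> = cnj c * (a * d - b * c) + a * (cnj a * b - cnj c * d)" by (simp add: algebra_simps)
    finally have "b = cnj c" unfolding h by simp
    then have c: "c = cnj b" by simp
    show "d = cnj a \<and> c = cnj b \<and> a * cnj a - b * cnj b = 1"
      using h(1) c d by (simp add: mult.commute)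
  next
    assume h: "d = cnj a" "c = cnj b" "a * cnj a - b * cnj b = 1"
    from h(3) have "cnj b * b - a * cnj a = - 1" by (simp add: algebra_simps)
    with h show "((cnj a * a - cnj c * c = 1 \<and> cnj a * b - cnj c * d = 0) \<and>
      cnj b * a - cnj d * c = 0 \<and> cnj b * b - cnj d * d = - 1) \<and> a * d - b * c = 1"
      by (simp add: mult.commute)
  qed
qed

lemma SU11_mult: "g \<in> SU11 \<Longrightarrow> h \<in> SU11 \<Longrightarrow> g ** h \<in> SU11"
proof -
  assume g: "g \<in> SU11" and h: "h \<in> SU11"
  let ?a = "g $ 1 $ 1" and ?b = "g $ 1 $ 2" and ?c = "h $ 1 $ 1" and ?d = "h $ 1 $ 2"
  have "(?a * ?c + ?b * cnj ?d) * cnj (?a * ?c + ?b * cnj ?d)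
      - (?a * ?d + ?b * cnj ?c) * cnj (?a * ?d + ?b * cnj ?c)
      = (?a * cnj ?a - ?b * cnj ?b) * (?c * cnj ?c - ?d * cnj ?d)"
    by (simp add: algebra_simps)
  also have "\<dots> = 1" using g h by (simp add: SU11_iff)
  finally have norm: "(?a * ?c + ?b * cnj ?d) * cnj (?a * ?c + ?b * cnj ?d)
      - (?a * ?d + ?b * cnj ?c) * cnj (?a * ?d + ?b * cnj ?c) = 1" .
  have rows: "g $ 2 $ 2 = cnj ?a" "g $ 2 $ 1 = cnj ?b" "h $ 2 $ 2 = cnj ?c" "h $ 2 $ 1 = cnj ?d"
    using g h by (auto simp: SU11_iff)
  show ?thesis
    unfolding SU11_iff mat2_entries rows using norm by (simp add: add.commute)
qed

lemma SU11_one: "mat 1 \<in> SU11"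
  by (simp add: SU11_iff mat_def)

definition mat2_adjugate :: "complex ^ 2 ^ 2 \<Rightarrow> complex ^ 2 ^ 2" where
  "mat2_adjugate g = vector [vector [g $ 2 $ 2, - g $ 1 $ 2], vector [- g $ 2 $ 1, g $ 1 $ 1]]"

lemma SU11_adjugate:
  assumes "g \<in> SU11"
  shows "mat2_adjugate g \<in> SU11" "mat2_adjugate g ** g = mat 1"
  using assms by (auto simp: SU11_iff mat2_simps mat2_adjugate_def algebra_simps)

text \<open>
  The factor of automorphy \<open>c z + d\<close>, whose inverse square is the derivative of the action.
\<close>

definition automorphy :: "complex ^ 2 ^ 2 \<Rightarrow> complex \<Rightarrow> complex" where
  "automorphy g z = g $ 2 $ 1 * z + g $ 2 $ 2"

lemma SU11_norm: "g \<in> SU11 \<Longrightarrow> cmod (g $ 2 $ 1) < cmod (g $ 2 $ 2)"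
proof -
  assume g: "g \<in> SU11"
  then have "of_real ((cmod (g $ 1 $ 1))\<^sup>2 - (cmod (g $ 1 $ 2))\<^sup>2) = (1 :: complex)"
    by (simp only: SU11_iff of_real_diff complex_norm_square)
  then have "(cmod (g $ 1 $ 1))\<^sup>2 - (cmod (g $ 1 $ 2))\<^sup>2 = 1"
    by (simp only: of_real_eq_1_iff)
  then have "(cmod (g $ 2 $ 1))\<^sup>2 < (cmod (g $ 2 $ 2))\<^sup>2" using g by (simp add: SU11_iff)
  then show ?thesis by (rule power_less_imp_less_base) simp
qed

lemma SU11_22_nonzero: "g \<in> SU11 \<Longrightarrow> g $ 2 $ 2 \<noteq> 0"
  using SU11_norm by fastforce

lemma SU11_ratio_small:
  assumes "g \<in> SU11" "z \<in> disc"
  shows "cmod (g $ 2 $ 1 / g $ 2 $ 2 * z) < 1"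
proof -
  have "cmod (g $ 2 $ 1 / g $ 2 $ 2) < 1"
    using SU11_norm[OF assms(1)] SU11_22_nonzero[OF assms(1)] by (simp add: norm_divide)
  then have "cmod (g $ 2 $ 1 / g $ 2 $ 2) * cmod z < 1"
    using assms(2) mult_strict_mono[of "cmod (g $ 2 $ 1 / g $ 2 $ 2)" 1 "cmod z" 1] by simp
  then show ?thesis by (simp only: norm_mult)
qed

lemma one_plus_not_nonpos: "cmod x < 1 \<Longrightarrow> 1 + x \<notin> \<real>\<^sub>\<le>\<^sub>0"
  using abs_Re_le_cmod[of x] by (auto simp: complex_nonpos_Reals_iff)

lemma one_plus_ratio:
  assumes "g \<in> SU11" "z \<in> disc"
  shows "1 + g $ 2 $ 1 / g $ 2 $ 2 * z \<notin> \<real>\<^sub>\<le>\<^sub>0"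
  by (intro one_plus_not_nonpos SU11_ratio_small assms)

lemma automorphy_factored: "g \<in> SU11 \<Longrightarrow> automorphy g z = g $ 2 $ 2 * (1 + g $ 2 $ 1 / g $ 2 $ 2 * z)"
  using SU11_22_nonzero[of g] by (simp add: automorphy_def field_simps)

lemma automorphy_nonzero: "g \<in> SU11 \<Longrightarrow> z \<in> disc \<Longrightarrow> automorphy g z \<noteq> 0"
  using one_plus_ratio[of g z] SU11_22_nonzero[of g] by (auto simp: automorphy_factored)

text \<open>
  The polarised form of the invariance of the Hermitian form \<open>\<bar>v\<^sub>2\<bar>\<^sup>2 - \<bar>v\<^sub>1\<bar>\<^sup>2\<close>, from which both the
  invariance of the disc and the transformation law of the kernels follow.
\<close>

lemma moebius_polarised:
  assumes "g \<in> SU11" "z \<in> disc" "w \<in> disc"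
  shows "1 - moebius g z * cnj (moebius g w) = (1 - z * cnj w) / (automorphy g z * cnj (automorphy g w))"
proof -
  let ?a = "g $ 1 $ 1" and ?b = "g $ 1 $ 2"
  have g: "g $ 2 $ 2 = cnj ?a" "g $ 2 $ 1 = cnj ?b" "?a * cnj ?a - ?b * cnj ?b = 1"
    using assms(1) by (auto simp: SU11_iff)
  have nz: "automorphy g z \<noteq> 0" "cnj (automorphy g w) \<noteq> 0" using automorphy_nonzero assms by auto
  have "automorphy g z * cnj (automorphy g w) - (?a * z + ?b) * cnj (?a * w + ?b)
      = (?a * cnj ?a - ?b * cnj ?b) * (1 - z * cnj w)"
    by (simp add: automorphy_def g(1,2) algebra_simps)
  then have "automorphy g z * cnj (automorphy g w) - (?a * z + ?b) * cnj (?a * w + ?b) = 1 - z * cnj w"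
    using g(3) by simp
  moreover have "moebius g z * cnj (moebius g w)
      = ((?a * z + ?b) * cnj (?a * w + ?b)) / (automorphy g z * cnj (automorphy g w))"
    by (simp add: moebius_def automorphy_def)
  ultimately show ?thesis using nz by (simp add: field_simps)
qed

lemma moebius_disc:
  assumes "g \<in> SU11" "z \<in> disc"
  shows "moebius g z \<in> disc"
proof -
  have "complex_of_real (1 - (cmod (moebius g z))\<^sup>2)
      = of_real ((1 - (cmod z)\<^sup>2) / (cmod (automorphy g z))\<^sup>2)"
    using moebius_polarised[OF assms assms(2)]
    by (simp only: of_real_diff of_real_divide of_real_1 complex_norm_square)
  then have "1 - (cmod (moebius g z))\<^sup>2 = (1 - (cmod z)\<^sup>2) / (cmod (automorphy g z))\<^sup>2"
    by (simp only: of_real_eq_iff)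
  also have "\<dots> > 0" using assms automorphy_nonzero[OF assms] by (simp add: abs_square_less_1)
  finally show ?thesis by (simp add: abs_square_less_1)
qed

lemma moebius_deriv:
  assumes "g \<in> SU11" "z \<in> disc"
  shows "(moebius g has_field_derivative 1 / (automorphy g z)\<^sup>2) (at z)"
proof -
  have nz: "g $ 2 $ 1 * z + g $ 2 $ 2 \<noteq> 0" using automorphy_nonzero[OF assms] by (simp add: automorphy_def)
  have det: "g $ 1 $ 1 * g $ 2 $ 2 - g $ 1 $ 2 * g $ 2 $ 1 = 1"
    using assms(1) by (simp add: SU11_iff)
  have "(g $ 1 $ 1 * (g $ 2 $ 1 * z + g $ 2 $ 2) - (g $ 1 $ 1 * z + g $ 1 $ 2) * g $ 2 $ 1) = 1"
    using det by (simp add: algebra_simps)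
  then show ?thesis
    unfolding moebius_def[abs_def] automorphy_def
    by (auto intro!: derivative_eq_intros nz simp: power2_eq_square nz)
qed

lemma deriv_moebius: "g \<in> SU11 \<Longrightarrow> z \<in> disc \<Longrightarrow> deriv (moebius g) z = 1 / (automorphy g z)\<^sup>2"
  by (rule DERIV_imp_deriv[OF moebius_deriv])

lemma moebius_mult:
  assumes "g \<in> SU11" "h \<in> SU11" "z \<in> disc"
  shows "moebius (g ** h) z = moebius g (moebius h z)"
    and "automorphy (g ** h) z = automorphy g (moebius h z) * automorphy h z"
proof -
  have nz: "automorphy h z \<noteq> 0" "automorphy g (moebius h z) \<noteq> 0"
    using automorphy_nonzero moebius_disc assms by auto
  have m: "moebius h z * automorphy h z = h $ 1 $ 1 * z + h $ 1 $ 2"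
    using nz by (simp add: moebius_def automorphy_def)
  have "automorphy g (moebius h z) * automorphy h z = g $ 2 $ 1 * (moebius h z * automorphy h z) + g $ 2 $ 2 * automorphy h z"
    by (simp add: automorphy_def[of g] algebra_simps)
  then show A: "automorphy (g ** h) z = automorphy g (moebius h z) * automorphy h z"
    unfolding m by (simp add: automorphy_def mat2_simps algebra_simps)
  have "(g $ 1 $ 1 * moebius h z + g $ 1 $ 2) * automorphy h z
      = g $ 1 $ 1 * (moebius h z * automorphy h z) + g $ 1 $ 2 * automorphy h z"
    by (simp add: algebra_simps)
  then have B: "(g $ 1 $ 1 * moebius h z + g $ 1 $ 2) * automorphy h z
      = (g ** h) $ 1 $ 1 * z + (g ** h) $ 1 $ 2"
    unfolding m by (simp add: automorphy_def mat2_simps algebra_simps)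
  have "moebius (g ** h) z = ((g $ 1 $ 1 * moebius h z + g $ 1 $ 2) * automorphy h z) / automorphy (g ** h) z"
    unfolding B by (simp add: moebius_def automorphy_def)
  also have "\<dots> = moebius g (moebius h z)"
    unfolding A using nz by (simp add: moebius_def[of g] automorphy_def[of g])
  finally show "moebius (g ** h) z = moebius g (moebius h z)" .
qed

lemma moebius_one: "moebius (mat 1) z = z"
  by (simp add: moebius_def mat_def)

lemma continuous_on_matmult:
  fixes f g :: "'a::topological_space \<Rightarrow> complex ^ 2 ^ 2"
  assumes "continuous_on S f" "continuous_on S g"
  shows "continuous_on S (\<lambda>x. f x ** g x)"
  unfolding matrix_matrix_mult_def
  by (intro continuous_on_vec_lambda continuous_intros assms)

lemma continuous_on_adjugate: "continuous_on S mat2_adjugate"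
proof -
  have eq: "mat2_adjugate = (\<lambda>g. \<chi> i j. if i = j then (if i = 1 then g $ 2 $ 2 else g $ 1 $ 1) else - (g $ i $ j))"
    by (auto simp: fun_eq_iff mat2_adjugate_def vec2_eq_iff)
  show ?thesis
    unfolding eq
  proof (intro continuous_on_vec_lambda)
    fix i j :: 2
    show "continuous_on S (\<lambda>g :: complex ^ 2 ^ 2. if i = j then (if i = 1 then g $ 2 $ 2 else g $ 1 $ 1) else - (g $ i $ j))"
      by (cases "i = j"; cases "i = 1") (auto intro!: continuous_intros)
  qed
qed

section \<open>The covering group\<close>

definition SU11_path :: "(real \<Rightarrow> complex ^ 2 ^ 2) \<Rightarrow> bool" where
  "SU11_path a \<longleftrightarrow> path a \<and> path_image a \<subseteq> SU11 \<and> pathstart a = mat 1"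

lemma carrier_cover: "carrier SU11_cover = path_class ` {a. SU11_path a}"
  by (auto simp: SU11_cover_def SU11_path_def)

lemma SU11_path_cont: "SU11_path a \<Longrightarrow> continuous_on {0..1} a"
  and SU11_path_mem: "SU11_path a \<Longrightarrow> t \<in> {0..1} \<Longrightarrow> a t \<in> SU11"
  and SU11_path_0: "SU11_path a \<Longrightarrow> a 0 = mat 1"
  by (auto simp: SU11_path_def path_def path_image_def pathstart_def)

lemma SU11_pathI:
  "continuous_on {0..1} a \<Longrightarrow> (\<And>t. t \<in> {0..1} \<Longrightarrow> a t \<in> SU11) \<Longrightarrow> a 0 = mat 1 \<Longrightarrow> SU11_path a"
  by (auto simp: SU11_path_def path_def path_image_def pathstart_def)

lemma SU11_path_mult: "SU11_path a \<Longrightarrow> SU11_path b \<Longrightarrow> SU11_path (\<lambda>t. a t ** b t)"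
  by (rule SU11_pathI) (simp_all add: continuous_on_matmult SU11_path_cont SU11_mult SU11_path_mem SU11_path_0)

lemma SU11_path_one: "SU11_path (\<lambda>t. mat 1)"
  by (rule SU11_pathI) (auto simp: SU11_one)

lemma SU11_path_homotopic: "SU11_path a \<Longrightarrow> homotopic_paths SU11 a b \<Longrightarrow> SU11_path b"
  unfolding SU11_path_def
  by (metis homotopic_paths_imp_path homotopic_paths_imp_pathstart homotopic_paths_imp_subset)

lemma SU11_path_adjugate: "SU11_path a \<Longrightarrow> SU11_path (\<lambda>t. mat2_adjugate (a t))"
proof (rule SU11_pathI)
  assume a: "SU11_path a"
  show "continuous_on {0..1} (\<lambda>t. mat2_adjugate (a t))"
    by (rule continuous_on_compose2[OF continuous_on_adjugate SU11_path_cont[OF a]]) auto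
  show "mat2_adjugate (a 0) = mat 1"
    by (simp add: SU11_path_0[OF a] mat2_adjugate_def mat2_simps)
qed (auto intro!: SU11_adjugate SU11_path_mem)

lemma homotopic_paths_SU11_mult:
  assumes "homotopic_paths SU11 a a'" "homotopic_paths SU11 b b'"
  shows "homotopic_paths SU11 (\<lambda>t. a t ** b t) (\<lambda>t. a' t ** b' t)"
proof -
  from assms obtain h k where
    h: "continuous_on ({0..1} \<times> {0..1}) h" "h \<in> {0..1} \<times> {0..1} \<rightarrow> SU11"
       "\<forall>x\<in>{0..1}. h (0, x) = a x" "\<forall>x\<in>{0..1}. h (1, x) = a' x"
       "\<forall>t\<in>{0..1::real}. pathstart (h \<circ> Pair t) = pathstart a \<and> pathfinish (h \<circ> Pair t) = pathfinish a"
    and k: "continuous_on ({0..1} \<times> {0..1}) k" "k \<in> {0..1} \<times> {0..1} \<rightarrow> SU11"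
       "\<forall>x\<in>{0..1}. k (0, x) = b x" "\<forall>x\<in>{0..1}. k (1, x) = b' x"
       "\<forall>t\<in>{0..1::real}. pathstart (k \<circ> Pair t) = pathstart b \<and> pathfinish (k \<circ> Pair t) = pathfinish b"
    unfolding homotopic_paths by blast
  show ?thesis
    unfolding homotopic_paths
    by (rule exI[of _ "\<lambda>p. h p ** k p"])
       (use h k in \<open>auto intro!: continuous_on_matmult SU11_mult simp: pathstart_def pathfinish_def Pi_iff\<close>)
qed

lemma path_class_eq_iff: "SU11_path a \<Longrightarrow> path_class a = path_class b \<longleftrightarrow> homotopic_paths SU11 a b"
proof
  assume a: "SU11_path a" and eq: "path_class a = path_class b"
  have "a \<in> path_class b"
    unfolding eq[symmetric] using a by (simp add: path_class_def SU11_path_def)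
  then have "homotopic_paths SU11 b a" by (simp add: path_class_def)
  then show "homotopic_paths SU11 a b" by (rule homotopic_paths_sym)
next
  assume "homotopic_paths SU11 a b"
  then show "path_class a = path_class b"
    unfolding path_class_def using homotopic_paths_sym homotopic_paths_trans by blast
qed

text \<open>
  Pointwise products of homotopies are homotopies, so the union over all representatives in the
  definition of the product is a union of equal classes.
\<close>

lemma cover_mult:
  assumes "SU11_path a" "SU11_path b"
  shows "path_class a \<otimes>\<^bsub>SU11_cover\<^esub> path_class b = path_class (\<lambda>t. a t ** b t)"
proof -
  have mem: "a \<in> path_class a" "b \<in> path_class b" using assms by (auto simp: path_class_def SU11_path_def)
  have eq: "path_class (\<lambda>t. a' t ** b' t) = path_class (\<lambda>t. a t ** b t)"
    if "a' \<in> path_class a" "b' \<in> path_class b" for a' b'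
    using that assms
    by (subst eq_commute) (simp add: path_class_def[of a] path_class_def[of b]
          path_class_eq_iff SU11_path_mult homotopic_paths_SU11_mult)
  have "path_class a \<otimes>\<^bsub>SU11_cover\<^esub> path_class b
      = (\<Union>a'\<in>path_class a. \<Union>b'\<in>path_class b. path_class (\<lambda>t. a' t ** b' t))"
    by (simp add: SU11_cover_def)
  also have "\<dots> = (\<Union>a'\<in>path_class a. \<Union>b'\<in>path_class b. path_class (\<lambda>t. a t ** b t))"
    by (intro SUP_cong refl eq)
  also have "\<dots> = path_class (\<lambda>t. a t ** b t)" using mem by auto
  finally show ?thesis .
qed

lemma cover_one: "\<one>\<^bsub>SU11_cover\<^esub> = path_class (\<lambda>t. mat 1)"
  by (simp add: SU11_cover_def)

lemma group_cover: "group SU11_cover"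
proof (rule groupI)
  show "\<one>\<^bsub>SU11_cover\<^esub> \<in> carrier SU11_cover"
    unfolding cover_one carrier_cover using SU11_path_one by blast
  fix x assume "x \<in> carrier SU11_cover"
  then obtain a where a: "x = path_class a" "SU11_path a" by (auto simp: carrier_cover)
  show "\<one>\<^bsub>SU11_cover\<^esub> \<otimes>\<^bsub>SU11_cover\<^esub> x = x"
    using a by (simp add: cover_one cover_mult SU11_path_one)
  show "\<exists>y\<in>carrier SU11_cover. y \<otimes>\<^bsub>SU11_cover\<^esub> x = \<one>\<^bsub>SU11_cover\<^esub>"
  proof
    let ?b = "\<lambda>t. mat2_adjugate (a t)"
    show "path_class ?b \<in> carrier SU11_cover"
      using SU11_path_adjugate a by (auto simp: carrier_cover)
    have "homotopic_paths SU11 (\<lambda>t. ?b t ** a t) (\<lambda>t. mat 1)"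
      using SU11_path_mult[OF SU11_path_adjugate[OF a(2)] a(2)] a(2)
      by (intro homotopic_paths_eq) (auto simp: SU11_path_def SU11_adjugate SU11_path_mem[OF a(2)])
    then show "path_class ?b \<otimes>\<^bsub>SU11_cover\<^esub> x = \<one>\<^bsub>SU11_cover\<^esub>"
      using a SU11_path_adjugate by (simp add: cover_one cover_mult path_class_eq_iff SU11_path_mult)
  qed
  fix y assume "y \<in> carrier SU11_cover"
  then obtain b where b: "y = path_class b" "SU11_path b" by (auto simp: carrier_cover)
  show "x \<otimes>\<^bsub>SU11_cover\<^esub> y \<in> carrier SU11_cover"
    using a b SU11_path_mult by (auto simp: carrier_cover cover_mult)
  fix z assume "z \<in> carrier SU11_cover"
  then obtain c where c: "z = path_class c" "SU11_path c" by (auto simp: carrier_cover)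
  show "x \<otimes>\<^bsub>SU11_cover\<^esub> y \<otimes>\<^bsub>SU11_cover\<^esub> z = x \<otimes>\<^bsub>SU11_cover\<^esub> (y \<otimes>\<^bsub>SU11_cover\<^esub> z)"
    using a b c by (simp add: cover_mult SU11_path_mult matrix_mul_assoc)
qed

lemma cover_proj_path_class: "SU11_path a \<Longrightarrow> cover_proj (path_class a) = a 1"
proof -
  assume a: "SU11_path a"
  have "a \<in> path_class a" using a by (simp add: path_class_def SU11_path_def)
  moreover have "pathfinish b = a 1" if "b \<in> path_class a" for b
    using that homotopic_paths_imp_pathfinish[of SU11 a b] by (simp add: path_class_def pathfinish_def)
  ultimately have "pathfinish ` path_class a = {a 1}" by force
  then show ?thesis by (simp add: cover_proj_def)
qed

lemma cover_proj_SU11: "g \<in> carrier SU11_cover \<Longrightarrow> cover_proj g \<in> SU11"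
  by (auto simp: carrier_cover cover_proj_path_class SU11_path_mem)

lemma cover_proj_mult:
  "g \<in> carrier SU11_cover \<Longrightarrow> h \<in> carrier SU11_cover \<Longrightarrow>
    cover_proj (g \<otimes>\<^bsub>SU11_cover\<^esub> h) = cover_proj g ** cover_proj h"
  by (auto simp: carrier_cover cover_mult cover_proj_path_class SU11_path_mult)

lemma cover_proj_one: "cover_proj \<one>\<^bsub>SU11_cover\<^esub> = mat 1"
  by (simp add: cover_one cover_proj_path_class SU11_path_one)

section \<open>Logarithms of the derivative along paths\<close>

text \<open>
  The uniqueness principle behind all identities between logarithms: the values of \<open>f\<close> differ by multiples
  of \<open>2 \<pi> \<i>\<close>, so they cannot vary on a connected set.
\<close>

lemma exp_const_imp_const:
  fixes f :: "'a::topological_space \<Rightarrow> complex"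
  assumes "connected S" "continuous_on S f" "\<And>x. x \<in> S \<Longrightarrow> exp (f x) = w" "x \<in> S" "y \<in> S"
  shows "f x = f y"
proof -
  have "f constant_on S"
  proof (rule continuous_discrete_range_constant[OF assms(1,2)])
    fix x assume x: "x \<in> S"
    have "2 * pi \<le> norm (f y - f x)" if y: "y \<in> S" "f y \<noteq> f x" for y
    proof -
      from assms(3)[OF x] assms(3)[OF y(1)] have "exp (f y) = exp (f x)" by simp
      then obtain n :: int where n: "f y = f x + of_int (2 * n) * of_real pi * \<i>"
        unfolding exp_eq by auto
      with y(2) have "n \<noteq> 0" by auto
      then have "real_of_int \<bar>n\<bar> \<ge> 1" by linarith
      then show ?thesis using n by (simp add: norm_mult)
    qed
    then show "\<exists>e>0. \<forall>y. y \<in> S \<and> f y \<noteq> f x \<longrightarrow> e \<le> norm (f y - f x)"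
      by (intro exI[of _ "2 * pi"]) auto
  qed
  with assms(4,5) show ?thesis unfolding constant_on_def by metis
qed

text \<open>
  Monodromy on the unit square: a continuous logarithm of \<open>F\<close> exists on the whole square.  On its left
  and right sides it is \<open>l\<close> and \<open>k\<close> up to constants, and along the other two sides it is constant.
\<close>

lemma log_homotopy:
  fixes F :: "real \<times> real \<Rightarrow> complex"
  assumes F: "continuous_on ({0..1} \<times> {0..1}) F" "\<And>p. p \<in> {0..1} \<times> {0..1} \<Longrightarrow> F p \<noteq> 0"
    and ends: "\<And>s. s \<in> {0..1} \<Longrightarrow> F (s, 0) = 1" "\<And>s. s \<in> {0..1} \<Longrightarrow> F (s, 1) = w"
    and l: "continuous_on {0..1} l" "l 0 = 0" "\<And>t. t \<in> {0..1} \<Longrightarrow> exp (l t) = F (0, t)"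
    and k: "continuous_on {0..1} k" "k 0 = 0" "\<And>t. t \<in> {0..1} \<Longrightarrow> exp (k t) = F (1, t)"
  shows "l 1 = k 1"
proof -
  obtain L where L: "continuous_on ({0..1} \<times> {0..1}) L"
    "\<And>p. p \<in> {0..1} \<times> {0..1} \<Longrightarrow> F p = exp (L p)"
    using continuous_logarithm_on_contractible[OF F(1) convex_imp_contractible F(2)]
    by (metis convex_Times convex_real_interval(5))
  have row: "continuous_on {0..1} (\<lambda>t. L (s, t))" if "s \<in> {0..1}" for s
    by (rule continuous_on_compose2[OF L(1)]) (use that in \<open>auto intro!: continuous_intros\<close>)
  have col: "continuous_on {0..1} (\<lambda>s. L (s, t))" if "t \<in> {0..1}" for t
    by (rule continuous_on_compose2[OF L(1)]) (use that in \<open>auto intro!: continuous_intros\<close>)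
  have edge: "L (s, 0) - q 0 = L (s, 1) - q 1"
    if s: "s \<in> {0..1}" and q: "continuous_on {0..1} q" "\<And>t. t \<in> {0..1} \<Longrightarrow> exp (q t) = F (s, t)" for s q
  proof (rule exp_const_imp_const[where S = "{0..1::real}" and w = 1 and f = "\<lambda>t. L (s, t) - q t"])
    show "continuous_on {0..1} (\<lambda>t. L (s, t) - q t)" by (intro continuous_on_diff row s q(1))
    show "exp (L (s, t) - q t) = 1" if "t \<in> {0..1}" for t
      using F(2)[of "(s, t)"] L(2)[of "(s, t)"] q(2)[OF that] s that by (simp add: exp_diff)
  qed auto
  have side: "L (0, t) = L (1, t)" if t: "t \<in> {0..1}" and v: "\<And>s. s \<in> {0..1} \<Longrightarrow> F (s, t) = v" for t v
  proof (rule exp_const_imp_const[where S = "{0..1::real}" and w = v and f = "\<lambda>s. L (s, t)"])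
    show "exp (L (s, t)) = v" if "s \<in> {0..1}" for s
      using L(2)[of "(s, t)"] v[OF that] that t by simp
  qed (use col[OF t] in auto)
  have "L (0, 0) = L (1, 0)" by (rule side[OF _ ends(1)]) auto
  moreover have "L (0, 1) = L (1, 1)" by (rule side[OF _ ends(2)]) auto
  moreover have "L (0, 0) - l 0 = L (0, 1) - l 1" by (rule edge[OF _ l(1,3)]) auto
  moreover have "L (1, 0) - k 0 = L (1, 1) - k 1" by (rule edge[OF _ k(1,3)]) auto
  ultimately show ?thesis using l(2) k(2) by simp
qed

text \<open>
  Any lift along any representative gives the same value: a homotopy between two representatives
  makes the derivative a function on the square to which \<open>log_homotopy\<close> applies.
\<close>

lemma log_deriv_eqI:
  assumes a: "SU11_path a" and z: "z \<in> disc"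
    and l: "continuous_on {0..1} l" "l 0 = 0" "\<And>t. t \<in> {0..1} \<Longrightarrow> exp (l t) = 1 / (automorphy (a t) z)\<^sup>2"
  shows "log_deriv (path_class a) z = l 1"
  unfolding log_deriv_def
proof (rule the_equality)
  have "a \<in> path_class a" using a by (simp add: path_class_def SU11_path_def)
  then show "\<exists>b\<in>path_class a. \<exists>k. continuous_on {0..1} k \<and> k 0 = 0 \<and>
      (\<forall>t\<in>{0..1}. exp (k t) = deriv (moebius (b t)) z) \<and> k 1 = l 1"
    using l z by (intro bexI[of _ a] exI[of _ l]) (auto simp: deriv_moebius SU11_path_mem[OF a])
  fix u assume "\<exists>b\<in>path_class a. \<exists>k. continuous_on {0..1} k \<and> k 0 = 0 \<and>
      (\<forall>t\<in>{0..1}. exp (k t) = deriv (moebius (b t)) z) \<and> k 1 = u"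
  then obtain b k where b: "homotopic_paths SU11 a b"
    and k: "continuous_on {0..1} k" "k 0 = 0" "\<And>t. t \<in> {0..1} \<Longrightarrow> exp (k t) = deriv (moebius (b t)) z" "k 1 = u"
    by (auto simp: path_class_def)
  have bp: "SU11_path b" by (rule SU11_path_homotopic[OF a b])
  from b obtain h where
    h: "continuous_on ({0..1} \<times> {0..1}) h" "h \<in> {0..1} \<times> {0..1} \<rightarrow> SU11"
       "\<forall>x\<in>{0..1}. h (0, x) = a x" "\<forall>x\<in>{0..1}. h (1, x) = b x"
       "\<forall>t\<in>{0..1::real}. pathstart (h \<circ> Pair t) = pathstart a \<and> pathfinish (h \<circ> Pair t) = pathfinish a"
    unfolding homotopic_paths by blast
  have nz: "automorphy (h p) z \<noteq> 0" if "p \<in> {0..1} \<times> {0..1}" for p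
    using automorphy_nonzero[OF _ z] h(2) that by blast
  have "l 1 = k 1"
  proof (rule log_homotopy[where F = "\<lambda>p. 1 / (automorphy (h p) z)\<^sup>2" and w = "1 / (automorphy (a 1) z)\<^sup>2"])
    show "continuous_on ({0..1} \<times> {0..1}) (\<lambda>p. 1 / (automorphy (h p) z)\<^sup>2)"
      using nz unfolding automorphy_def by (intro continuous_intros h(1)) auto
    show "1 / (automorphy (h (s, 0)) z)\<^sup>2 = 1" if "s \<in> {0..1}" for s
      using h(5) that SU11_path_0[OF a] by (simp add: pathstart_def automorphy_def mat_def)
    show "1 / (automorphy (h (s, 1)) z)\<^sup>2 = 1 / (automorphy (a 1) z)\<^sup>2" if "s \<in> {0..1}" for s
      using h(5) that by (simp add: pathfinish_def)
  qed (use nz l k h(3,4) deriv_moebius[OF SU11_path_mem[OF bp] z] in auto)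
  then show "u = l 1" using k(4) by simp
qed

lemma SU11_path_log22:
  assumes a: "SU11_path a"
  obtains \<delta> where "continuous_on {0..1} \<delta>" "\<delta> 0 = 0" "\<forall>t\<in>{0..1}. exp (\<delta> t) = a t $ 2 $ 2"
proof -
  have "continuous_on {0..1} (\<lambda>t. a t $ 2 $ 2)"
    by (intro continuous_intros SU11_path_cont a)
  then obtain L where L: "continuous_on {0..1} L" "\<And>t. t \<in> {0..1} \<Longrightarrow> a t $ 2 $ 2 = exp (L t)"
    using continuous_logarithm_on_contractible[of "{0..1::real}" "\<lambda>t. a t $ 2 $ 2"]
      SU11_22_nonzero[OF SU11_path_mem[OF a]] convex_imp_contractible[OF convex_real_interval(5)]
    by metis
  have "exp (L 0) = 1" using L(2)[of 0] SU11_path_0[OF a] by (simp add: mat_def)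
  then show ?thesis
    by (intro that[of "\<lambda>t. L t - L 0"]) (auto intro!: continuous_intros L simp: L(2) exp_diff)
qed

text \<open>
  Given a continuous logarithm \<open>\<delta>\<close> of the entry \<open>d\<close>, this is a continuous logarithm of
  \<open>(c z + d)^(-2)\<close>.  The principal logarithm is continuous here because \<open>\<bar>c z / d\<bar> < 1\<close>.
\<close>

definition path_log :: "(real \<Rightarrow> complex ^ 2 ^ 2) \<Rightarrow> (real \<Rightarrow> complex) \<Rightarrow> complex \<Rightarrow> real \<Rightarrow> complex" where
  "path_log a \<delta> z t = - 2 * (\<delta> t + Ln (1 + a t $ 2 $ 1 / a t $ 2 $ 2 * z))"

text \<open>
  The base point is allowed to move with \<open>t\<close>: the cocycle law needs the logarithm of \<open>g'\<close> at
  \<open>h\<^sub>t z\<close> along a path \<open>h\<^sub>t\<close>.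
\<close>

lemma path_log:
  assumes a: "SU11_path a" and d: "continuous_on {0..1} \<delta>" "\<delta> 0 = 0" "\<forall>t\<in>{0..1}. exp (\<delta> t) = a t $ 2 $ 2"
    and z: "continuous_on {0..1} z" "\<forall>t\<in>{0..1}. z t \<in> disc"
  shows "continuous_on {0..1} (\<lambda>t. path_log a \<delta> (z t) t)"
    and "path_log a \<delta> (z 0) 0 = 0"
    and "\<And>t. t \<in> {0..1} \<Longrightarrow> exp (path_log a \<delta> (z t) t) = 1 / (automorphy (a t) (z t))\<^sup>2"
proof -
  show "continuous_on {0..1} (\<lambda>t. path_log a \<delta> (z t) t)"
    unfolding path_log_def
    by (intro continuous_intros d z SU11_path_cont a)
       (use SU11_22_nonzero[OF SU11_path_mem[OF a]] one_plus_ratio[OF SU11_path_mem[OF a] bspec[OF z(2)]] in auto)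
  show "path_log a \<delta> (z 0) 0 = 0" by (simp add: path_log_def SU11_path_0[OF a] d mat_def)
  fix t :: real assume t: "t \<in> {0..1}"
  have "1 + a t $ 2 $ 1 / a t $ 2 $ 2 * z t \<noteq> 0"
    using one_plus_ratio[OF SU11_path_mem[OF a t] bspec[OF z(2) t]] by auto
  then have "exp (\<delta> t + Ln (1 + a t $ 2 $ 1 / a t $ 2 $ 2 * z t)) = automorphy (a t) (z t)"
    by (simp add: exp_add bspec[OF d(3) t] automorphy_factored[OF SU11_path_mem[OF a t]])
  then show "exp (path_log a \<delta> (z t) t) = 1 / (automorphy (a t) (z t))\<^sup>2"
    unfolding path_log_def by (simp only: mult_minus_left exp_minus exp_double inverse_eq_divide)
qed

lemma log_deriv_path_log:
  assumes a: "SU11_path a" and d: "continuous_on {0..1} \<delta>" "\<delta> 0 = 0" "\<forall>t\<in>{0..1}. exp (\<delta> t) = a t $ 2 $ 2"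
    and z: "z \<in> disc"
  shows "log_deriv (path_class a) z = path_log a \<delta> z 1"
  using path_log[OF a d, of "\<lambda>_. z"] z by (intro log_deriv_eqI[OF a z]) auto

lemma log_deriv_formula:
  assumes g: "g \<in> carrier SU11_cover"
  obtains \<delta> where "exp \<delta> = cover_proj g $ 2 $ 2"
    "\<And>z. z \<in> disc \<Longrightarrow> log_deriv g z = - 2 * (\<delta> + Ln (1 + cover_proj g $ 2 $ 1 / cover_proj g $ 2 $ 2 * z))"
proof -
  from g obtain a where a: "g = path_class a" "SU11_path a" by (auto simp: carrier_cover)
  obtain \<delta> where d: "continuous_on {0..1} \<delta>" "\<delta> 0 = 0" "\<forall>t\<in>{0..1}. exp (\<delta> t) = a t $ 2 $ 2"
    using SU11_path_log22[OF a(2)] by blast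
  show ?thesis
    by (rule that[of "\<delta> 1"])
       (simp_all only: a(1) cover_proj_path_class[OF a(2)] d log_deriv_path_log[OF a(2) d] path_log_def
         atLeastAtMost_iff zero_le_one order_refl simp_thms)
qed

text \<open>
  The chain rule for the product of two representing paths, lifted to logarithms.
\<close>

lemma log_deriv_mult:
  assumes g: "g \<in> carrier SU11_cover" and h: "h \<in> carrier SU11_cover" and z: "z \<in> disc"
  shows "log_deriv (g \<otimes>\<^bsub>SU11_cover\<^esub> h) z = log_deriv g (cover_act h z) + log_deriv h z"
proof -
  from g obtain a where a: "g = path_class a" "SU11_path a" by (auto simp: carrier_cover)
  from h obtain b where b: "h = path_class b" "SU11_path b" by (auto simp: carrier_cover)
  obtain \<alpha> where d: "continuous_on {0..1} \<alpha>" "\<alpha> 0 = 0" "\<forall>t\<in>{0..1}. exp (\<alpha> t) = a t $ 2 $ 2"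
    using SU11_path_log22[OF a(2)] by blast
  obtain \<beta> where e: "continuous_on {0..1} \<beta>" "\<beta> 0 = 0" "\<forall>t\<in>{0..1}. exp (\<beta> t) = b t $ 2 $ 2"
    using SU11_path_log22[OF b(2)] by blast
  let ?w = "\<lambda>t. moebius (b t) z"
  have w: "\<forall>t\<in>{0..1}. ?w t \<in> disc"
    using moebius_disc[OF SU11_path_mem[OF b(2)] z] by blast
  have cw: "continuous_on {0..1} ?w"
    unfolding moebius_def using automorphy_nonzero[OF SU11_path_mem[OF b(2)] z]
    by (intro continuous_intros SU11_path_cont b(2)) (auto simp: automorphy_def)
  have zt: "\<forall>t\<in>{0..1::real}. z \<in> disc" using z by blast
  have w1: "?w 1 \<in> disc" by (rule bspec[OF w]) simp
  note A = path_log[OF a(2) d cw w] and B = path_log[OF b(2) e continuous_on_const zt]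
  have "log_deriv (path_class (\<lambda>t. a t ** b t)) z = path_log a \<alpha> (?w 1) 1 + path_log b \<beta> z 1"
    by (rule log_deriv_eqI[OF SU11_path_mult[OF a(2) b(2)] z])
       (use A B in \<open>auto intro!: continuous_intros simp: exp_add power_mult_distrib
          moebius_mult(2)[OF SU11_path_mem[OF a(2)] SU11_path_mem[OF b(2)] z]\<close>)
  then show ?thesis
    using a b
    by (simp add: cover_mult log_deriv_path_log[OF a(2) d w1] log_deriv_path_log[OF b(2) e z]
        cover_proj_path_class)
qed

lemma log_deriv_one: "z \<in> disc \<Longrightarrow> log_deriv \<one>\<^bsub>SU11_cover\<^esub> z = 0"
  unfolding cover_one by (rule log_deriv_eqI[OF SU11_path_one]) (auto simp: automorphy_def mat_def)

text \<open>
  Both sides are continuous along a path that represents \<open>g\<close>, agree at the identity, and have the same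
  exponential by \<open>moebius_polarised\<close>.
\<close>

lemma log_deriv_kernel:
  assumes g: "g \<in> carrier SU11_cover" and z: "z \<in> disc" and w: "w \<in> disc"
  shows "log_deriv g z + cnj (log_deriv g w) - 2 * Ln (1 - cover_act g z * cnj (cover_act g w))
       = - 2 * Ln (1 - z * cnj w)"
proof -
  from g obtain a where a: "g = path_class a" "SU11_path a" by (auto simp: carrier_cover)
  obtain \<alpha> where d: "continuous_on {0..1} \<alpha>" "\<alpha> 0 = 0" "\<forall>t\<in>{0..1}. exp (\<alpha> t) = a t $ 2 $ 2"
    using SU11_path_log22[OF a(2)] by blast
  have m: "moebius (a t) x \<in> disc" if "t \<in> {0..1}" "x \<in> disc" for t x
    using moebius_disc[OF SU11_path_mem[OF a(2) that(1)] that(2)] .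
  have cm: "continuous_on {0..1} (\<lambda>t. moebius (a t) x)" if "x \<in> disc" for x
    unfolding moebius_def using automorphy_nonzero[OF SU11_path_mem[OF a(2)] that]
    by (intro continuous_intros SU11_path_cont a(2)) (auto simp: automorphy_def)
  have nn: "1 - x * cnj y \<notin> \<real>\<^sub>\<le>\<^sub>0" if "x \<in> disc" "y \<in> disc" for x y
    using one_plus_not_nonpos[of "- (x * cnj y)"] mult_strict_mono[of "cmod x" 1 "cmod y" 1] that
    by (simp add: norm_mult)
  have nn0: "1 - x * cnj y \<noteq> 0" if "x \<in> disc" "y \<in> disc" for x y
    using nn[OF that] by auto
  have zt: "\<forall>t\<in>{0..1::real}. z \<in> disc" and wt: "\<forall>t\<in>{0..1::real}. w \<in> disc" using z w by blast+
  note Z = path_log[OF a(2) d continuous_on_const zt] and W = path_log[OF a(2) d continuous_on_const wt]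
  define F where "F t = path_log a \<alpha> z t + cnj (path_log a \<alpha> w t)
    - 2 * Ln (1 - moebius (a t) z * cnj (moebius (a t) w)) + 2 * Ln (1 - z * cnj w)" for t
  have "F 0 = F 1"
  proof (rule exp_const_imp_const[where S = "{0..1::real}" and w = 1])
    show "continuous_on {0..1} F"
      unfolding F_def by (intro continuous_intros Z(1) W(1) cm z w nn m)
    fix t :: real assume t: "t \<in> {0..1}"
    have nz: "automorphy (a t) z \<noteq> 0" "automorphy (a t) w \<noteq> 0"
      using automorphy_nonzero[OF SU11_path_mem[OF a(2) t]] z w by auto
    have W': "exp (cnj (path_log a \<alpha> w t)) = cnj (1 / (automorphy (a t) w)\<^sup>2)"
      by (simp only: exp_cnj[symmetric] W(3)[OF t])
    have "exp (F t) = 1 / (automorphy (a t) z)\<^sup>2 * cnj (1 / (automorphy (a t) w)\<^sup>2)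
        / (1 - moebius (a t) z * cnj (moebius (a t) w))\<^sup>2 * (1 - z * cnj w)\<^sup>2"
      unfolding F_def using nn0 m t z w Z(3)[OF t] W'
      by (simp add: exp_add exp_diff exp_double)
    also have "\<dots> = 1"
      unfolding moebius_polarised[OF SU11_path_mem[OF a(2) t] z w]
      using nz nn0[OF z w] by (simp add: field_simps)
    finally show "exp (F t) = 1" .
  qed auto
  moreover have "F 0 = 0" using Z(2) W(2) by (simp add: F_def SU11_path_0[OF a(2)] moebius_one)
  ultimately have "F 1 = 0" by simp
  then show ?thesis
    using a
    by (simp add: F_def log_deriv_path_log[OF a(2) d z] log_deriv_path_log[OF a(2) d w]
        cover_proj_path_class algebra_simps)
qed

text \<open>
  The path runs through the boosts that move \<open>0\<close> along the segment to \<open>w\<close>.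
\<close>

lemma cover_transitive:
  assumes w: "w \<in> disc"
  obtains g where "g \<in> carrier SU11_cover" "cover_act g 0 = w"
proof -
  define r where "r t = complex_of_real (1 / sqrt (1 - (cmod (of_real t * w))\<^sup>2))" for t
  define a :: "real \<Rightarrow> complex ^ 2 ^ 2" where
    "a t = (\<chi> i j. r t * (if i = j then 1 else if i = 1 then of_real t * w else of_real t * cnj w))" for t
  have small: "(cmod (of_real t * w))\<^sup>2 < 1" if "t \<in> {0..1}" for t
  proof -
    have "t * cmod w \<le> 1 * cmod w" by (rule mult_right_mono) (use that in auto)
    then show ?thesis using w that by (simp add: norm_mult abs_square_less_1 abs_mult)
  qed
  have a: "SU11_path a"
  proof (rule SU11_pathI)
    show "continuous_on {0..1} a"
      unfolding a_def
    proof (intro continuous_on_vec_lambda)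
      fix i j :: 2
      have "continuous_on {0..1} r"
        unfolding r_def using small by (intro continuous_intros) force+
      then show "continuous_on {0..1} (\<lambda>t. r t * (if i = j then 1 else if i = 1 then of_real t * w else of_real t * cnj w))"
        by (cases "i = j"; cases "i = 1") (auto intro!: continuous_intros)
    qed
    fix t :: real assume t: "t \<in> {0..1}"
    let ?q = "(cmod (of_real t * w))\<^sup>2"
    have "r t * cnj (r t) * (1 - of_real ?q) = of_real ((1 / sqrt (1 - ?q))\<^sup>2 * (1 - ?q))"
      by (simp only: r_def complex_cnj_complex_of_real of_real_mult of_real_diff of_real_1 power2_eq_square)
    also have "(1 / sqrt (1 - ?q))\<^sup>2 * (1 - ?q) = 1" using small[OF t] by (simp add: power_divide)
    finally have "r t * cnj (r t) * (1 - of_real ?q) = 1" by (simp only: of_real_1)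
    then have "r t * cnj (r t) - (r t * (of_real t * w)) * cnj (r t * (of_real t * w)) = 1"
      unfolding complex_norm_square by (simp add: algebra_simps)
    then show "a t \<in> SU11" by (simp add: SU11_iff a_def r_def)
  qed (auto simp: a_def r_def mat2_simps)
  have "r 1 \<noteq> 0" using small[of 1] by (simp add: r_def)
  then have "moebius (a 1) 0 = w" by (simp add: moebius_def a_def)
  then show ?thesis
    using a by (intro that[of "path_class a"]) (auto simp: carrier_cover cover_proj_path_class)
qed

section \<open>The unitary action on Bergman spaces\<close>

lemma deriv_power_add: "deriv_power (l + m) g z = deriv_power l g z * deriv_power m g z"
  by (simp add: deriv_power_def ring_distribs exp_add)

lemma deriv_power_mult:
  assumes "g \<in> carrier SU11_cover" "h \<in> carrier SU11_cover" "z \<in> disc"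
  shows "deriv_power l (g \<otimes>\<^bsub>SU11_cover\<^esub> h) z = deriv_power l g (cover_act h z) * deriv_power l h z"
  by (simp add: deriv_power_def log_deriv_mult[OF assms] ring_distribs exp_add)

lemma deriv_power_one: "z \<in> disc \<Longrightarrow> deriv_power l \<one>\<^bsub>SU11_cover\<^esub> z = 1"
  by (simp only: deriv_power_def log_deriv_one mult_zero_right exp_zero)

text \<open>
  The branch of \<open>g'(z)^(1/2)\<close> on the cover is exactly \<open>1 / (c z + d)\<close>, without a sign ambiguity, because \<open>\<delta>\<close>
  exponentiates to \<open>d\<close>.
\<close>

lemma deriv_power_half_integer:
  assumes g: "g \<in> carrier SU11_cover" and z: "z \<in> disc"
  shows "deriv_power (l + real n / 2) g z = deriv_power l g z * (1 / automorphy (cover_proj g) z) ^ n"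
proof -
  obtain \<delta> where d: "exp \<delta> = cover_proj g $ 2 $ 2"
    "\<And>z. z \<in> disc \<Longrightarrow> log_deriv g z = - 2 * (\<delta> + Ln (1 + cover_proj g $ 2 $ 1 / cover_proj g $ 2 $ 2 * z))"
    using log_deriv_formula[OF g] by blast
  let ?x = "1 + cover_proj g $ 2 $ 1 / cover_proj g $ 2 $ 2 * z"
  note S = cover_proj_SU11[OF g]
  have "?x \<noteq> 0" using one_plus_ratio[OF S z] by auto
  then have "exp (\<delta> + Ln ?x) = automorphy (cover_proj g) z"
    by (simp add: exp_add d(1) automorphy_factored[OF S])
  moreover have "of_real (real n / 2) * log_deriv g z = of_nat n * (- (\<delta> + Ln ?x))"
    unfolding d(2)[OF z] by simp
  ultimately have "deriv_power (real n / 2) g z = (1 / automorphy (cover_proj g) z) ^ n"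
    unfolding deriv_power_def by (simp only: exp_of_nat_mult exp_minus inverse_eq_divide)
  then show ?thesis by (simp add: deriv_power_add)
qed

lemma deriv_power_has_derivative:
  assumes g: "g \<in> carrier SU11_cover" and z: "z \<in> disc"
  shows "(deriv_power l g has_field_derivative
     - of_real (2 * l) * (cover_proj g $ 2 $ 1) * (1 / automorphy (cover_proj g) z) * deriv_power l g z) (at z)"
proof -
  obtain \<delta> where d: "exp \<delta> = cover_proj g $ 2 $ 2"
    "\<And>z. z \<in> disc \<Longrightarrow> log_deriv g z = - 2 * (\<delta> + Ln (1 + cover_proj g $ 2 $ 1 / cover_proj g $ 2 $ 2 * z))"
    using log_deriv_formula[OF g] by blast
  let ?c = "cover_proj g $ 2 $ 1" and ?d = "cover_proj g $ 2 $ 2"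
  let ?E = "\<lambda>z. exp (of_real l * (- 2 * (\<delta> + Ln (1 + ?c / ?d * z))))"
  note S = cover_proj_SU11[OF g]
  have nn: "1 + ?c / ?d * z \<notin> \<real>\<^sub>\<le>\<^sub>0" by (rule one_plus_ratio[OF S z])
  have "(?E has_field_derivative ?E z * (of_real l * (- 2 * (?c / ?d * (1 / (1 + ?c / ?d * z)))))) (at z)"
    using nn by (auto intro!: derivative_eq_intros simp: field_simps)
  moreover have "?c / ?d * (1 / (1 + ?c / ?d * z)) = ?c * (1 / automorphy (cover_proj g) z)"
    unfolding automorphy_factored[OF S] by simp
  ultimately have "(?E has_field_derivative ?E z * (of_real l * (- 2 * (?c * (1 / automorphy (cover_proj g) z))))) (at z)"
    by (simp only:)
  then have "(deriv_power l g has_field_derivative ?E z * (of_real l * (- 2 * (?c * (1 / automorphy (cover_proj g) z))))) (at z)"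
    by (rule has_field_derivative_transform_within_open[OF _ open_ball z]) (simp add: deriv_power_def d(2) del: mem_ball mem_ball_0)
  moreover have "?E z = deriv_power l g z" by (simp only: deriv_power_def d(2)[OF z])
  ultimately show ?thesis by (simp add: mult_ac)
qed

lemma deriv_power_kernel:
  assumes g: "g \<in> carrier SU11_cover" and z: "z \<in> disc" and w: "w \<in> disc"
  shows "deriv_power l g z * cnj (deriv_power l g w)
      * (1 - cover_act g z * cnj (cover_act g w)) powr of_real (- 2 * l)
    = (1 - z * cnj w) powr of_real (- 2 * l)"
proof -
  have nz: "1 - x * cnj y \<noteq> 0" if "x \<in> disc" "y \<in> disc" for x y
  proof
    assume "1 - x * cnj y = 0"
    then have "cmod (x * cnj y) = 1" by (simp flip: norm_mult)
    then show False using mult_strict_mono[of "cmod x" 1 "cmod y" 1] that by (simp add: norm_mult)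
  qed
  note m = moebius_disc[OF cover_proj_SU11[OF g]]
  have "deriv_power l g z * cnj (deriv_power l g w)
      * (1 - cover_act g z * cnj (cover_act g w)) powr of_real (- 2 * l)
    = exp (of_real l * (log_deriv g z + cnj (log_deriv g w) - 2 * Ln (1 - cover_act g z * cnj (cover_act g w))))"
    using nz[OF m[OF z] m[OF w]]
    by (simp add: deriv_power_def powr_def exp_add[symmetric] exp_cnj algebra_simps)
  also have "\<dots> = (1 - z * cnj w) powr of_real (- 2 * l)"
    unfolding log_deriv_kernel[OF assms] using nz[OF z w] by (simp add: powr_def algebra_simps)
  finally show ?thesis .
qed

text \<open>
  The operator of the inverse group element, which turns group products into compositions in the
  opposite order.
\<close>

definition weighted_pullback ::
  "real \<Rightarrow> (real \<Rightarrow> complex ^ 2 ^ 2) set \<Rightarrow> (complex \<Rightarrow> complex) \<Rightarrow> complex \<Rightarrow> complex" where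
  "weighted_pullback l g f = on_disc (\<lambda>z. deriv_power l g z * f (cover_act g z))"

lemma weighted_pullback_apply:
  "z \<in> disc \<Longrightarrow> weighted_pullback l g f z = deriv_power l g z * f (cover_act g z)"
  "z \<notin> disc \<Longrightarrow> weighted_pullback l g f z = 0"
  by (simp_all add: weighted_pullback_def on_disc_def)

lemma D_act_eq: "D_act l g = weighted_pullback l (inv\<^bsub>SU11_cover\<^esub> g)"
  by (simp add: fun_eq_iff D_act_def weighted_pullback_def Let_def)

lemma weighted_pullback_hol:
  assumes g: "g \<in> carrier SU11_cover" and f: "f \<in> hol_disc"
  shows "weighted_pullback l g f \<in> hol_disc"
  unfolding weighted_pullback_def
proof (intro on_disc_hol holomorphic_on_mult)
  show "deriv_power l g holomorphic_on disc"
    using deriv_power_has_derivative[OF g] holomorphic_on_open[OF open_ball] by blast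
  have "cover_act g holomorphic_on disc"
    using moebius_deriv[OF cover_proj_SU11[OF g]] holomorphic_on_open[OF open_ball] by blast
  moreover have "f holomorphic_on disc" using f by (simp add: hol_disc_def)
  ultimately have "f \<circ> cover_act g holomorphic_on disc"
    by (rule holomorphic_on_compose_gen) (use moebius_disc[OF cover_proj_SU11[OF g]] in blast)
  then show "(\<lambda>z. f (cover_act g z)) holomorphic_on disc" by (simp add: o_def)
qed

lemma weighted_pullback_mult:
  assumes g: "g \<in> carrier SU11_cover" and h: "h \<in> carrier SU11_cover"
  shows "weighted_pullback l (g \<otimes>\<^bsub>SU11_cover\<^esub> h) f = weighted_pullback l h (weighted_pullback l g f)"
proof
  fix z
  show "weighted_pullback l (g \<otimes>\<^bsub>SU11_cover\<^esub> h) f z = weighted_pullback l h (weighted_pullback l g f) z"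
  proof (cases "z \<in> disc")
    case True
    note hz = moebius_disc[OF cover_proj_SU11[OF h] True]
    show ?thesis
      by (simp only: weighted_pullback_apply(1)[OF True] weighted_pullback_apply(1)[OF hz]
          deriv_power_mult[OF g h True] cover_proj_mult[OF g h]
          moebius_mult(1)[OF cover_proj_SU11[OF g] cover_proj_SU11[OF h] True] mult_ac)
  next
    case False
    show ?thesis by (simp only: weighted_pullback_apply(2)[OF False])
  qed
qed

lemma weighted_pullback_one: "f \<in> hol_disc \<Longrightarrow> weighted_pullback l \<one>\<^bsub>SU11_cover\<^esub> f = f"
proof
  fix z assume "f \<in> hol_disc"
  then show "weighted_pullback l \<one>\<^bsub>SU11_cover\<^esub> f z = f z"
    by (cases "z \<in> disc")
       (auto simp: weighted_pullback_def on_disc_def deriv_power_one cover_proj_one moebius_one hol_disc_def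
         simp del: mem_ball mem_ball_0)
qed

lemma weighted_pullback_inv:
  assumes g: "g \<in> carrier SU11_cover" and f: "f \<in> hol_disc"
  shows "weighted_pullback l (inv\<^bsub>SU11_cover\<^esub> g) (weighted_pullback l g f) = f"
proof -
  interpret group SU11_cover by (rule group_cover)
  show ?thesis
    using weighted_pullback_mult[OF g inv_closed[OF g], of l f] weighted_pullback_one[OF f, of l] g by simp
qed

lemma weighted_pullback_add: "weighted_pullback l g (f + h) = weighted_pullback l g f + weighted_pullback l g h"
  and weighted_pullback_scale: "weighted_pullback l g (scale_fun c f) = scale_fun c (weighted_pullback l g f)"
  by (auto simp: weighted_pullback_def on_disc_def scale_fun_def fun_eq_iff ring_distribs)

text \<open>
  The image of the Bergman space with the transported inner product is again a Hilbert space, and the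
  kernel function at \<open>w\<close> is the image of a multiple of the kernel function at \<open>g w\<close>.  So the image
  satisfies the defining properties of the Bergman space and is equal to it by uniqueness.
\<close>

theorem weighted_pullback_unitary:
  assumes lam: "lam > 0" and g: "g \<in> carrier SU11_cover"
  shows "f \<in> bergman_carrier lam \<Longrightarrow> weighted_pullback lam g f \<in> bergman_carrier lam"
    and "f \<in> bergman_carrier lam \<Longrightarrow> h \<in> bergman_carrier lam \<Longrightarrow>
      bergman_inner lam (weighted_pullback lam g f) (weighted_pullback lam g h) = bergman_inner lam f h"
proof -
  let ?V = "bergman_carrier lam" and ?ip = "bergman_inner lam"
  let ?T = "weighted_pullback lam g" and ?S = "weighted_pullback lam (inv\<^bsub>SU11_cover\<^esub> g)"
  define ip' where "ip' F G = ?ip (?S F) (?S G)" for F G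
  note B = is_bergman_space_bergman[OF lam]
  have hs: "hilbert_space scale_fun ?V ?ip" and hol: "?V \<subseteq> hol_disc"
    using B by (auto simp: is_bergman_space_def)
  interpret complex_hilbert_space scale_fun ?V ?ip by unfold_locales (rule hs)
  have ip': "ip' (?T f) (?T h) = ?ip f h" if "f \<in> ?V" "h \<in> ?V" for f h
    using that hol weighted_pullback_inv[OF g] by (simp add: ip'_def subset_iff)
  have kV: "bergman_kernel lam w \<in> ?V" and ev: "f \<in> ?V \<Longrightarrow> f w = ?ip f (bergman_kernel lam w)"
    if "w \<in> disc" for w f
    using B that unfolding is_bergman_space_def bergman_kernel_def by blast+
  have bs: "is_bergman_space lam (?T ` ?V) ip'"
    unfolding is_bergman_space_def bergman_kernel_def[symmetric]
  proof (intro conjI ballI)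
    show "hilbert_space scale_fun (?T ` ?V) ip'"
      by (rule hilbert_space_transport[OF hs vector_space_scale_fun])
         (simp_all add: weighted_pullback_add weighted_pullback_scale ip')
    show "?T ` ?V \<subseteq> hol_disc" using weighted_pullback_hol[OF g] hol by blast
    fix w assume w: "w \<in> disc"
    note gw = moebius_disc[OF cover_proj_SU11[OF g] w]
    \<comment> \<open>the preimage of the kernel function at \<open>w\<close>, found from \<open>deriv_power_kernel\<close>\<close>
    let ?k = "scale_fun (cnj (deriv_power lam g w)) (bergman_kernel lam (cover_act g w))"
    have kk: "?k \<in> ?V" by (intro scale_V kV gw)
    have K: "bergman_kernel lam w = ?T ?k"
    proof
      fix z
      show "bergman_kernel lam w z = ?T ?k z"
      proof (cases "z \<in> disc")
        case True
        note gz = moebius_disc[OF cover_proj_SU11[OF g] True]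
        show ?thesis
          using deriv_power_kernel[OF g True w, of lam] True gz
          by (simp add: weighted_pullback_def on_disc_def bergman_kernel_def scale_fun_def mult_ac)
      qed (simp add: weighted_pullback_def on_disc_def bergman_kernel_def)
    qed
    show "bergman_kernel lam w \<in> ?T ` ?V" unfolding K using kk by blast
    fix F assume "F \<in> ?T ` ?V"
    then obtain f where f: "F = ?T f" "f \<in> ?V" by blast
    have "ip' F (bergman_kernel lam w) = ?ip f ?k"
      unfolding K f(1) by (rule ip'[OF f(2) kk])
    also have "\<dots> = deriv_power lam g w * f (cover_act g w)"
      by (simp only: ip_scale_right[OF kV[OF gw] f(2)] complex_cnj_cnj ev[OF gw f(2)])
    finally show "F w = ip' F (bergman_kernel lam w)"
      by (simp only: f(1) weighted_pullback_apply(1)[OF w])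
  qed
  note eq = bergman_eqI[OF lam bs]
  show "?T f \<in> ?V" if "f \<in> ?V" using eq(1) that by blast
  show "?ip (?T f) (?T h) = ?ip f h" if "f \<in> ?V" "h \<in> ?V"
    using eq(2)[of "?T f" "?T h"] ip' that by simp
qed

section \<open>Higher derivatives of the action\<close>

definition pullback_coeff :: "real \<Rightarrow> nat \<Rightarrow> nat \<Rightarrow> real" where
  "pullback_coeff x k i = real (k choose i) * pochhammer (x + real i) (k - i)"

lemma pullback_coeff_0: "pullback_coeff x (Suc k) 0 = (x + real k) * pullback_coeff x k 0"
  by (simp add: pullback_coeff_def pochhammer_Suc)

text \<open>
  The Pascal rule for these coefficients, which is what differentiating one more time produces.
\<close>

lemma pullback_coeff_Suc:
  assumes "i \<le> k"
  shows "pullback_coeff x (Suc k) (Suc i)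
    = (x + real k + real (Suc i)) * pullback_coeff x k (Suc i) + pullback_coeff x k i"
proof (cases "i = k")
  case True
  then show ?thesis by (simp add: pullback_coeff_def)
next
  case False
  then obtain j where k: "k = i + 1 + j" using assms less_iff_Suc_add[of i k] by auto
  define P where "P = pochhammer (x + real i + 1) j"
  have 1: "pochhammer (x + real (Suc i)) (Suc j) = P * (x + real k)"
    by (simp add: P_def pochhammer_Suc k algebra_simps)
  have 2: "pochhammer (x + real i) (Suc j) = (x + real i) * P"
    by (simp add: P_def pochhammer_rec)
  have "Suc i * (k choose Suc i) = (k - i) * (k choose i)"
    using binomial_absorb_comp[of k i] binomial_absorption[of i "k - 1"] k
    by (metis Suc_times_binomial_add add.assoc add.commute add_diff_cancel_left' plus_1_eq_Suc)
  then have 3: "real (Suc i) * real (k choose Suc i) = (real k - real i) * real (k choose i)"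
    using k by (metis add_diff_cancel_left' of_nat_diff of_nat_mult le_add1 add.assoc)
  have "Suc k - Suc i = Suc j" "k - Suc i = j" "k - i = Suc j" using k by auto
  then have "pullback_coeff x (Suc k) (Suc i) = (real (k choose i) + real (k choose Suc i)) * (P * (x + real k))"
    "pullback_coeff x k (Suc i) = real (k choose Suc i) * P"
    "pullback_coeff x k i = real (k choose i) * ((x + real i) * P)"
    using 1 2 by (simp_all add: pullback_coeff_def P_def algebra_simps)
  moreover have "(real (k choose i) + real (k choose Suc i)) * (P * (x + real k))
      = P * ((x + real k) * real (k choose Suc i) + (real k - real i) * real (k choose i) + (x + real i) * real (k choose i))"
    by (simp add: algebra_simps)
  ultimately show ?thesis unfolding 3[symmetric] by (simp add: algebra_simps)
qed

text \<open>
  With \<open>q = 1 / (c z + d)\<close> the derivatives of \<open>g'^l\<close>, \<open>q\<close> and \<open>f^(i) \<circ> g\<close> are \<open>- 2 l c q g'^l\<close>, \<open>- c q\<^sup>2\<close> and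
  \<open>q\<^sup>2 (f^(i + 1) \<circ> g)\<close>, so each differentiation sends the \<open>i\<close>-th term to terms of index \<open>i\<close> and \<open>i + 1\<close>.
\<close>

lemma higher_deriv_weighted_pullback:
  assumes g: "g \<in> carrier SU11_cover" and f: "f \<in> hol_disc" and z: "z \<in> disc"
  defines "c \<equiv> cover_proj g $ 2 $ 1" and "q \<equiv> \<lambda>z. 1 / automorphy (cover_proj g) z"
  shows "(deriv ^^ k) (weighted_pullback l g f) z =
    (\<Sum>i\<le>k. of_real (pullback_coeff (2 * l) k i) * (- c) ^ (k - i) * (deriv_power l g z * q z ^ (k + i))
      * (deriv ^^ i) f (cover_act g z))"
  using z
proof (induction k arbitrary: z)
  case 0
  then show ?case by (simp add: weighted_pullback_def on_disc_def pullback_coeff_def)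
next
  case (Suc k)
  note S = cover_proj_SU11[OF g]
  let ?E = "deriv_power l g" and ?A = "\<lambda>k i. complex_of_real (pullback_coeff (2 * l) k i)"
  let ?f = "\<lambda>i z. (deriv ^^ i) f (cover_act g z)"
  have E: "(?E has_field_derivative - of_real (2 * l) * c * q z * ?E z) (at z)"
    using deriv_power_has_derivative[OF g Suc.prems, of l] by (simp add: c_def q_def)
  have autf0: "automorphy (cover_proj g) z \<noteq> 0" by (rule automorphy_nonzero[OF S Suc.prems])
  have q: "(q has_field_derivative - c * q z ^ 2) (at z)"
    unfolding q_def automorphy_def c_def using autf0
    by (auto intro!: derivative_eq_intros simp: automorphy_def power2_eq_square field_simps)
  have fi: "(?f i has_field_derivative ?f (Suc i) z * q z ^ 2) (at z)" for i
  proof -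
    have "(deriv ^^ i) f holomorphic_on disc"
      using f by (intro holomorphic_higher_deriv) (auto simp: hol_disc_def)
    from holomorphic_derivI[OF this open_ball moebius_disc[OF S Suc.prems]]
    have "((deriv ^^ i) f has_field_derivative ?f (Suc i) z) (at (cover_act g z))" by simp
    from DERIV_chain2[OF this moebius_deriv[OF S Suc.prems]]
    show ?thesis by (simp add: q_def power_divide)
  qed
  let ?t = "\<lambda>i. (- c) ^ (Suc k - i) * (?E z * q z ^ (Suc k + i)) * ?f i z"
  have qpow: "((\<lambda>z. q z ^ n) has_field_derivative - (of_nat n * c * q z) * q z ^ n) (at z)" for n
    using DERIV_power[OF q, of n] by (cases n) (simp_all add: mult_ac power2_eq_square)
  have dterm: "((\<lambda>z. ?A k i * (- c) ^ (k - i) * (?E z * q z ^ (k + i)) * ?f i z) has_field_derivative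
      ?A k i * of_real (2 * l + real k + real i) * ?t i + ?A k i * ?t (Suc i)) (at z)" if "i \<le> k" for i
  proof -
    note D = DERIV_mult'[OF DERIV_cmult[OF DERIV_mult'[OF E qpow[of "k + i"]],
          of "?A k i * (- c) ^ (k - i)"] fi[of i]]
    have "(- c) ^ (Suc k - i) = (- c) ^ (k - i) * (- c)"
      using that by (simp add: Suc_diff_le)
    then show ?thesis
      by (intro DERIV_cong[OF D]) (simp add: power_add power2_eq_square algebra_simps)
  qed
  have "((\<lambda>z. \<Sum>i\<le>k. ?A k i * (- c) ^ (k - i) * (?E z * q z ^ (k + i)) * ?f i z) has_field_derivative
      (\<Sum>i\<le>k. ?A k i * of_real (2 * l + real k + real i) * ?t i + ?A k i * ?t (Suc i))) (at z)"
    by (intro DERIV_sum dterm) auto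
  then have "((deriv ^^ k) (weighted_pullback l g f) has_field_derivative
      (\<Sum>i\<le>k. ?A k i * of_real (2 * l + real k + real i) * ?t i + ?A k i * ?t (Suc i))) (at z)"
    by (rule has_field_derivative_transform_within_open[OF _ open_ball Suc.prems]) (simp only: Suc.IH)
  then have "(deriv ^^ Suc k) (weighted_pullback l g f) z
      = (\<Sum>i\<le>k. ?A k i * of_real (2 * l + real k + real i) * ?t i + ?A k i * ?t (Suc i))"
    by (simp only: funpow.simps o_def DERIV_imp_deriv)
  also have "\<dots> = (\<Sum>i\<le>k. ?A k i * of_real (2 * l + real k + real i) * ?t i) + (\<Sum>i\<le>k. ?A k i * ?t (Suc i))"
    by (rule sum.distrib)
  \<comment> \<open>the added term vanishes because \<open>k choose Suc k\<close> is zero\<close>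
  also have "(\<Sum>i\<le>k. ?A k i * of_real (2 * l + real k + real i) * ?t i)
      = (\<Sum>i\<le>Suc k. ?A k i * of_real (2 * l + real k + real i) * ?t i)"
    by (simp add: pullback_coeff_def)
  also have "\<dots> = ?A k 0 * of_real (2 * l + real k + real 0) * ?t 0
      + (\<Sum>i\<le>k. ?A k (Suc i) * of_real (2 * l + real k + real (Suc i)) * ?t (Suc i))"
    by (rule sum.atMost_Suc_shift)
  also have "?A k 0 * of_real (2 * l + real k + real 0) * ?t 0 = ?A (Suc k) 0 * ?t 0"
    by (simp add: pullback_coeff_0 mult_ac)
  also have "?A (Suc k) 0 * ?t 0 + (\<Sum>i\<le>k. ?A k (Suc i) * of_real (2 * l + real k + real (Suc i)) * ?t (Suc i))
        + (\<Sum>i\<le>k. ?A k i * ?t (Suc i))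
      = ?A (Suc k) 0 * ?t 0 + (\<Sum>i\<le>k. ?A (Suc k) (Suc i) * ?t (Suc i))"
  proof -
    have "?A k (Suc i) * of_real (2 * l + real k + real (Suc i)) * ?t (Suc i) + ?A k i * ?t (Suc i)
        = ?A (Suc k) (Suc i) * ?t (Suc i)" if "i \<in> {..k}" for i
    proof -
      have "?A (Suc k) (Suc i) = ?A k (Suc i) * of_real (2 * l + real k + real (Suc i)) + ?A k i"
        using that by (subst pullback_coeff_Suc) (simp_all only: atMost_iff of_real_add of_real_mult mult.commute)
      then show ?thesis by (simp only: ring_distribs)
    qed
    then show ?thesis by (simp only: add.assoc sum.distrib[symmetric] cong: sum.cong)
  qed
  also have "\<dots> = (\<Sum>i\<le>Suc k. ?A (Suc k) i * ?t i)" by (rule sum.atMost_Suc_shift[symmetric])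
  finally show ?case by (simp only: mult.assoc)
qed

text \<open>
  Dividing by \<open>k! (2 l)\<^sub>k\<close> separates the coefficient into a factor of the multiplier, depending
  on \<open>k - i\<close>, and a factor of the intertwining map, depending on \<open>i\<close>.
\<close>

lemma normalised_deriv_weighted_pullback:
  assumes g: "g \<in> carrier SU11_cover" and f: "f \<in> hol_disc" and z: "z \<in> disc" and l: "l > 0"
  shows "1 / fact k * (1 / of_real (pochhammer (2 * l) k)) * (deriv ^^ k) (weighted_pullback l g f) z =
    (\<Sum>i\<le>k. 1 / fact (k - i) * (- (cover_proj g $ 2 $ 1)) ^ (k - i) * deriv_power (l + real (k + i) / 2) g z
      * (1 / fact i * (1 / of_real (pochhammer (2 * l) i)) * (deriv ^^ i) f (cover_act g z)))"
  unfolding higher_deriv_weighted_pullback[OF g f z] sum_distrib_left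
proof (rule sum.cong[OF refl])
  fix i assume "i \<in> {..k}"
  then have i: "i \<le> k" by simp
  have p: "pochhammer (2 * l) k = pochhammer (2 * l) i * pochhammer (2 * l + real i) (k - i)"
    by (rule pochhammer_product[OF i])
  have nz: "pochhammer (2 * l) i > 0" "pochhammer (2 * l + real i) (k - i) > 0"
    using l by (auto intro!: pochhammer_pos)
  have "1 / fact k * (1 / pochhammer (2 * l) k) * pullback_coeff (2 * l) k i
      = 1 / fact (k - i) * (1 / fact i * (1 / pochhammer (2 * l) i))"
    unfolding pullback_coeff_def p binomial_fact[OF i] using nz by (simp add: field_simps)
  from arg_cong[OF this, of complex_of_real]
  have coeff: "1 / fact k * (1 / complex_of_real (pochhammer (2 * l) k)) * of_real (pullback_coeff (2 * l) k i)
      = 1 / fact (k - i) * (1 / fact i * (1 / of_real (pochhammer (2 * l) i)))"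
    by (simp only: of_real_mult of_real_divide of_real_1 of_real_fact)
  have "1 / fact k * (1 / complex_of_real (pochhammer (2 * l) k)) *
       (of_real (pullback_coeff (2 * l) k i) * (- (cover_proj g $ 2 $ 1)) ^ (k - i) *
        (deriv_power l g z * (1 / automorphy (cover_proj g) z) ^ (k + i)) * (deriv ^^ i) f (cover_act g z))
     = (1 / fact k * (1 / complex_of_real (pochhammer (2 * l) k)) * of_real (pullback_coeff (2 * l) k i))
       * (- (cover_proj g $ 2 $ 1)) ^ (k - i) *
        (deriv_power l g z * (1 / automorphy (cover_proj g) z) ^ (k + i)) * (deriv ^^ i) f (cover_act g z)"
    by (simp only: mult_ac)
  then show "1 / fact k * (1 / complex_of_real (pochhammer (2 * l) k)) *
       (of_real (pullback_coeff (2 * l) k i) * (- (cover_proj g $ 2 $ 1)) ^ (k - i) *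
        (deriv_power l g z * (1 / automorphy (cover_proj g) z) ^ (k + i)) * (deriv ^^ i) f (cover_act g z))
     = 1 / fact (k - i) * (- (cover_proj g $ 2 $ 1)) ^ (k - i) * deriv_power (l + real (k + i) / 2) g z
      * (1 / fact i * (1 / of_real (pochhammer (2 * l) i)) * (deriv ^^ i) f (cover_act g z))"
    unfolding coeff deriv_power_half_integer[OF g z] by (simp only: mult_ac)
qed

section \<open>Equivariance and injectivity of the intertwining map\<close>

lemma Yprod_steps_support:
  "Yprod_steps blk Y l k $ p $ q \<noteq> 0 \<Longrightarrow> blk p = l + k \<and> blk q = l"
proof (induction k arbitrary: p)
  case 0
  then show ?case by (auto simp: block_def split: if_splits)
next
  case (Suc k)
  then obtain r where "block blk (l + Suc k) (l + k) Y $ p $ r \<noteq> 0" "Yprod_steps blk Y l k $ r $ q \<noteq> 0"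
    by (auto simp: matrix_matrix_mult_def elim!: sum.not_neutral_contains_not_neutral)
  with Suc.IH[of r] show ?case by (auto simp: block_def split: if_splits)
qed

lemma Yprod_support: "l \<le> p \<Longrightarrow> Yprod blk Y p l $ i $ k \<noteq> 0 \<Longrightarrow> blk i = p \<and> blk k = l"
  using Yprod_steps_support[of blk Y l "p - l" i k] by (auto simp: Yprod_def)

lemma block_one_mult:
  assumes "\<And>p q. A $ p $ q \<noteq> 0 \<Longrightarrow> blk p = l"
  shows "block blk l l (mat 1) ** A = A"
proof -
  have "(\<Sum>r\<in>UNIV. block blk l l (mat 1) $ p $ r * A $ r $ q) = A $ p $ q" for p q
  proof -
    have "block blk l l (mat 1) $ p $ r * A $ r $ q = (if r = p then A $ p $ q else 0)" for r
      using assms[of r q] by (auto simp: block_def mat_def)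
    then show ?thesis by simp
  qed
  then show ?thesis by (simp add: vec_eq_iff matrix_matrix_mult_def)
qed

lemma Yprod_steps_add:
  "Yprod_steps blk Y (l + a) b ** Yprod_steps blk Y l a = Yprod_steps blk Y l (a + b)"
proof (induction b)
  case 0
  show ?case using Yprod_steps_support[of blk Y l a] by (simp add: block_one_mult)
next
  case (Suc b)
  then show ?case by (simp add: matrix_mul_assoc[symmetric] add.assoc)
qed

lemma Yprod_trans: "j \<le> r \<Longrightarrow> r \<le> l \<Longrightarrow> Yprod blk Y l r ** Yprod blk Y r j = Yprod blk Y l j"
  using Yprod_steps_add[of blk Y j "r - j" "l - r"] by (simp add: Yprod_def)

lemma Yprod_refl: "Yprod blk Y l l $ p $ q = (if p = q \<and> blk p = l then 1 else 0)"
  by (auto simp: Yprod_def block_def mat_def)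

text \<open>
  The factor with which a derivative of the \<open>k\<close>-th component enters the \<open>p\<close>-th component of \<open>\<Gamma>\<close>.  Indexing by
  coordinates instead of blocks turns \<open>\<Gamma>\<close> into a single finite sum.
\<close>

definition gam_coeff ::
  "('n::finite \<Rightarrow> nat) \<Rightarrow> real \<Rightarrow> complex ^ 'n ^ 'n \<Rightarrow> 'n \<Rightarrow> 'n \<Rightarrow> complex" where
  "gam_coeff blk \<eta> Y p k = (if blk k \<le> blk p
     then 1 / fact (blk p - blk k) * (1 / of_real (pochhammer (2 * \<eta> + 2 * real (blk k)) (blk p - blk k)))
       * Yprod blk Y (blk p) (blk k) $ p $ k
     else 0)"

lemma Gam_component:
  assumes "z \<in> disc"
  shows "Gam blk \<eta> Y F z $ p =
    (\<Sum>k\<in>UNIV. gam_coeff blk \<eta> Y p k * (deriv ^^ (blk p - blk k)) (\<lambda>w. F w $ k) z)"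
proof -
  let ?l = "blk p"
  let ?c = "\<lambda>j. 1 / fact (?l - j) * (1 / complex_of_real (pochhammer (2 * \<eta> + 2 * real j) (?l - j)))"
  have "Gam blk \<eta> Y F z $ p = (\<Sum>j=0..?l. \<Sum>k\<in>UNIV.
      ?c j * (Yprod blk Y ?l j $ p $ k * (deriv ^^ (?l - j)) (\<lambda>w. F w $ k) z))"
    using assms by (simp add: Gam_def on_disc_def Let_def matrix_vector_mult_def sum_distrib_left)
  also have "\<dots> = (\<Sum>k\<in>UNIV. \<Sum>j=0..?l.
      ?c j * (Yprod blk Y ?l j $ p $ k * (deriv ^^ (?l - j)) (\<lambda>w. F w $ k) z))"
    by (rule sum.swap)
  also have "\<dots> = (\<Sum>k\<in>UNIV. gam_coeff blk \<eta> Y p k * (deriv ^^ (blk p - blk k)) (\<lambda>w. F w $ k) z)"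
  proof (rule sum.cong[OF refl])
    fix k
    have "(\<Sum>j=0..?l. ?c j * (Yprod blk Y ?l j $ p $ k * (deriv ^^ (?l - j)) (\<lambda>w. F w $ k) z))
        = (\<Sum>j=0..?l. if j = blk k then ?c j * (Yprod blk Y ?l j $ p $ k * (deriv ^^ (?l - j)) (\<lambda>w. F w $ k) z) else 0)"
      using Yprod_support[of _ ?l blk Y p k] by (intro sum.cong) auto
    also have "\<dots> = gam_coeff blk \<eta> Y p k * (deriv ^^ (blk p - blk k)) (\<lambda>w. F w $ k) z"
      by (simp add: gam_coeff_def)
    finally show "(\<Sum>j=0..?l. ?c j * (Yprod blk Y ?l j $ p $ k * (deriv ^^ (?l - j)) (\<lambda>w. F w $ k) z))
        = gam_coeff blk \<eta> Y p k * (deriv ^^ (blk p - blk k)) (\<lambda>w. F w $ k) z" .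
  qed
  finally show ?thesis .
qed

lemma gam_coeff_same_block: "blk k = blk p \<Longrightarrow> gam_coeff blk \<eta> Y p k = (if k = p then 1 else 0)"
  by (simp add: gam_coeff_def Yprod_refl)

definition vec_pullback ::
  "('n::finite \<Rightarrow> nat) \<Rightarrow> real \<Rightarrow> (real \<Rightarrow> complex ^ 2 ^ 2) set \<Rightarrow>
    (complex \<Rightarrow> complex ^ 'n) \<Rightarrow> complex \<Rightarrow> complex ^ 'n" where
  "vec_pullback blk \<eta> g f = (\<lambda>z. \<chi> i. weighted_pullback (\<eta> + real (blk i)) g (\<lambda>w. f w $ i) z)"

definition multiplier_pullback ::
  "('n::finite \<Rightarrow> nat) \<Rightarrow> real \<Rightarrow> complex ^ 'n ^ 'n \<Rightarrow> (real \<Rightarrow> complex ^ 2 ^ 2) set \<Rightarrow>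
    (complex \<Rightarrow> complex ^ 'n) \<Rightarrow> complex \<Rightarrow> complex ^ 'n" where
  "multiplier_pullback blk \<eta> Y g F = on_disc (\<lambda>z. multiplier blk \<eta> Y g z *v F (cover_act g z))"

lemma A_act_eq: "A_act blk \<eta> g = vec_pullback blk \<eta> (inv\<^bsub>SU11_cover\<^esub> g)"
  by (simp add: fun_eq_iff A_act_def vec_pullback_def D_act_eq)

lemma U_act_eq: "U_act blk \<eta> Y g = multiplier_pullback blk \<eta> Y (inv\<^bsub>SU11_cover\<^esub> g)"
  by (simp add: fun_eq_iff U_act_def multiplier_pullback_def Let_def)

text \<open>
  The matrix entry form of equivariance.  The coordinates \<open>q\<close> of block \<open>blk k + i\<close> contribute the
  \<open>i\<close>-th term of \<open>normalised_deriv_weighted_pullback\<close>, and summing over the coordinates in one block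
  composes the products of the \<open>Y\<^sub>j\<close>.
\<close>

lemma multiplier_gam_coeff_sum:
  fixes blk :: "'n::finite \<Rightarrow> nat"
  assumes g: "g \<in> carrier SU11_cover" and f: "f \<in> hol_disc" and z: "z \<in> disc" and \<eta>: "\<eta> > 0"
  shows "gam_coeff blk \<eta> Y p k * (deriv ^^ (blk p - blk k)) (weighted_pullback (\<eta> + real (blk k)) g f) z
    = (\<Sum>q\<in>UNIV. multiplier blk \<eta> Y g z $ p $ q *
        (gam_coeff blk \<eta> Y q k * (deriv ^^ (blk q - blk k)) f (cover_act g z)))"
proof (cases "blk k \<le> blk p")
  case False
  then show ?thesis by (auto simp: gam_coeff_def multiplier_def intro!: sum.neutral)
next
  case True
  let ?j = "blk k"
  from True obtain n where n: "blk p = ?j + n" using le_iff_add by blast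
  let ?l = "?j + n"
  let ?c = "cover_proj g $ 2 $ 1"
  define M where "M i = 1 / fact (n - i) * (- ?c) ^ (n - i) * deriv_power (\<eta> + real ?j + real (n + i) / 2) g z
      * (1 / fact i * (1 / of_real (pochhammer (2 * (\<eta> + real ?j)) i)) * (deriv ^^ i) f (cover_act g z))" for i
  have pos: "\<eta> + real ?j > 0" using \<eta> by simp
  have term_q: "multiplier blk \<eta> Y g z $ p $ q * (gam_coeff blk \<eta> Y q k * (deriv ^^ (blk q - blk k)) f (cover_act g z))
      = (\<Sum>i\<le>n. Yprod blk Y ?l (?j + i) $ p $ q * Yprod blk Y (?j + i) ?j $ q $ k * M i)" for q
  proof (cases "?j \<le> blk q \<and> blk q \<le> ?l")
    case q: True
    define i where "i = blk q - ?j"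
    have i: "blk q = ?j + i" "i \<le> n" using q n by (auto simp: i_def)
    have "Yprod blk Y (?j + i') ?j $ q $ k = 0" if "i' \<noteq> i" for i'
      using Yprod_support[of ?j "?j + i'" blk Y q k] i(1) that by auto
    then have "(\<Sum>i'\<le>n. Yprod blk Y ?l (?j + i') $ p $ q * Yprod blk Y (?j + i') ?j $ q $ k * M i')
        = (\<Sum>i'\<le>n. if i' = i then Yprod blk Y ?l (?j + i) $ p $ q * Yprod blk Y (?j + i) ?j $ q $ k * M i else 0)"
      by (intro sum.cong) auto
    also have "\<dots> = Yprod blk Y ?l (?j + i) $ p $ q * Yprod blk Y (?j + i) ?j $ q $ k * M i"
      using i(2) by simp
    also have "\<dots> = multiplier blk \<eta> Y g z $ p $ q * (gam_coeff blk \<eta> Y q k * (deriv ^^ (blk q - blk k)) f (cover_act g z))"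
    proof -
      have eta: "\<eta> + real (?l + (?j + i)) / 2 = \<eta> + real ?j + real (n + i) / 2"
        by (simp add: field_simps)
      have "multiplier blk \<eta> Y g z $ p $ q = 1 / fact (n - i) * (- ?c) ^ (n - i)
          * deriv_power (\<eta> + real ?j + real (n + i) / 2) g z * Yprod blk Y ?l (?j + i) $ p $ q"
        using i(2) by (simp only: multiplier_def Let_def vec_lambda_beta i(1) n eta add_le_cancel_left
            if_True add_diff_cancel_left)
      moreover have "gam_coeff blk \<eta> Y q k
          = 1 / fact i * (1 / of_real (pochhammer (2 * (\<eta> + real ?j)) i)) * Yprod blk Y (?j + i) ?j $ q $ k"
        by (simp add: gam_coeff_def i(1) ring_distribs)
      moreover have "blk q - blk k = i" by (simp add: i(1))
      ultimately show ?thesis by (simp only: M_def mult_ac)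
    qed
    finally show ?thesis ..
  next
    case q: False
    have "Yprod blk Y (?j + i) ?j $ q $ k = 0" if "i \<le> n" for i
    proof (rule ccontr)
      assume "Yprod blk Y (?j + i) ?j $ q $ k \<noteq> 0"
      from Yprod_support[OF _ this] q that n show False by auto
    qed
    then show ?thesis using q by (auto simp: gam_coeff_def multiplier_def n)
  qed
  have "(\<Sum>q\<in>UNIV. multiplier blk \<eta> Y g z $ p $ q * (gam_coeff blk \<eta> Y q k * (deriv ^^ (blk q - blk k)) f (cover_act g z)))
      = (\<Sum>i\<le>n. \<Sum>q\<in>UNIV. Yprod blk Y ?l (?j + i) $ p $ q * Yprod blk Y (?j + i) ?j $ q $ k * M i)"
    unfolding term_q by (rule sum.swap)
  also have "\<dots> = (\<Sum>i\<le>n. Yprod blk Y ?l ?j $ p $ k * M i)"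
  proof (rule sum.cong[OF refl])
    fix i assume "i \<in> {..n}"
    then have "Yprod blk Y ?l (?j + i) ** Yprod blk Y (?j + i) ?j = Yprod blk Y ?l ?j"
      by (intro Yprod_trans) auto
    from arg_cong[OF this, of "\<lambda>A. A $ p $ k"]
    show "(\<Sum>q\<in>UNIV. Yprod blk Y ?l (?j + i) $ p $ q * Yprod blk Y (?j + i) ?j $ q $ k * M i)
        = Yprod blk Y ?l ?j $ p $ k * M i"
      by (simp add: matrix_matrix_mult_def flip: sum_distrib_right)
  qed
  also have "\<dots> = Yprod blk Y ?l ?j $ p $ k * (\<Sum>i\<le>n. M i)" by (simp add: sum_distrib_left)
  also have "(\<Sum>i\<le>n. M i) = 1 / fact n * (1 / of_real (pochhammer (2 * (\<eta> + real ?j)) n))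
      * (deriv ^^ n) (weighted_pullback (\<eta> + real ?j) g f) z"
    unfolding M_def by (rule normalised_deriv_weighted_pullback[OF g f z pos, symmetric])
  also have "Yprod blk Y ?l ?j $ p $ k * \<dots>
      = gam_coeff blk \<eta> Y p k * (deriv ^^ n) (weighted_pullback (\<eta> + real ?j) g f) z"
    by (simp add: gam_coeff_def n ring_distribs)
  finally show ?thesis by (simp add: n)
qed

theorem Gam_vec_pullback:
  assumes g: "g \<in> carrier SU11_cover" and F: "F \<in> hol_disc_vec" and \<eta>: "\<eta> > 0"
  shows "Gam blk \<eta> Y (vec_pullback blk \<eta> g F) = multiplier_pullback blk \<eta> Y g (Gam blk \<eta> Y F)"
proof
  fix z
  show "Gam blk \<eta> Y (vec_pullback blk \<eta> g F) z = multiplier_pullback blk \<eta> Y g (Gam blk \<eta> Y F) z"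
  proof (cases "z \<in> disc")
    case False
    then show ?thesis by (simp add: Gam_def multiplier_pullback_def on_disc_def)
  next
    case z: True
    note gz = moebius_disc[OF cover_proj_SU11[OF g] z]
    have hol: "(\<lambda>w. F w $ k) \<in> hol_disc" for k using F by (simp add: hol_disc_vec_def)
    show ?thesis
    proof (rule vec_eq_iff[THEN iffD2], rule allI)
      fix p
      have "multiplier_pullback blk \<eta> Y g (Gam blk \<eta> Y F) z $ p
          = (\<Sum>q\<in>UNIV. multiplier blk \<eta> Y g z $ p $ q * Gam blk \<eta> Y F (cover_act g z) $ q)"
        using z by (simp add: multiplier_pullback_def on_disc_def matrix_vector_mult_def)
      also have "\<dots> = (\<Sum>q\<in>UNIV. \<Sum>k\<in>UNIV. multiplier blk \<eta> Y g z $ p $ q *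
          (gam_coeff blk \<eta> Y q k * (deriv ^^ (blk q - blk k)) (\<lambda>w. F w $ k) (cover_act g z)))"
        by (simp only: Gam_component[OF gz] sum_distrib_left)
      also have "\<dots> = (\<Sum>k\<in>UNIV. \<Sum>q\<in>UNIV. multiplier blk \<eta> Y g z $ p $ q *
          (gam_coeff blk \<eta> Y q k * (deriv ^^ (blk q - blk k)) (\<lambda>w. F w $ k) (cover_act g z)))"
        by (rule sum.swap)
      also have "\<dots> = (\<Sum>k\<in>UNIV. gam_coeff blk \<eta> Y p k *
          (deriv ^^ (blk p - blk k)) (weighted_pullback (\<eta> + real (blk k)) g (\<lambda>w. F w $ k)) z)"
        by (simp only: multiplier_gam_coeff_sum[OF g hol z \<eta>])
      also have "\<dots> = Gam blk \<eta> Y (vec_pullback blk \<eta> g F) z $ p"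
        by (simp add: Gam_component[OF z] vec_pullback_def)
      finally show "Gam blk \<eta> Y (vec_pullback blk \<eta> g F) z $ p
          = multiplier_pullback blk \<eta> Y g (Gam blk \<eta> Y F) z $ p" ..
    qed
  qed
qed

lemma vec_component_simps:
  fixes F G :: "complex \<Rightarrow> complex ^ 'n"
  shows "(\<lambda>z. (F + G) z $ i) = (\<lambda>z. F z $ i) + (\<lambda>z. G z $ i)"
    "(\<lambda>z. (F - G) z $ i) = (\<lambda>z. F z $ i) - (\<lambda>z. G z $ i)"
    "(\<lambda>z. scale_vfun c F z $ i) = scale_fun c (\<lambda>z. F z $ i)"
    "(\<lambda>z. (0 :: complex \<Rightarrow> complex ^ 'n) z $ i) = 0"
  by (auto simp: scale_vfun_def scale_fun_def fun_eq_iff)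

lemma higher_deriv_hol_disc:
  assumes "f \<in> hol_disc" "g \<in> hol_disc" "z \<in> disc"
  shows "(deriv ^^ n) (f + g) z = (deriv ^^ n) f z + (deriv ^^ n) g z"
    and "(deriv ^^ n) (scale_fun c f) z = c * (deriv ^^ n) f z"
  using higher_deriv_add[of f disc g z n] higher_deriv_cmult[of f disc z n c] assms
  by (simp_all add: hol_disc_def scale_fun_def plus_fun_def)

lemma Gam_outside: "z \<notin> disc \<Longrightarrow> Gam blk \<eta> Y F z = 0"
  by (simp add: Gam_def on_disc_def)

lemma Gam_linear:
  assumes F: "F \<in> hol_disc_vec"
  shows Gam_add: "G \<in> hol_disc_vec \<Longrightarrow> Gam blk \<eta> Y (F + G) = Gam blk \<eta> Y F + Gam blk \<eta> Y G"
    and Gam_scale: "Gam blk \<eta> Y (scale_vfun c F) = scale_vfun c (Gam blk \<eta> Y F)"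
proof -
  have hol: "(\<lambda>w. F w $ k) \<in> hol_disc" if "F \<in> hol_disc_vec" for k and F :: "complex \<Rightarrow> complex ^ 'a"
    using that by (simp add: hol_disc_vec_def)
  show "Gam blk \<eta> Y (F + G) = Gam blk \<eta> Y F + Gam blk \<eta> Y G" if G: "G \<in> hol_disc_vec"
  proof
    fix z
    show "Gam blk \<eta> Y (F + G) z = (Gam blk \<eta> Y F + Gam blk \<eta> Y G) z"
    proof (cases "z \<in> disc")
      case True
      have "Gam blk \<eta> Y (F + G) z $ p = Gam blk \<eta> Y F z $ p + Gam blk \<eta> Y G z $ p" for p
        unfolding Gam_component[OF True] vec_component_simps
          higher_deriv_hol_disc(1)[OF hol[OF F] hol[OF G] True]
        by (simp add: ring_distribs sum.distrib)
      then show ?thesis by (simp add: vec_eq_iff)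
    qed (simp add: Gam_outside)
  qed
  show "Gam blk \<eta> Y (scale_vfun c F) = scale_vfun c (Gam blk \<eta> Y F)"
  proof
    fix z
    show "Gam blk \<eta> Y (scale_vfun c F) z = scale_vfun c (Gam blk \<eta> Y F) z"
    proof (cases "z \<in> disc")
      case True
      have "Gam blk \<eta> Y (scale_vfun c F) z $ p = c * Gam blk \<eta> Y F z $ p" for p
        unfolding Gam_component[OF True] vec_component_simps
          higher_deriv_hol_disc(2)[OF hol[OF F] hol[OF F] True] sum_distrib_left
        by (simp add: mult_ac)
      then show ?thesis by (simp add: vec_eq_iff scale_vfun_def)
    qed (simp add: Gam_outside scale_vfun_def)
  qed
qed

lemma Gam_hol:
  assumes "F \<in> hol_disc_vec"
  shows "Gam blk \<eta> Y F \<in> hol_disc_vec"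
proof -
  have hol: "(\<lambda>w. F w $ k) holomorphic_on disc" for k
    using assms by (simp add: hol_disc_vec_def hol_disc_def)
  have "(\<lambda>z. Gam blk \<eta> Y F z $ p) = on_disc (\<lambda>z.
      \<Sum>k\<in>UNIV. gam_coeff blk \<eta> Y p k * (deriv ^^ (blk p - blk k)) (\<lambda>w. F w $ k) z)" for p
  proof
    show "Gam blk \<eta> Y F z $ p = on_disc (\<lambda>z.
      \<Sum>k\<in>UNIV. gam_coeff blk \<eta> Y p k * (deriv ^^ (blk p - blk k)) (\<lambda>w. F w $ k) z) z" for z
      by (cases "z \<in> disc") (simp_all add: Gam_component Gam_outside on_disc_def del: mem_ball mem_ball_0)
  qed
  moreover have "on_disc (\<lambda>z. \<Sum>k\<in>UNIV. gam_coeff blk \<eta> Y p k * (deriv ^^ (blk p - blk k)) (\<lambda>w. F w $ k) z) \<in> hol_disc" for p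
    by (intro on_disc_hol holomorphic_intros holomorphic_higher_deriv hol open_ball)
  ultimately show ?thesis by (simp add: hol_disc_vec_def)
qed

text \<open>
  The coefficient of \<open>F\<^sub>p\<close> itself in the \<open>p\<close>-th component is \<open>1\<close>, and all others belong to lower blocks, so
  the components vanish by induction on the block.
\<close>

lemma Gam_eq_0_imp:
  assumes F: "F \<in> hol_disc_vec" and 0: "Gam blk \<eta> Y F = 0"
  shows "F = 0"
proof -
  have "(\<lambda>z. F z $ p) = (\<lambda>_. 0)" for p
  proof (induction "blk p" arbitrary: p rule: less_induct)
    case less
    show ?case
    proof
      fix z
      show "F z $ p = 0"
      proof (cases "z \<in> disc")
        case True
        have zero: "(deriv ^^ n) (\<lambda>_. 0 :: complex) = (\<lambda>_. 0)" for n by (induction n) auto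
        have "gam_coeff blk \<eta> Y p k * (deriv ^^ (blk p - blk k)) (\<lambda>w. F w $ k) z = (if k = p then F z $ p else 0)" for k
        proof (cases "blk k" "blk p" rule: linorder_cases)
          case less
          then show ?thesis using less.hyps[OF less] by (auto simp: zero)
        next
          case equal
          then show ?thesis by (simp add: gam_coeff_same_block)
        next
          case greater
          then show ?thesis by (auto simp: gam_coeff_def)
        qed
        then have "Gam blk \<eta> Y F z $ p = F z $ p" by (simp add: Gam_component[OF True])
        then show ?thesis using 0 by simp
      next
        case False
        then show ?thesis using F by (auto simp: hol_disc_vec_def hol_disc_def)
      qed
    qed
  qed
  then show ?thesis by (simp add: fun_eq_iff vec_eq_iff)
qed

section \<open>Finite direct sums of Hilbert spaces\<close>

lemma hilbert_space_direct_sum: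
  fixes V :: "'n::finite \<Rightarrow> (complex \<Rightarrow> complex) set"
  assumes hs: "\<And>i. hilbert_space scale_fun (V i) (ip i)"
  shows "hilbert_space scale_vfun {f. \<forall>i. (\<lambda>z. f z $ i) \<in> V i}
    (\<lambda>f g. \<Sum>i\<in>UNIV. ip i (\<lambda>z. f z $ i) (\<lambda>z. g z $ i))"
proof (rule hilbert_spaceI)
  interpret C: complex_hilbert_space scale_fun "V i" "ip i" for i by unfold_locales (rule hs)
  interpret W: vector_space scale_vfun by (rule vector_space_scale_vfun)
  let ?W = "{f. \<forall>i. (\<lambda>z. f z $ i) \<in> V i}"
  let ?ip = "\<lambda>f g. \<Sum>i\<in>UNIV. ip i (\<lambda>z. f z $ i) (\<lambda>z. g z $ i)"
  note comp = vec_component_simps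
  show "vector_space scale_vfun" by (rule vector_space_scale_vfun)
  show "W.subspace ?W"
    unfolding W.subspace_def mem_Collect_eq comp by (auto simp: comp C.V_closed simp del: plus_fun_apply zero_fun_apply)
  show "?ip (f + g) h = ?ip f h + ?ip g h" if "f \<in> ?W" "g \<in> ?W" "h \<in> ?W" for f g h
    using that unfolding comp by (simp add: C.ip_add_left sum.distrib)
  show "?ip (scale_vfun c f) g = c * ?ip f g" if "f \<in> ?W" "g \<in> ?W" for c f g
    using that unfolding comp by (simp add: C.ip_scale_left sum_distrib_left)
  show "?ip g f = cnj (?ip f g)" if "f \<in> ?W" "g \<in> ?W" for f g
    unfolding cnj_sum using that by (intro sum.cong refl C.ip_sym) auto
  show "Re (?ip f f) > 0" if f: "f \<in> ?W" "f \<noteq> 0" for f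
  proof -
    obtain i where "(\<lambda>z. f z $ i) \<noteq> 0"
      using f(2) by (auto simp: fun_eq_iff vec_eq_iff)
    then have "Re (ip i (\<lambda>z. f z $ i) (\<lambda>z. f z $ i)) > 0"
      using f(1) by (intro C.ip_pos) auto
    moreover have "Re (ip i (\<lambda>z. f z $ i) (\<lambda>z. f z $ i)) \<ge> 0" for i
      using C.nrm2_nonneg[of "\<lambda>z. f z $ i" i] f(1) by (simp add: C.nrm2_def)
    ultimately show ?thesis unfolding Re_sum by (intro sum_pos2[of UNIV i]) auto
  qed
  fix X :: "nat \<Rightarrow> complex \<Rightarrow> complex ^ 'n"
  assume X: "range X \<subseteq> ?W"
    and cau: "\<And>e. e > 0 \<Longrightarrow> \<exists>M. \<forall>a\<ge>M. \<forall>b\<ge>M. Re (?ip (X a - X b) (X a - X b)) < e"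
  have XV: "(\<lambda>z. X a z $ i) \<in> V i" for a i using X by auto
  have ip_eq: "Re (?ip (X a - f) (X a - f)) = (\<Sum>i\<in>UNIV. C.nrm2 i ((\<lambda>z. X a z $ i) - (\<lambda>z. f z $ i)))" for a f
    unfolding comp by (simp add: C.nrm2_def)
  have "\<exists>f\<in>V i. (\<lambda>a. C.nrm2 i ((\<lambda>z. X a z $ i) - f)) \<longlonglongrightarrow> 0" for i
  proof -
    obtain f where "f \<in> V i" "(\<lambda>a. C.nrm2 i ((\<lambda>z. X a z $ i) - f)) \<longlonglongrightarrow> 0"
    proof (rule C.complete[of "\<lambda>a z. X a z $ i" i])
      show "range (\<lambda>a z. X a z $ i) \<subseteq> V i" using XV by auto
      fix e :: real assume "e > 0"
      from cau[OF this] obtain M where M: "\<And>a b. a \<ge> M \<Longrightarrow> b \<ge> M \<Longrightarrow> Re (?ip (X a - X b) (X a - X b)) < e"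
        by blast
      have "C.nrm2 i ((\<lambda>z. X a z $ i) - (\<lambda>z. X b z $ i)) < e" if "a \<ge> M" "b \<ge> M" for a b
      proof -
        have "C.nrm2 i ((\<lambda>z. X a z $ i) - (\<lambda>z. X b z $ i))
            \<le> (\<Sum>i\<in>UNIV. C.nrm2 i ((\<lambda>z. X a z $ i) - (\<lambda>z. X b z $ i)))"
          by (rule member_le_sum[of i UNIV "\<lambda>i. C.nrm2 i ((\<lambda>z. X a z $ i) - (\<lambda>z. X b z $ i))"])
             (auto intro!: C.nrm2_nonneg C.diff_V XV)
        then show ?thesis using M[OF that] unfolding ip_eq by linarith
      qed
      then show "\<exists>M. \<forall>a\<ge>M. \<forall>b\<ge>M. C.nrm2 i ((\<lambda>z. X a z $ i) - (\<lambda>z. X b z $ i)) < e" by blast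
    qed auto
    then show ?thesis by blast
  qed
  then obtain f where f: "\<And>i. f i \<in> V i" "\<And>i. (\<lambda>a. C.nrm2 i ((\<lambda>z. X a z $ i) - f i)) \<longlonglongrightarrow> 0"
    by metis
  show "\<exists>f\<in>?W. (\<lambda>a. Re (?ip (X a - f) (X a - f))) \<longlonglongrightarrow> 0"
  proof
    show "(\<lambda>z. \<chi> i. f i z) \<in> ?W" using f(1) by simp
    have "(\<lambda>a. \<Sum>i\<in>UNIV. C.nrm2 i ((\<lambda>z. X a z $ i) - f i)) \<longlonglongrightarrow> (\<Sum>i\<in>(UNIV :: 'n set). 0)"
      by (intro tendsto_sum f)
    then show "(\<lambda>a. Re (?ip (X a - (\<lambda>z. \<chi> i. f i z)) (X a - (\<lambda>z. \<chi> i. f i z)))) \<longlonglongrightarrow> 0"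
      unfolding ip_eq by simp
  qed
qed

section \<open>Reproducing kernels of vector valued functions\<close>

lemma sum_fun_apply: "(\<Sum>i\<in>S. f i) z = (\<Sum>i\<in>S. f i z)" for f :: "'i \<Rightarrow> 'a \<Rightarrow> 'b::comm_monoid_add"
  by (induction S rule: infinite_finite_induct) auto

lemma (in complex_hilbert_space) ip_sum_right:
  assumes "\<And>i. i \<in> S \<Longrightarrow> f i \<in> V" "h \<in> V"
  shows "ip h (\<Sum>i\<in>S. f i) = (\<Sum>i\<in>S. ip h (f i))"
  using assms
proof (induction S rule: infinite_finite_induct)
  case (insert x S)
  then show ?case by (simp add: ip_add_right subspace_sum[OF subspace_V])
qed (simp_all add: ip_zero)

text \<open>
  The kernel is assembled column by column from the vectors that represent the coordinate functionals.
\<close>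

lemma reproducing_kernel_of_representers:
  fixes V :: "(complex \<Rightarrow> complex ^ 'n) set"
  assumes hs: "hilbert_space scale_vfun V ip" and off: "\<And>F z. F \<in> V \<Longrightarrow> z \<notin> disc \<Longrightarrow> F z = 0"
    and R: "\<And>w j. w \<in> disc \<Longrightarrow> R w j \<in> V"
    and ev: "\<And>F w j. w \<in> disc \<Longrightarrow> F \<in> V \<Longrightarrow> F w $ j = ip F (R w j)"
  shows "has_reproducing_kernel V ip (\<lambda>z w. \<chi> i j. R w j z $ i)"
  unfolding has_reproducing_kernel_def
proof (intro ballI allI)
  interpret complex_hilbert_space scale_vfun V ip by unfold_locales (rule hs)
  fix w \<xi> assume w: "w \<in> disc"
  have K: "on_disc (\<lambda>z. (\<chi> i j. R w j z $ i) *v \<xi>) = (\<Sum>j\<in>UNIV. scale_vfun (\<xi> $ j) (R w j))"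
  proof
    fix z
    show "on_disc (\<lambda>z. (\<chi> i j. R w j z $ i) *v \<xi>) z = (\<Sum>j\<in>UNIV. scale_vfun (\<xi> $ j) (R w j)) z"
      using off[OF R[OF w], of z]
      by (cases "z \<in> disc")
         (simp_all add: on_disc_def sum_fun_apply scale_vfun_def vec_eq_iff matrix_vector_mult_def mult.commute
           del: mem_ball mem_ball_0)
  qed
  have mem: "scale_vfun (\<xi> $ j) (R w j) \<in> V" for j by (intro scale_V R w)
  show "on_disc (\<lambda>z. (\<chi> i j. R w j z $ i) *v \<xi>) \<in> V \<and>
      (\<forall>f\<in>V. cinner_vec (f w) \<xi> = ip f (on_disc (\<lambda>z. (\<chi> i j. R w j z $ i) *v \<xi>)))"
    unfolding K
  proof (intro conjI ballI)
    show "(\<Sum>j\<in>UNIV. scale_vfun (\<xi> $ j) (R w j)) \<in> V" by (intro subspace_sum[OF subspace_V] mem)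
    fix f assume f: "f \<in> V"
    show "cinner_vec (f w) \<xi> = ip f (\<Sum>j\<in>UNIV. scale_vfun (\<xi> $ j) (R w j))"
      unfolding ip_sum_right[OF mem f] cinner_vec_def ip_scale_right[OF R[OF w] f] ev[OF w f]
      by (simp add: mult.commute)
  qed
qed

lemma higher_deriv_sum:
  assumes "finite S" "\<And>k. k \<in> S \<Longrightarrow> f k \<in> hol_disc" "z \<in> disc"
  shows "(deriv ^^ n) (\<lambda>w. \<Sum>k\<in>S. c k * f k w) z = (\<Sum>k\<in>S. c k * (deriv ^^ n) (f k) z)"
proof -
  have "(\<lambda>w. \<Sum>k\<in>S. c k * f k w) \<in> hol_disc \<and>
    (deriv ^^ n) (\<lambda>w. \<Sum>k\<in>S. c k * f k w) z = (\<Sum>k\<in>S. c k * (deriv ^^ n) (f k) z)"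
    using assms(1,2)
  proof (induction S)
    case empty
    have "(deriv ^^ n) (\<lambda>_. 0 :: complex) = (\<lambda>_. 0)" by (induction n) auto
    then show ?case using hol_disc_closed(1) by (simp add: zero_fun_def)
  next
    case (insert k S)
    have eq: "(\<lambda>w. \<Sum>k\<in>insert k S. c k * f k w) = scale_fun (c k) (f k) + (\<lambda>w. \<Sum>k\<in>S. c k * f k w)"
      using insert.hyps by (auto simp: scale_fun_def fun_eq_iff)
    have fk: "f k \<in> hol_disc" and IH: "(\<lambda>w. \<Sum>k\<in>S. c k * f k w) \<in> hol_disc"
      "(deriv ^^ n) (\<lambda>w. \<Sum>k\<in>S. c k * f k w) z = (\<Sum>k\<in>S. c k * (deriv ^^ n) (f k) z)"
      using insert by auto
    show ?case
      unfolding eq higher_deriv_hol_disc(1)[OF hol_disc_closed(3)[OF fk] IH(1) assms(3)]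
        higher_deriv_hol_disc(2)[OF fk fk assms(3)] IH(2)
      using insert.hyps IH(1) fk by (simp add: hol_disc_closed)
  qed
  then show ?thesis ..
qed

lemma adj_mult: "adj (A ** B) = adj B ** adj A"
  by (simp add: vec_eq_iff adj_def matrix_matrix_mult_def mult.commute)

lemma A_carrier_component: "f \<in> A_carrier blk \<eta> \<Longrightarrow> (\<lambda>z. f z $ i) \<in> bergman_carrier (\<eta> + real (blk i))"
  by (simp add: A_carrier_def)

section \<open>The image space and its kernel\<close>

locale intertwining_data =
  fixes blk :: "'n::finite \<Rightarrow> nat" and \<eta> :: real
    and Y N :: "complex ^ 'n ^ 'n"
  assumes eta: "\<eta> > 0" and N_diag: "block_diagonal blk N" and N_inv: "invertible N"
begin

abbreviation "V \<equiv> A_carrier blk \<eta>"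
abbreviation "H \<equiv> H_carrier blk \<eta> Y N"
abbreviation "T \<equiv> Gam_N blk \<eta> Y N"
abbreviation "ipV \<equiv> A_inner blk \<eta>"
abbreviation "ipH \<equiv> H_inner blk \<eta> Y N"

lemma weight_pos: "\<eta> + real (blk i) > 0" using eta by simp

lemma hilbert_V: "hilbert_space scale_vfun V ipV"
proof -
  have "hilbert_space scale_fun (bergman_carrier (\<eta> + real (blk i))) (bergman_inner (\<eta> + real (blk i)))" for i
    using is_bergman_space_bergman[OF weight_pos] by (simp add: is_bergman_space_def)
  from hilbert_space_direct_sum[OF this] show ?thesis by (simp add: A_carrier_def A_inner_def[abs_def])
qed

sublocale V: complex_hilbert_space scale_vfun V ipV
  by unfold_locales (rule hilbert_V)

lemma V_hol: "f \<in> V \<Longrightarrow> f \<in> hol_disc_vec"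
  using is_bergman_space_bergman[OF weight_pos]
  by (auto simp: A_carrier_def hol_disc_vec_def is_bergman_space_def)

lemma N_V_hol: "f \<in> hol_disc_vec \<Longrightarrow> (\<lambda>z. N *v f z) \<in> hol_disc_vec"
proof -
  assume "f \<in> hol_disc_vec"
  then have f: "(\<lambda>z. f z $ k) holomorphic_on disc" "\<And>z. z \<notin> disc \<Longrightarrow> f z $ k = 0" for k
    by (auto simp: hol_disc_vec_def hol_disc_def)
  show ?thesis
    unfolding hol_disc_vec_def hol_disc_def matrix_vector_mult_def
    using f by (auto intro!: holomorphic_intros)
qed

lemma T_hol: "f \<in> V \<Longrightarrow> T f \<in> hol_disc_vec"
  unfolding Gam_N_def by (intro Gam_hol N_V_hol V_hol)

lemma T_add: "f \<in> V \<Longrightarrow> g \<in> V \<Longrightarrow> T (f + g) = T f + T g"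
proof -
  assume "f \<in> V" "g \<in> V"
  moreover have "(\<lambda>z. N *v (f + g) z) = (\<lambda>z. N *v f z) + (\<lambda>z. N *v g z)"
    by (simp add: fun_eq_iff matrix_vector_right_distrib)
  ultimately show ?thesis unfolding Gam_N_def by (simp only: Gam_add N_V_hol V_hol)
qed

lemma T_scale: "f \<in> V \<Longrightarrow> T (scale_vfun c f) = scale_vfun c (T f)"
proof -
  assume "f \<in> V"
  moreover have "(\<lambda>z. N *v scale_vfun c f z) = scale_vfun c (\<lambda>z. N *v f z)"
    by (simp add: fun_eq_iff scale_vfun_def vec_eq_iff matrix_vector_mult_def sum_distrib_left mult_ac)
  ultimately show ?thesis unfolding Gam_N_def by (simp only: Gam_scale N_V_hol V_hol)
qed

lemma T_inj: "inj_on T V"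
proof (rule inj_onI)
  fix f g assume f: "f \<in> V" and g: "g \<in> V" and eq: "T f = T g"
  have fg: "f - g \<in> V" by (rule V.diff_V[OF f g])
  have "T (f - g) = 0" using T_add[OF fg g] eq by simp
  then have "(\<lambda>z. N *v (f - g) z) = 0"
    using Gam_eq_0_imp[OF N_V_hol[OF V_hol[OF fg]]] by (simp add: Gam_N_def)
  then have N0: "N *v (f z - g z) = 0" for z by (simp add: fun_eq_iff)
  obtain N' where N': "N' ** N = mat 1" using N_inv by (auto simp: invertible_def)
  have "f z - g z = 0" for z
    using arg_cong[OF N0[of z], of "\<lambda>x. N' *v x"] by (simp add: matrix_vector_mul_assoc N')
  then show "f = g" by (simp add: fun_eq_iff)
qed

lemma H_eq: "H = T ` V" by (simp add: H_carrier_def)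

lemma H_inner_T: "f \<in> V \<Longrightarrow> g \<in> V \<Longrightarrow> ipH (T f) (T g) = ipV f g"
  by (simp add: H_inner_def inv_into_f_f[OF T_inj])

lemma hilbert_H: "hilbert_space scale_vfun H ipH"
  unfolding H_eq
  by (rule hilbert_space_transport[OF hilbert_V vector_space_scale_vfun]) (simp_all add: T_add T_scale H_inner_T)

sublocale H: complex_hilbert_space scale_vfun H ipH
  by unfold_locales (rule hilbert_H)

lemma H_hol: "H \<subseteq> hol_disc_vec" unfolding H_eq using T_hol by blast

lemma T_isomorphism: "hilbert_isomorphism scale_vfun V ipV H ipH T"
  unfolding hilbert_isomorphism_def
  using hilbert_V hilbert_H T_inj T_add T_scale H_inner_T by (auto simp: bij_betw_def H_eq)

lemma vec_pullback_V:
  assumes g: "g \<in> carrier SU11_cover"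
  shows "f \<in> V \<Longrightarrow> vec_pullback blk \<eta> g f \<in> V"
    and "f \<in> V \<Longrightarrow> h \<in> V \<Longrightarrow> ipV (vec_pullback blk \<eta> g f) (vec_pullback blk \<eta> g h) = ipV f h"
  using weighted_pullback_unitary[OF weight_pos g]
  by (simp_all add: A_carrier_def A_inner_def vec_pullback_def)

lemma vec_pullback_mult:
  assumes "g \<in> carrier SU11_cover" "h \<in> carrier SU11_cover"
  shows "vec_pullback blk \<eta> (g \<otimes>\<^bsub>SU11_cover\<^esub> h) f = vec_pullback blk \<eta> h (vec_pullback blk \<eta> g f)"
  by (simp add: vec_pullback_def weighted_pullback_mult[OF assms])

lemma vec_pullback_one: "f \<in> V \<Longrightarrow> vec_pullback blk \<eta> \<one>\<^bsub>SU11_cover\<^esub> f = f"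
  using V_hol[of f] by (simp add: vec_pullback_def hol_disc_vec_def weighted_pullback_one vec_eq_iff fun_eq_iff)

lemma N_vec_pullback: "(\<lambda>z. N *v vec_pullback blk \<eta> g f z) = vec_pullback blk \<eta> g (\<lambda>z. N *v f z)"
proof
  fix z
  have "(N *v vec_pullback blk \<eta> g f z) $ p = vec_pullback blk \<eta> g (\<lambda>z. N *v f z) z $ p" for p
  proof (cases "z \<in> disc")
    case True
    have eq: "N $ p $ k * (deriv_power (\<eta> + real (blk k)) g z * f (cover_act g z) $ k)
        = deriv_power (\<eta> + real (blk p)) g z * (N $ p $ k * f (cover_act g z) $ k)" for k
      using N_diag by (cases "N $ p $ k = 0") (auto simp: block_diagonal_def)
    show ?thesis
      by (simp only: vec_pullback_def matrix_vector_mult_def weighted_pullback_apply(1)[OF True]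
          vec_lambda_beta sum_distrib_left eq)
  next
    case False
    then show ?thesis
      by (simp add: vec_pullback_def matrix_vector_mult_def weighted_pullback_apply(2)[OF False])
  qed
  then show "N *v vec_pullback blk \<eta> g f z = vec_pullback blk \<eta> g (\<lambda>z. N *v f z) z"
    by (simp add: vec_eq_iff)
qed

lemma T_vec_pullback:
  assumes "g \<in> carrier SU11_cover" "f \<in> V"
  shows "T (vec_pullback blk \<eta> g f) = multiplier_pullback blk \<eta> Y g (T f)"
  unfolding Gam_N_def N_vec_pullback
  by (rule Gam_vec_pullback[OF assms(1) N_V_hol[OF V_hol[OF assms(2)]] eta])

sublocale G: group SU11_cover by (rule group_cover)

lemma T_A_act:
  assumes "g \<in> carrier SU11_cover" "f \<in> V"
  shows "A_act blk \<eta> g f \<in> V" "T (A_act blk \<eta> g f) = U_act blk \<eta> Y g (T f)"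
  using assms by (simp_all add: A_act_eq U_act_eq vec_pullback_V T_vec_pullback)

lemma A_act_mult:
  assumes "g \<in> carrier SU11_cover" "h \<in> carrier SU11_cover"
  shows "A_act blk \<eta> (g \<otimes>\<^bsub>SU11_cover\<^esub> h) f = A_act blk \<eta> g (A_act blk \<eta> h f)"
  using assms by (simp add: A_act_eq G.inv_mult_group vec_pullback_mult)

lemma A_act_one: "f \<in> V \<Longrightarrow> A_act blk \<eta> \<one>\<^bsub>SU11_cover\<^esub> f = f"
  by (simp add: A_act_eq vec_pullback_one)

lemma A_act_onto: "g \<in> carrier SU11_cover \<Longrightarrow> A_act blk \<eta> g ` V = V"
proof (intro equalityI subsetI)
  assume g: "g \<in> carrier SU11_cover"
  fix f assume f: "f \<in> V"
  have "A_act blk \<eta> g (A_act blk \<eta> (inv\<^bsub>SU11_cover\<^esub> g) f) = f"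
    using A_act_mult[OF g G.inv_closed[OF g], of f] A_act_one[OF f] g by simp
  then show "f \<in> A_act blk \<eta> g ` V"
    using T_A_act(1)[OF G.inv_closed[OF g] f] by (metis imageI)
qed (auto intro: T_A_act)

lemma U_act_add: "U_act blk \<eta> Y g (F + G) = U_act blk \<eta> Y g F + U_act blk \<eta> Y g G"
  by (auto simp: U_act_eq multiplier_pullback_def on_disc_def fun_eq_iff matrix_vector_right_distrib)

lemma U_act_scale: "U_act blk \<eta> Y g (scale_vfun c F) = scale_vfun c (U_act blk \<eta> Y g F)"
  by (auto simp: U_act_eq multiplier_pullback_def on_disc_def scale_vfun_def fun_eq_iff vec_eq_iff
      matrix_vector_mult_def sum_distrib_left mult_ac)

theorem U_act_unitary: "unitary_action SU11_cover scale_vfun H ipH (U_act blk \<eta> Y)"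
  unfolding unitary_action_def
proof (intro conjI ballI allI)
  fix g assume g: "g \<in> carrier SU11_cover"
  have "U_act blk \<eta> Y g ` T ` V = T ` (A_act blk \<eta> g ` V)"
    unfolding image_image by (intro image_cong refl T_A_act(2)[OF g, symmetric])
  then show "U_act blk \<eta> Y g ` H = H" by (simp add: H_eq A_act_onto[OF g])
  show "ipH (U_act blk \<eta> Y g F) (U_act blk \<eta> Y g G) = ipH F G" if F: "F \<in> H" and G: "G \<in> H" for F G
  proof -
    obtain f where f: "F = T f" "f \<in> V" using F by (auto simp: H_eq)
    obtain h where h: "G = T h" "h \<in> V" using G by (auto simp: H_eq)
    note fh = f h
    have "ipH (T (A_act blk \<eta> g f)) (T (A_act blk \<eta> g h)) = ipV f h"
      using fh g by (simp add: H_inner_T T_A_act(1)) (simp add: A_act_eq vec_pullback_V(2))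
    then show ?thesis using fh g by (simp add: T_A_act(2) H_inner_T)
  qed
  show "U_act blk \<eta> Y (g \<otimes>\<^bsub>SU11_cover\<^esub> h) F = U_act blk \<eta> Y g (U_act blk \<eta> Y h F)"
    if h: "h \<in> carrier SU11_cover" and F: "F \<in> H" for h F
  proof -
    obtain f where f: "F = T f" "f \<in> V" using F by (auto simp: H_eq)
    show ?thesis
      unfolding f(1) T_A_act(2)[OF G.m_closed[OF g h] f(2), symmetric] T_A_act(2)[OF h f(2), symmetric]
        T_A_act(2)[OF g T_A_act(1)[OF h f(2)], symmetric] A_act_mult[OF g h] ..
  qed
next
  fix F assume "F \<in> H"
  then obtain f where f: "F = T f" "f \<in> V" by (auto simp: H_eq)
  show "U_act blk \<eta> Y \<one>\<^bsub>SU11_cover\<^esub> F = F"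
    unfolding f(1) T_A_act(2)[OF G.one_closed f(2), symmetric] A_act_one[OF f(2)] ..
qed (simp_all add: U_act_add U_act_scale)

lemmas U_act_facts = U_act_unitary[unfolded unitary_action_def]

text \<open>
  The entry at \<open>(p, i)\<close> of \<open>Y\<^sub>l \<cdots> Y\<^sub>j\<^sub>+\<^sub>1 N\<close>, where \<open>l\<close> and \<open>j\<close> are the blocks of \<open>p\<close> and \<open>i\<close>; only
  the case \<open>j \<le> l\<close> is meaningful.
\<close>

definition YN :: "'n \<Rightarrow> 'n \<Rightarrow> complex" where
  "YN p i = (Yprod blk Y (blk p) (blk i) ** N) $ p $ i"

text \<open>
  The representer of \<open>f \<mapsto> (\<Gamma> N f)\<^sub>p(0)\<close>.  The coefficient of \<open>\<Gamma>\<close> contains a Pochhammer symbol,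
  which cancels because the \<open>n\<close>-th derivative of \<open>f\<close> at \<open>0\<close> is \<open>(2 lam)\<^sub>n\<close> times the inner product with \<open>z\<^sup>n\<close>.
\<close>

definition origin_rep :: "'n \<Rightarrow> complex \<Rightarrow> complex ^ 'n" where
  "origin_rep p = (\<lambda>z. \<chi> i. scale_fun (if blk i \<le> blk p then cnj (YN p i) / fact (blk p - blk i) else 0)
      (disc_monomial (blk p - blk i)) z)"

lemma origin_rep_component: "(\<lambda>z. origin_rep p z $ i) =
    scale_fun (if blk i \<le> blk p then cnj (YN p i) / fact (blk p - blk i) else 0) (disc_monomial (blk p - blk i))"
  by (simp add: origin_rep_def)

lemma bergman_hilbert: "complex_hilbert_space scale_fun
    (bergman_carrier (\<eta> + real (blk i))) (bergman_inner (\<eta> + real (blk i)))"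
  using is_bergman_space_bergman[OF weight_pos[of i]] by unfold_locales (simp add: is_bergman_space_def)

lemma origin_rep_in_V: "origin_rep p \<in> V"
  unfolding A_carrier_def mem_Collect_eq origin_rep_component
  by (intro allI complex_hilbert_space.scale_V[OF bergman_hilbert] bergman_monomial(1) weight_pos)

lemma gam_coeff_N_sum:
  "(\<Sum>k\<in>UNIV. gam_coeff blk \<eta> Y p k * N $ k $ i) =
    (if blk i \<le> blk p then 1 / fact (blk p - blk i)
       * (1 / of_real (pochhammer (2 * \<eta> + 2 * real (blk i)) (blk p - blk i))) * YN p i else 0)"
proof -
  have "gam_coeff blk \<eta> Y p k * N $ k $ i =
    (if blk i \<le> blk p then 1 / fact (blk p - blk i)
       * (1 / of_real (pochhammer (2 * \<eta> + 2 * real (blk i)) (blk p - blk i)))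
       * (Yprod blk Y (blk p) (blk i) $ p $ k * N $ k $ i) else 0)" for k
    using N_diag by (cases "N $ k $ i = 0") (auto simp: gam_coeff_def block_diagonal_def)
  then show ?thesis
    by (simp add: YN_def matrix_matrix_mult_def sum_distrib_left)
qed

lemma T_at_0:
  assumes f: "f \<in> V"
  shows "T f 0 $ p = ipV f (origin_rep p)"
proof -
  have z0: "0 \<in> disc" by simp
  have hol: "(\<lambda>w. f w $ i) \<in> hol_disc" for i using V_hol[OF f] by (simp add: hol_disc_vec_def)
  let ?D = "\<lambda>n i. (deriv ^^ n) (\<lambda>w. f w $ i) 0"
  have "T f 0 $ p = (\<Sum>k\<in>UNIV. gam_coeff blk \<eta> Y p k * (\<Sum>i\<in>UNIV. N $ k $ i * ?D (blk p - blk k) i))"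
    unfolding Gam_N_def Gam_component[OF z0]
    by (simp add: matrix_vector_mult_def higher_deriv_sum[OF finite hol z0])
  also have "\<dots> = (\<Sum>k\<in>UNIV. \<Sum>i\<in>UNIV. gam_coeff blk \<eta> Y p k * N $ k $ i * ?D (blk p - blk i) i)"
  proof -
    have eq: "N $ k $ i * ?D (blk p - blk k) i = N $ k $ i * ?D (blk p - blk i) i" for k i
      using N_diag by (cases "N $ k $ i = 0") (auto simp: block_diagonal_def)
    show ?thesis
      unfolding sum_distrib_left mult.assoc by (intro sum.cong refl arg_cong2[of _ _ _ _ "(*)"] eq)
  qed
  also have "\<dots> = (\<Sum>i\<in>UNIV. (\<Sum>k\<in>UNIV. gam_coeff blk \<eta> Y p k * N $ k $ i) * ?D (blk p - blk i) i)"
    by (subst sum.swap) (simp add: sum_distrib_right)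
  also have "\<dots> = ipV f (origin_rep p)"
    unfolding A_inner_def
  proof (rule sum.cong[OF refl])
    fix i
    let ?n = "blk p - blk i" and ?lam = "\<eta> + real (blk i)"
    note fi = A_carrier_component[OF f, of i]
    note mono = bergman_monomial[OF weight_pos[of i], where n = ?n]
    have poch: "pochhammer (2 * ?lam) ?n > 0" using weight_pos[of i] by (intro pochhammer_pos) simp
    have D: "?D ?n i = of_real (pochhammer (2 * ?lam) ?n) * bergman_inner ?lam (\<lambda>w. f w $ i) (disc_monomial ?n)"
      unfolding mono(2)[OF fi] taylor_coeff_def binom_weight_def using poch by (simp add: field_simps)
    have "bergman_inner ?lam (\<lambda>w. f w $ i) (\<lambda>z. origin_rep p z $ i)
        = cnj (if blk i \<le> blk p then cnj (YN p i) / fact ?n else 0) * bergman_inner ?lam (\<lambda>w. f w $ i) (disc_monomial ?n)"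
      unfolding origin_rep_component by (rule complex_hilbert_space.ip_scale_right[OF bergman_hilbert mono(1) fi])
    moreover have "2 * \<eta> + 2 * real (blk i) = 2 * ?lam" by simp
    ultimately show "(\<Sum>k\<in>UNIV. gam_coeff blk \<eta> Y p k * N $ k $ i) * ?D ?n i
        = bergman_inner ?lam (\<lambda>w. f w $ i) (\<lambda>z. origin_rep p z $ i)"
      unfolding gam_coeff_N_sum D using poch by simp
  qed
  finally show ?thesis .
qed

text \<open>
  These are the entries of \<open>K(0, 0)\<close>: the two representers contribute \<open>1 / n!\<close> each and the squared norm of the
  monomial is \<open>n! / (2 \<eta> + 2 j)\<^sub>n\<close>, for \<open>n = l - j\<close>.
\<close>

lemma origin_rep_inner:
  assumes pk: "blk p = l" "blk k = l"
  shows "ipV (origin_rep k) (origin_rep p) = (\<Sum>j=0..l. of_real (1 / fact (l - j) * (1 / pochhammer (2 * \<eta> + 2 * real j) (l - j)))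
      * (\<Sum>i\<in>UNIV. if blk i = j then YN p i * cnj (YN k i) else 0))"
proof -
  let ?c = "\<lambda>j. complex_of_real (1 / fact (l - j) * (1 / pochhammer (2 * \<eta> + 2 * real j) (l - j)))"
  have comp: "bergman_inner (\<eta> + real (blk i)) (\<lambda>z. origin_rep k z $ i) (\<lambda>z. origin_rep p z $ i)
      = (\<Sum>j=0..l. ?c j * (if blk i = j then YN p i * cnj (YN k i) else 0))" for i
  proof -
    let ?n = "l - blk i" and ?lam = "\<eta> + real (blk i)"
    note mono = bergman_monomial[OF weight_pos[of i], where n = ?n]
    have lam2: "2 * \<eta> + 2 * real (blk i) = 2 * ?lam" by simp
    have mm: "bergman_inner ?lam (disc_monomial ?n) (disc_monomial ?n) = of_real (fact ?n / pochhammer (2 * ?lam) ?n)"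
      unfolding mono(2)[OF mono(1)] by (simp add: taylor_coeff_disc_monomial binom_weight_def)
    have "bergman_inner ?lam (\<lambda>z. origin_rep k z $ i) (\<lambda>z. origin_rep p z $ i) =
        (if blk i \<le> l then cnj (YN k i) / fact ?n else 0) *
        (cnj (if blk i \<le> l then cnj (YN p i) / fact ?n else 0) * of_real (fact ?n / pochhammer (2 * ?lam) ?n))"
      unfolding origin_rep_component pk mm[symmetric]
      by (simp only: complex_hilbert_space.ip_scale_left[OF bergman_hilbert mono(1)
            complex_hilbert_space.scale_V[OF bergman_hilbert mono(1)]]
          complex_hilbert_space.ip_scale_right[OF bergman_hilbert mono(1) mono(1)])
    also have "\<dots> = (if blk i \<le> l then ?c (blk i) * (YN p i * cnj (YN k i)) else 0)"
      unfolding lam2 by simp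
    also have "\<dots> = (\<Sum>j=0..l. if blk i = j then ?c (blk i) * (YN p i * cnj (YN k i)) else 0)" by simp
    also have "\<dots> = (\<Sum>j=0..l. ?c j * (if blk i = j then YN p i * cnj (YN k i) else 0))"
      by (intro sum.cong) auto
    finally show ?thesis .
  qed
  show ?thesis unfolding A_inner_def comp by (subst sum.swap) (simp only: sum_distrib_left)
qed

lemma block_product_entry:
  assumes "j \<le> l"
  shows "(Yprod blk Y l j ** block blk j j N ** adj (block blk j j N) ** adj (Yprod blk Y l j)) $ p $ k
    = (if blk p = l \<and> blk k = l then \<Sum>i\<in>UNIV. if blk i = j then YN p i * cnj (YN k i) else 0 else 0)"
proof -
  let ?B = "Yprod blk Y l j ** block blk j j N"
  have B: "?B $ p $ i = (if blk p = l \<and> blk i = j then YN p i else 0)" for p i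
  proof -
    have "Yprod blk Y l j $ p $ q * block blk j j N $ q $ i
        = (if blk p = l \<and> blk i = j then Yprod blk Y l j $ p $ q * N $ q $ i else 0)" for q
      using Yprod_support[OF assms, of blk Y p q] by (cases "Yprod blk Y l j $ p $ q = 0") (auto simp: block_def)
    then show ?thesis by (auto simp: YN_def matrix_matrix_mult_def)
  qed
  have "(Yprod blk Y l j ** block blk j j N ** adj (block blk j j N) ** adj (Yprod blk Y l j)) = ?B ** adj ?B"
    by (simp add: adj_mult matrix_mul_assoc)
  then have "(Yprod blk Y l j ** block blk j j N ** adj (block blk j j N) ** adj (Yprod blk Y l j)) $ p $ k
      = (\<Sum>i\<in>UNIV. ?B $ p $ i * cnj (?B $ k $ i))"
    by (simp add: matrix_matrix_mult_def[of ?B] adj_def)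
  also have "\<dots> = (if blk p = l \<and> blk k = l then \<Sum>i\<in>UNIV. if blk i = j then YN p i * cnj (YN k i) else 0 else 0)"
    unfolding B by (auto intro!: sum.cong sum.neutral)
  finally show ?thesis .
qed

lemma H_at_0: "F \<in> H \<Longrightarrow> F 0 $ p = ipH F (T (origin_rep p))"
  unfolding H_eq using T_at_0 H_inner_T origin_rep_in_V by auto

text \<open>
  If \<open>w = g 0\<close>, then \<open>F(w)\<close> is a matrix times the value at \<open>0\<close> of the translate of \<open>F\<close> by the inverse of \<open>g\<close>.  By
  unitarity the functional \<open>F \<mapsto> F(w)\<^sub>p\<close> is represented by the translate by \<open>g\<close> of a combination of
  the representers at \<open>0\<close>.
\<close>

lemma representer_exists:
  assumes w: "w \<in> disc"
  shows "\<exists>r\<in>H. \<forall>F\<in>H. F w $ p = ipH F r"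
proof -
  obtain g where g: "g \<in> carrier SU11_cover" and gw: "cover_act g 0 = w"
    using cover_transitive[OF w] by blast
  let ?U = "U_act blk \<eta> Y" and ?gi = "inv\<^bsub>SU11_cover\<^esub> g"
  note gi = G.inv_closed[OF g]
  define M where "M = multiplier blk \<eta> Y ?gi w"
  define s where "s = (\<Sum>k\<in>UNIV. scale_vfun (cnj (M $ p $ k)) (T (origin_rep k)))"
  have TH: "T (origin_rep k) \<in> H" for k using origin_rep_in_V by (simp add: H_eq)
  have mem: "scale_vfun (cnj (M $ p $ k)) (T (origin_rep k)) \<in> H" for k by (rule H.scale_V[OF TH])
  have s: "s \<in> H" unfolding s_def by (intro V.subspace_sum[OF H.subspace_V] mem)
  have UH: "?U h F \<in> H" if "h \<in> carrier SU11_cover" "F \<in> H" for h F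
    using U_act_facts that by blast
  have "F w $ p = ipH F (?U g s)" if F: "F \<in> H" for F
  proof -
    let ?F = "?U ?gi F"
    note F' = UH[OF gi F]
    have "?U g ?F = F"
      using U_act_facts g gi F by (metis G.r_inv)
    have "cover_act ?gi w = moebius (cover_proj ?gi ** cover_proj g) 0"
      unfolding gw[symmetric]
      by (rule moebius_mult(1)[OF cover_proj_SU11[OF gi] cover_proj_SU11[OF g], symmetric]) simp
    also have "\<dots> = 0"
      using g by (simp add: cover_proj_mult[OF gi g, symmetric] cover_proj_one moebius_one)
    finally have w0: "cover_act ?gi w = 0" .
    have "F w = ?U g ?F w" using \<open>?U g ?F = F\<close> by simp
    also have "\<dots> = M *v ?F 0"
      using w w0 by (simp add: U_act_eq multiplier_pullback_def on_disc_def M_def del: mem_ball mem_ball_0)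
    finally have "F w $ p = (\<Sum>k\<in>UNIV. M $ p $ k * ?F 0 $ k)" by (simp add: matrix_vector_mult_def)
    also have "\<dots> = ipH ?F s"
      unfolding s_def H.ip_sum_right[OF mem F'] H.ip_scale_right[OF TH F'] H_at_0[OF F'] by simp
    also have "\<dots> = ipH (?U g ?F) (?U g s)" using U_act_facts g F' s by metis
    finally show ?thesis using \<open>?U g ?F = F\<close> by simp
  qed
  then show ?thesis using UH[OF g s] by blast
qed

lemma kernel_exists:
  "\<exists>K. has_reproducing_kernel H ipH K \<and>
     (\<forall>l. block blk l l (K 0 0) =
        (\<Sum>j=0..l. (1 / fact (l - j) * (1 / pochhammer (2 * \<eta> + 2 * real j) (l - j))) *\<^sub>R
           (Yprod blk Y l j ** block blk j j N ** adj (block blk j j N) ** adj (Yprod blk Y l j))))"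
proof -
  \<comment> \<open>at \<open>0\<close> the explicit representers are chosen, so that \<open>K 0 0\<close> can be computed\<close>
  have "\<forall>w\<in>disc. \<forall>p. \<exists>r. r \<in> H \<and> (\<forall>F\<in>H. F w $ p = ipH F r) \<and> (w = 0 \<longrightarrow> r = T (origin_rep p))"
  proof (intro ballI allI)
    fix w p assume w: "w \<in> disc"
    show "\<exists>r. r \<in> H \<and> (\<forall>F\<in>H. F w $ p = ipH F r) \<and> (w = 0 \<longrightarrow> r = T (origin_rep p))"
    proof (cases "w = 0")
      case True
      then show ?thesis using H_at_0 origin_rep_in_V by (auto simp: H_eq)
    next
      case False
      then show ?thesis using representer_exists[OF w, of p] by blast
    qed
  qed
  then obtain R where R: "\<And>w p. w \<in> disc \<Longrightarrow> R w p \<in> H"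
    "\<And>w p F. w \<in> disc \<Longrightarrow> F \<in> H \<Longrightarrow> F w $ p = ipH F (R w p)"
    "\<And>p. R 0 p = T (origin_rep p)"
    by (metis centre_in_ball zero_less_one)
  define K where "K = (\<lambda>z w. \<chi> i j. R w j z $ i)"
  have off: "F z = 0" if "F \<in> H" "z \<notin> disc" for F z
    using H_hol that by (auto simp: hol_disc_vec_def hol_disc_def vec_eq_iff)
  have "has_reproducing_kernel H ipH K"
    unfolding K_def
    by (rule reproducing_kernel_of_representers[OF hilbert_H]) (fact off R(1) R(2))+
  moreover have "block blk l l (K 0 0) =
        (\<Sum>j=0..l. (1 / fact (l - j) * (1 / pochhammer (2 * \<eta> + 2 * real j) (l - j))) *\<^sub>R
           (Yprod blk Y l j ** block blk j j N ** adj (block blk j j N) ** adj (Yprod blk Y l j)))" for l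
  proof -
    have K00: "K 0 0 $ p $ k = ipV (origin_rep k) (origin_rep p)" for p k
      by (simp add: K_def R(3) T_at_0 origin_rep_in_V)
    have "block blk l l (K 0 0) $ p $ k =
        (\<Sum>j=0..l. (1 / fact (l - j) * (1 / pochhammer (2 * \<eta> + 2 * real j) (l - j))) *\<^sub>R
           (Yprod blk Y l j ** block blk j j N ** adj (block blk j j N) ** adj (Yprod blk Y l j))) $ p $ k" for p k
    proof (cases "blk p = l \<and> blk k = l")
      case True
      then have "block blk l l (K 0 0) $ p $ k = ipV (origin_rep k) (origin_rep p)" by (simp add: block_def K00)
      also have "\<dots> = (\<Sum>j=0..l. of_real (1 / fact (l - j) * (1 / pochhammer (2 * \<eta> + 2 * real j) (l - j)))
          * (\<Sum>i\<in>UNIV. if blk i = j then YN p i * cnj (YN k i) else 0))"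
        using True by (intro origin_rep_inner) auto
      also have "\<dots> = (\<Sum>j=0..l. (1 / fact (l - j) * (1 / pochhammer (2 * \<eta> + 2 * real j) (l - j))) *\<^sub>R
           ((Yprod blk Y l j ** block blk j j N ** adj (block blk j j N) ** adj (Yprod blk Y l j)) $ p $ k))"
        by (intro sum.cong refl, subst block_product_entry) (use True in \<open>auto simp: scaleR_conv_of_real\<close>)
      finally show ?thesis by simp
    next
      case False
      then have "block blk l l (K 0 0) $ p $ k = 0" by (auto simp: block_def)
      moreover have "(Yprod blk Y l j ** block blk j j N ** adj (block blk j j N) ** adj (Yprod blk Y l j)) $ p $ k = 0"
        if "j \<in> {0..l}" for j
        using that False by (subst block_product_entry) auto
      ultimately show ?thesis by simp
    qed
    then show ?thesis by (simp add: vec_eq_iff)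
  qed
  ultimately show ?thesis by blast
qed

end

theorem theorem3p1:
  fixes m :: nat and blk :: "'n::finite \<Rightarrow> nat" and \<eta> :: real
    and Y N :: "complex ^ 'n ^ 'n"
  assumes blk: "range blk = {..m}"
    and eta: "\<eta> > 0"
    and Y: "block_subdiagonal blk Y"
    and N: "block_diagonal blk N" "invertible N" "block blk 0 0 N = block blk 0 0 (mat 1)"
  shows "hilbert_isomorphism scale_vfun
           (A_carrier blk \<eta>) (A_inner blk \<eta>)
           (H_carrier blk \<eta> Y N) (H_inner blk \<eta> Y N) (Gam_N blk \<eta> Y N)
       \<and> H_carrier blk \<eta> Y N \<subseteq> hol_disc_vec
       \<and> (\<forall>g\<in>carrier SU11_cover. \<forall>f\<in>A_carrier blk \<eta>.
            A_act blk \<eta> g f \<in> A_carrier blk \<eta> \<and>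
            Gam_N blk \<eta> Y N (A_act blk \<eta> g f) = U_act blk \<eta> Y g (Gam_N blk \<eta> Y N f))
       \<and> unitary_action SU11_cover scale_vfun (H_carrier blk \<eta> Y N) (H_inner blk \<eta> Y N)
            (U_act blk \<eta> Y)
       \<and> (\<forall>g\<in>carrier SU11_cover. \<forall>f\<in>H_carrier blk \<eta> Y N. \<forall>z\<in>disc.
            U_act blk \<eta> Y (inv\<^bsub>SU11_cover\<^esub> g) f z = multiplier blk \<eta> Y g z *v f (cover_act g z))
       \<and> (\<exists>K. has_reproducing_kernel (H_carrier blk \<eta> Y N) (H_inner blk \<eta> Y N) K \<and>
            (\<forall>l\<le>m. block blk l l (K 0 0) =
               (\<Sum>j=0..l. (1 / fact (l - j) * (1 / pochhammer (2 * \<eta> + 2 * real j) (l - j))) *\<^sub>R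
                  (Yprod blk Y l j ** block blk j j N ** adj (block blk j j N)
                     ** adj (Yprod blk Y l j)))))"
proof -
  interpret intertwining_data blk \<eta> Y N
    by unfold_locales (use eta N in auto)
  have mult: "U_act blk \<eta> Y (inv\<^bsub>SU11_cover\<^esub> g) f z = multiplier blk \<eta> Y g z *v f (cover_act g z)"
    if "g \<in> carrier SU11_cover" "z \<in> disc" for g f z
    using that by (simp add: U_act_eq multiplier_pullback_def on_disc_def del: mem_ball mem_ball_0)
  obtain K where "has_reproducing_kernel H ipH K"
    "\<forall>l. block blk l l (K 0 0) =
        (\<Sum>j=0..l. (1 / fact (l - j) * (1 / pochhammer (2 * \<eta> + 2 * real j) (l - j))) *\<^sub>R
           (Yprod blk Y l j ** block blk j j N ** adj (block blk j j N) ** adj (Yprod blk Y l j)))"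
    using kernel_exists by blast
  then show ?thesis
    using T_isomorphism H_hol T_A_act U_act_unitary mult by (intro conjI exI[of _ K]) blast+
qed

end
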